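(* Let $(\mathsf{C},\otimes,I)$ be a $\mathbb{Q}_{\ge 0}$-linear symmetric monoidal category and let $(A_n)_{n\ge 0}\in\mathsf{C}^{\mathbb{N}}$ be a graded object. There is a bijection between: (1) families of maps $(r_n)_{n\ge 0}$, $(s_n)_{n\ge 0}$ making $(A_n)_{n\ge 0}$ into a permutation splitting; (2) families of maps $(\nabla_{n,p})_{n,p\ge 0}$, $(\Delta_{n,p})_{n,p\ge 0}$, $\eta$, $\epsilon$ making $(A_n)_{n\ge 0}$ into a binomial bimonoid. The two mutually inverse assignments are as follows. From (1) to (2): $\eta:=r_0$, $\epsilon:=s_0$, and for all $n,p\ge 0$, $$\nabla_{n,p}:=(s_n\otimes s_p);r_{n+p},\qquad \Delta_{n,p}:=\binom{n+p}{n}\, s_{n+p};(r_n\otimes r_p).$$ From (2) to (1): $r_0:=\eta$, $s_0:=\epsilon$, and for every $n\ge 1$, $$r_n:=\nabla_{1,\dots,1},\qquad s_n:=\frac{1}{n!}\Delta_{1,\dots,1}\qquad (n\text{ times }1),$$ where for $n=1$ these mean $r_1=s_1=\mathsf{id}_{A_1}$.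
   Context: Conventions. $f;g$ denotes composition in diagrammatic order (first $f$, then $g$); $\otimes$ binds tighter than $;$. Symmetric monoidal categories are treated as strict (unitors and associators suppressed). $\gamma_{A,B}:A\otimes B\to B\otimes A$ is the symmetry. For $\sigma\in S_n$, the same symbol $\sigma:A^{\otimes n}\to A^{\otimes n}$ denotes the natural transformation induced by the symmetry: the adjacent transposition $(a,a+1)$ acts as $\mathsf{id}_{A^{\otimes(a-1)}}\otimes\gamma_{A,A}\otimes\mathsf{id}_{A^{\otimes(n-a-1)}}$, and $\sigma;\tau$ acts as the composite. $A^{\otimes 0}=I$; $S_0,S_1$ are trivial. A $\mathbb{Q}_{\ge 0}$-linear symmetric monoidal category is a symmetric monoidal category in which every hom-set is a module over the commutative semiring $\mathbb{Q}_{\ge 0}$ (a commutative monoid with an action of $\mathbb{Q}_{\ge 0}$ satisfying the usual module axioms), and both composition and $\otimes$ of morphisms are $\mathbb{Q}_{\ge 0}$-bilinear (in particular preserve $0$ in each variable). A graded object is a family $(A_n)_{n\ge 0}\in\mathsf{C}^{\mathbb{N}}$. A permutation splitting is a graded object $(A_n)_{n\ge 0}$ with morphisms $r_n:A_1^{\otimes n}\to A_n$ and $s_n:A_n\to A_1^{\otimes n}$ ($n\ge 0$) such that $r_n;s_n=\frac{1}{n!}\sum_{\sigma\in S_n}\sigma$ and $s_n;r_n=\mathsf{id}_{A_n}$ for every $n\in\mathbb{N}$, and $r_1=s_1=\mathsf{id}_{A_1}$. A binomial bimonoid is a graded object $(A_n)_{n\ge 0}$ with maps $\nabla_{n,p}:A_n\otimes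 A_p\to A_{n+p}$, $\Delta_{n,p}:A_{n+p}\to A_n\otimes A_p$ ($n,p\ge 0$), $\eta:I\to A_0$, $\epsilon:A_0\to I$ such that, for all $n,p,q,r\ge 0$: (i) unitality $\eta\otimes\mathsf{id}_{A_n};\nabla_{0,n}=\mathsf{id}_{A_n}$; (ii) associativity $\nabla_{n,p}\otimes\mathsf{id}_{A_q};\nabla_{n+p,q}=\mathsf{id}_{A_n}\otimes\nabla_{p,q};\nabla_{n,p+q}$; (iii) commutativity $\gamma_{A_n,A_p};\nabla_{p,n}=\nabla_{n,p}$; (iv) counitality $\Delta_{0,n};\epsilon\otimes\mathsf{id}_{A_n}=\mathsf{id}_{A_n}$; (v) coassociativity $\Delta_{n+p,q};\Delta_{n,p}\otimes\mathsf{id}_{A_q}=\Delta_{n,p+q};\mathsf{id}_{A_n}\otimes\Delta_{p,q}$; (vi) cocommutativity $\Delta_{n,p};\gamma_{A_n,A_p}=\Delta_{p,n}$; (vii) $\nabla_{0,0};\epsilon=\epsilon\otimes\epsilon$; (viii) $\eta;\Delta_{0,0}=\eta\otimes\eta$; (ix) $\eta;\epsilon=\mathsf{id}_I$; (x) whenever $n+p=q+r$, $\nabla_{n,p};\Delta_{q,r}=\sum \Delta_{a,b}\otimes\Delta_{c,d};\mathsf{id}_{A_a}\otimes\gamma_{A_b,A_c}\otimes\mathsf{id}_{A_d};\nabla_{a,c}\otimes\nabla_{b,d}$, the sum being over all $a,b,c,d\ge 0$ with $a+b=n$, $c+d=p$, $a+c=q$, $b+d=r$; (xi) $\epsilon;\eta=\mathsf{id}_{A_0}$;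 (xii) $\Delta_{n,p};\nabla_{n,p}=\binom{n+p}{n}\mathsf{id}_{A_{n+p}}$. Iterated maps: $\nabla_{n_1,\dots,n_{q+1}}:=\nabla_{n_1,\dots,n_q}\otimes\mathsf{id}_{A_{n_{q+1}}};\nabla_{n_1+\cdots+n_q,n_{q+1}}$ and $\Delta_{n_1,\dots,n_{q+1}}:=\Delta_{n_1+\cdots+n_q,n_{q+1}};\Delta_{n_1,\dots,n_q}\otimes\mathsf{id}_{A_{n_{q+1}}}$ for $q\ge 2$. *)

theory Defs
  imports Complex_Main "HOL-Algebra.FiniteProduct" "HOL-Combinatorics.Permutations"
begin

section \<open>Nonnegative-rational-linear strict symmetric monoidal categories\<close>

record ('o, 'm) category =
  Obj :: "'o set"
  Arr :: "'m set"
  src :: "'m \<Rightarrow> 'o"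
  tgt :: "'m \<Rightarrow> 'o"
  ident :: "'o \<Rightarrow> 'm"
  cmp :: "'m \<Rightarrow> 'm \<Rightarrow> 'm"  (infixl \<open>\<Zsemi>\<index>\<close> 60)

definition homset :: "('o, 'm, 'x) category_scheme \<Rightarrow> 'o \<Rightarrow> 'o \<Rightarrow> 'm set" where
  "homset C X Y = {f \<in> Arr C. src C f = X \<and> tgt C f = Y}"

locale category =
  fixes C :: "('o, 'm, 'x) category_scheme" (structure)
  assumes src_closed: "f \<in> Arr C \<Longrightarrow> src C f \<in> Obj C"
    and tgt_closed: "f \<in> Arr C \<Longrightarrow> tgt C f \<in> Obj C"
    and ident_closed: "X \<in> Obj C \<Longrightarrow> ident C X \<in> homset C X X"
    and cmp_closed: "f \<in> homset C X Y \<Longrightarrow> g \<in> homset C Y Z \<Longrightarrow> f \<Zsemi> g \<in> homset C X Z"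
    and cmp_assoc: "f \<in> homset C W X \<Longrightarrow> g \<in> homset C X Y \<Longrightarrow> h \<in> homset C Y Z \<Longrightarrow>
      (f \<Zsemi> g) \<Zsemi> h = f \<Zsemi> (g \<Zsemi> h)"
    and ident_cmp: "f \<in> homset C X Y \<Longrightarrow> ident C X \<Zsemi> f = f"
    and cmp_ident: "f \<in> homset C X Y \<Longrightarrow> f \<Zsemi> ident C Y = f"

record ('o, 'm) monoidal_category = "('o, 'm) category" +
  unit_obj :: 'o
  tensor_obj :: "'o \<Rightarrow> 'o \<Rightarrow> 'o"  (infixl \<open>\<otimes>\<^sub>o\<index>\<close> 70)
  tensor_arr :: "'m \<Rightarrow> 'm \<Rightarrow> 'm"  (infixl \<open>\<otimes>\<^sub>m\<index>\<close> 70)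
  symm :: "'o \<Rightarrow> 'o \<Rightarrow> 'm"  (\<open>\<gamma>\<index>\<close>)

text \<open>Only one hexagon is assumed: the other one, and triviality of the symmetry at the unit
  object, follow from it together with \<open>symm_inverse\<close>.\<close>

locale strict_symmetric_monoidal_category = category C
  for C :: "('o, 'm, 'x) monoidal_category_scheme" (structure) +
  assumes unit_closed: "unit_obj C \<in> Obj C"
    and tensor_obj_closed: "X \<in> Obj C \<Longrightarrow> Y \<in> Obj C \<Longrightarrow> X \<otimes>\<^sub>o Y \<in> Obj C"
    and tensor_arr_closed: "f \<in> homset C X Y \<Longrightarrow> g \<in> homset C X' Y' \<Longrightarrow>
      f \<otimes>\<^sub>m g \<in> homset C (X \<otimes>\<^sub>o X') (Y \<otimes>\<^sub>o Y')"
    and tensor_ident: "X \<in> Obj C \<Longrightarrow> Y \<in> Obj C \<Longrightarrow> ident C X \<otimes>\<^sub>m ident C Y = ident C (X \<otimes>\<^sub>o Y)"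
    and interchange: "f \<in> homset C X Y \<Longrightarrow> g \<in> homset C Y Z \<Longrightarrow>
      f' \<in> homset C X' Y' \<Longrightarrow> g' \<in> homset C Y' Z' \<Longrightarrow>
      (f \<Zsemi> g) \<otimes>\<^sub>m (f' \<Zsemi> g') = (f \<otimes>\<^sub>m f') \<Zsemi> (g \<otimes>\<^sub>m g')"
    and tensor_obj_assoc: "X \<in> Obj C \<Longrightarrow> Y \<in> Obj C \<Longrightarrow> Z \<in> Obj C \<Longrightarrow>
      (X \<otimes>\<^sub>o Y) \<otimes>\<^sub>o Z = X \<otimes>\<^sub>o (Y \<otimes>\<^sub>o Z)"
    and unit_tensor_obj: "X \<in> Obj C \<Longrightarrow> unit_obj C \<otimes>\<^sub>o X = X"
    and tensor_obj_unit: "X \<in> Obj C \<Longrightarrow> X \<otimes>\<^sub>o unit_obj C = X"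
    and tensor_arr_assoc: "f \<in> Arr C \<Longrightarrow> g \<in> Arr C \<Longrightarrow> h \<in> Arr C \<Longrightarrow>
      (f \<otimes>\<^sub>m g) \<otimes>\<^sub>m h = f \<otimes>\<^sub>m (g \<otimes>\<^sub>m h)"
    and unit_tensor_arr: "f \<in> Arr C \<Longrightarrow> ident C (unit_obj C) \<otimes>\<^sub>m f = f"
    and tensor_arr_unit: "f \<in> Arr C \<Longrightarrow> f \<otimes>\<^sub>m ident C (unit_obj C) = f"
    and symm_closed: "X \<in> Obj C \<Longrightarrow> Y \<in> Obj C \<Longrightarrow> \<gamma> X Y \<in> homset C (X \<otimes>\<^sub>o Y) (Y \<otimes>\<^sub>o X)"
    and symm_natural: "f \<in> homset C X Y \<Longrightarrow> g \<in> homset C X' Y' \<Longrightarrow>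
      (f \<otimes>\<^sub>m g) \<Zsemi> \<gamma> Y Y' = \<gamma> X X' \<Zsemi> (g \<otimes>\<^sub>m f)"
    and symm_inverse: "X \<in> Obj C \<Longrightarrow> Y \<in> Obj C \<Longrightarrow> \<gamma> X Y \<Zsemi> \<gamma> Y X = ident C (X \<otimes>\<^sub>o Y)"
    and hexagon: "X \<in> Obj C \<Longrightarrow> Y \<in> Obj C \<Longrightarrow> Z \<in> Obj C \<Longrightarrow>
      \<gamma> X (Y \<otimes>\<^sub>o Z) = (\<gamma> X Y \<otimes>\<^sub>m ident C Z) \<Zsemi> (ident C Y \<otimes>\<^sub>m \<gamma> X Z)"

record ('o, 'm) linear_monoidal_category = "('o, 'm) monoidal_category" +
  zero_arr :: "'o \<Rightarrow> 'o \<Rightarrow> 'm"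
  add_arr :: "'m \<Rightarrow> 'm \<Rightarrow> 'm"  (infixl \<open>\<oplus>\<^sub>m\<index>\<close> 55)
  scale :: "rat \<Rightarrow> 'm \<Rightarrow> 'm"  (infixr \<open>\<odot>\<^sub>m\<index>\<close> 65)

text \<open>The additive monoid of a hom-set, as a (multiplicatively written) monoid, so that
  \<^const>\<open>finprod\<close> is the finite sum of parallel arrows.\<close>

definition hom_monoid ::
    "('o, 'm, 'x) linear_monoidal_category_scheme \<Rightarrow> 'o \<Rightarrow> 'o \<Rightarrow> 'm monoid" where
  "hom_monoid C X Y = \<lparr>carrier = homset C X Y, monoid.mult = add_arr C, one = zero_arr C X Y\<rparr>"

text \<open>The semiring of scalars consists of the nonnegative elements of \<^typ>\<open>rat\<close>; nothing is
  assumed about \<open>a \<odot>\<^sub>m f\<close> for negative \<open>a\<close>.\<close>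

locale nnrat_linear_symmetric_monoidal_category = strict_symmetric_monoidal_category C
  for C :: "('o, 'm, 'x) linear_monoidal_category_scheme" (structure) +
  assumes hom_comm_monoid: "X \<in> Obj C \<Longrightarrow> Y \<in> Obj C \<Longrightarrow> comm_monoid (hom_monoid C X Y)"
    and scale_closed: "0 \<le> a \<Longrightarrow> f \<in> homset C X Y \<Longrightarrow> a \<odot>\<^sub>m f \<in> homset C X Y"
    and scale_add_left: "0 \<le> a \<Longrightarrow> 0 \<le> b \<Longrightarrow> f \<in> homset C X Y \<Longrightarrow>
      (a + b) \<odot>\<^sub>m f = a \<odot>\<^sub>m f \<oplus>\<^sub>m b \<odot>\<^sub>m f"
    and scale_add_right: "0 \<le> a \<Longrightarrow> f \<in> homset C X Y \<Longrightarrow> g \<in> homset C X Y \<Longrightarrow>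
      a \<odot>\<^sub>m (f \<oplus>\<^sub>m g) = a \<odot>\<^sub>m f \<oplus>\<^sub>m a \<odot>\<^sub>m g"
    and scale_mult: "0 \<le> a \<Longrightarrow> 0 \<le> b \<Longrightarrow> f \<in> homset C X Y \<Longrightarrow>
      (a * b) \<odot>\<^sub>m f = a \<odot>\<^sub>m b \<odot>\<^sub>m f"
    and scale_one: "f \<in> homset C X Y \<Longrightarrow> 1 \<odot>\<^sub>m f = f"
    and scale_zero_left: "f \<in> homset C X Y \<Longrightarrow> 0 \<odot>\<^sub>m f = zero_arr C X Y"
    and scale_zero_right: "0 \<le> a \<Longrightarrow> X \<in> Obj C \<Longrightarrow> Y \<in> Obj C \<Longrightarrow>
      a \<odot>\<^sub>m zero_arr C X Y = zero_arr C X Y"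
    and add_cmp: "f \<in> homset C X Y \<Longrightarrow> f' \<in> homset C X Y \<Longrightarrow> g \<in> homset C Y Z \<Longrightarrow>
      (f \<oplus>\<^sub>m f') \<Zsemi> g = (f \<Zsemi> g) \<oplus>\<^sub>m (f' \<Zsemi> g)"
    and cmp_add: "f \<in> homset C X Y \<Longrightarrow> g \<in> homset C Y Z \<Longrightarrow> g' \<in> homset C Y Z \<Longrightarrow>
      f \<Zsemi> (g \<oplus>\<^sub>m g') = (f \<Zsemi> g) \<oplus>\<^sub>m (f \<Zsemi> g')"
    and zero_cmp: "X \<in> Obj C \<Longrightarrow> g \<in> homset C Y Z \<Longrightarrow> zero_arr C X Y \<Zsemi> g = zero_arr C X Z"
    and cmp_zero: "f \<in> homset C X Y \<Longrightarrow> Z \<in> Obj C \<Longrightarrow> f \<Zsemi> zero_arr C Y Z = zero_arr C X Z"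
    and scale_cmp: "0 \<le> a \<Longrightarrow> f \<in> homset C X Y \<Longrightarrow> g \<in> homset C Y Z \<Longrightarrow>
      (a \<odot>\<^sub>m f) \<Zsemi> g = a \<odot>\<^sub>m (f \<Zsemi> g)"
    and cmp_scale: "0 \<le> a \<Longrightarrow> f \<in> homset C X Y \<Longrightarrow> g \<in> homset C Y Z \<Longrightarrow>
      f \<Zsemi> (a \<odot>\<^sub>m g) = a \<odot>\<^sub>m (f \<Zsemi> g)"
    and add_tensor: "f \<in> homset C X Y \<Longrightarrow> f' \<in> homset C X Y \<Longrightarrow> g \<in> homset C X' Y' \<Longrightarrow>
      (f \<oplus>\<^sub>m f') \<otimes>\<^sub>m g = (f \<otimes>\<^sub>m g) \<oplus>\<^sub>m (f' \<otimes>\<^sub>m g)"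
    and tensor_add: "f \<in> homset C X Y \<Longrightarrow> g \<in> homset C X' Y' \<Longrightarrow> g' \<in> homset C X' Y' \<Longrightarrow>
      f \<otimes>\<^sub>m (g \<oplus>\<^sub>m g') = (f \<otimes>\<^sub>m g) \<oplus>\<^sub>m (f \<otimes>\<^sub>m g')"
    and zero_tensor: "X \<in> Obj C \<Longrightarrow> Y \<in> Obj C \<Longrightarrow> g \<in> homset C X' Y' \<Longrightarrow>
      zero_arr C X Y \<otimes>\<^sub>m g = zero_arr C (X \<otimes>\<^sub>o X') (Y \<otimes>\<^sub>o Y')"
    and tensor_zero: "f \<in> homset C X Y \<Longrightarrow> X' \<in> Obj C \<Longrightarrow> Y' \<in> Obj C \<Longrightarrow>
      f \<otimes>\<^sub>m zero_arr C X' Y' = zero_arr C (X \<otimes>\<^sub>o X') (Y \<otimes>\<^sub>o Y')"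
    and scale_tensor: "0 \<le> a \<Longrightarrow> f \<in> homset C X Y \<Longrightarrow> g \<in> homset C X' Y' \<Longrightarrow>
      (a \<odot>\<^sub>m f) \<otimes>\<^sub>m g = a \<odot>\<^sub>m (f \<otimes>\<^sub>m g)"
    and tensor_scale: "0 \<le> a \<Longrightarrow> f \<in> homset C X Y \<Longrightarrow> g \<in> homset C X' Y' \<Longrightarrow>
      f \<otimes>\<^sub>m (a \<odot>\<^sub>m g) = a \<odot>\<^sub>m (f \<otimes>\<^sub>m g)"


section \<open>Tensor powers and the action of permutations\<close>

primrec tensor_pow :: "('o, 'm, 'x) monoidal_category_scheme \<Rightarrow> 'o \<Rightarrow> nat \<Rightarrow> 'o" where
  "tensor_pow C X 0 = unit_obj C"
| "tensor_pow C X (Suc n) = tensor_obj C (tensor_pow C X n) X"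

text \<open>The tensor factors are numbered from 0, so \<open>transpose a (Suc a)\<close> exchanges the factors
  preceded by \<open>a\<close> others.  The diagrammatic composite \<open>\<sigma>;\<tau>\<close> of permutations is \<open>\<tau> \<circ> \<sigma>\<close>.  By coherence
  for symmetric monoidal categories there is exactly one family \<open>\<rho>\<close> as described; values outside
  the symmetric group are fixed by extensionality.\<close>

definition perm_action ::
    "('o, 'm, 'x) monoidal_category_scheme \<Rightarrow> 'o \<Rightarrow> nat \<Rightarrow> (nat \<Rightarrow> nat) \<Rightarrow> 'm" where
  "perm_action C X n = (THE \<rho>.
     \<rho> \<in> {\<sigma>. \<sigma> permutes {..<n}} \<rightarrow>\<^sub>E homset C (tensor_pow C X n) (tensor_pow C X n) \<and>
     \<rho> id = ident C (tensor_pow C X n) \<and>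
     (\<forall>a. Suc a < n \<longrightarrow> \<rho> (transpose a (Suc a)) =
        ident C (tensor_pow C X a) \<otimes>\<^sub>m\<^bsub>C\<^esub> \<gamma>\<^bsub>C\<^esub> X X \<otimes>\<^sub>m\<^bsub>C\<^esub> ident C (tensor_pow C X (n - a - 2))) \<and>
     (\<forall>\<sigma> \<tau>. \<sigma> permutes {..<n} \<longrightarrow> \<tau> permutes {..<n} \<longrightarrow> \<rho> (\<tau> \<circ> \<sigma>) = \<rho> \<sigma> \<Zsemi>\<^bsub>C\<^esub> \<rho> \<tau>))"


section \<open>Permutation splittings and binomial bimonoids\<close>

text \<open>Below, \<open>\<mu> n p\<close> and \<open>\<delta> n p\<close> stand for \<open>\<nabla>\<close> and \<open>\<Delta>\<close> with indices \<open>n, p\<close> (these two symbols are not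
  letters in Isabelle).\<close>

context nnrat_linear_symmetric_monoidal_category
begin

definition permutation_splitting ::
    "(nat \<Rightarrow> 'o) \<Rightarrow> (nat \<Rightarrow> 'm) \<Rightarrow> (nat \<Rightarrow> 'm) \<Rightarrow> bool" where
  "permutation_splitting A r s \<longleftrightarrow>
     (\<forall>n. r n \<in> homset C (tensor_pow C (A 1) n) (A n)) \<and>
     (\<forall>n. s n \<in> homset C (A n) (tensor_pow C (A 1) n)) \<and>
     (\<forall>n. r n \<Zsemi> s n = (1 / fact n) \<odot>\<^sub>m
        finprod (hom_monoid C (tensor_pow C (A 1) n) (tensor_pow C (A 1) n))
          (perm_action C (A 1) n) {\<sigma>. \<sigma> permutes {..<n}}) \<and>
     (\<forall>n. s n \<Zsemi> r n = ident C (A n)) \<and>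
     r 1 = ident C (A 1) \<and> s 1 = ident C (A 1)"

definition binomial_bimonoid ::
    "(nat \<Rightarrow> 'o) \<Rightarrow> (nat \<Rightarrow> nat \<Rightarrow> 'm) \<Rightarrow> (nat \<Rightarrow> nat \<Rightarrow> 'm) \<Rightarrow> 'm \<Rightarrow> 'm \<Rightarrow> bool" where
  "binomial_bimonoid A \<mu> \<delta> \<eta> \<epsilon> \<longleftrightarrow>
     (\<forall>n p. \<mu> n p \<in> homset C (A n \<otimes>\<^sub>o A p) (A (n + p))) \<and>
     (\<forall>n p. \<delta> n p \<in> homset C (A (n + p)) (A n \<otimes>\<^sub>o A p)) \<and>
     \<eta> \<in> homset C (unit_obj C) (A 0) \<and>
     \<epsilon> \<in> homset C (A 0) (unit_obj C) \<and>
     (\<forall>n. (\<eta> \<otimes>\<^sub>m ident C (A n)) \<Zsemi> \<mu> 0 n = ident C (A n)) \<and>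
     (\<forall>n p q. (\<mu> n p \<otimes>\<^sub>m ident C (A q)) \<Zsemi> \<mu> (n + p) q =
        (ident C (A n) \<otimes>\<^sub>m \<mu> p q) \<Zsemi> \<mu> n (p + q)) \<and>
     (\<forall>n p. \<gamma> (A n) (A p) \<Zsemi> \<mu> p n = \<mu> n p) \<and>
     (\<forall>n. \<delta> 0 n \<Zsemi> (\<epsilon> \<otimes>\<^sub>m ident C (A n)) = ident C (A n)) \<and>
     (\<forall>n p q. \<delta> (n + p) q \<Zsemi> (\<delta> n p \<otimes>\<^sub>m ident C (A q)) =
        \<delta> n (p + q) \<Zsemi> (ident C (A n) \<otimes>\<^sub>m \<delta> p q)) \<and>
     (\<forall>n p. \<delta> n p \<Zsemi> \<gamma> (A n) (A p) = \<delta> p n) \<and>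
     \<mu> 0 0 \<Zsemi> \<epsilon> = \<epsilon> \<otimes>\<^sub>m \<epsilon> \<and>
     \<eta> \<Zsemi> \<delta> 0 0 = \<eta> \<otimes>\<^sub>m \<eta> \<and>
     \<eta> \<Zsemi> \<epsilon> = ident C (unit_obj C) \<and>
     (\<forall>n p q r. n + p = q + r \<longrightarrow> \<mu> n p \<Zsemi> \<delta> q r =
        finprod (hom_monoid C (A n \<otimes>\<^sub>o A p) (A q \<otimes>\<^sub>o A r))
          (\<lambda>(a, b, c, d). (\<delta> a b \<otimes>\<^sub>m \<delta> c d)
             \<Zsemi> (ident C (A a) \<otimes>\<^sub>m \<gamma> (A b) (A c) \<otimes>\<^sub>m ident C (A d))
             \<Zsemi> (\<mu> a c \<otimes>\<^sub>m \<mu> b d))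
          {(a, b, c, d). a + b = n \<and> c + d = p \<and> a + c = q \<and> b + d = r}) \<and>
     \<epsilon> \<Zsemi> \<eta> = ident C (A 0) \<and>
     (\<forall>n p. \<delta> n p \<Zsemi> \<mu> n p = of_nat ((n + p) choose n) \<odot>\<^sub>m ident C (A (n + p)))"

definition permutation_splittings :: "(nat \<Rightarrow> 'o) \<Rightarrow> ((nat \<Rightarrow> 'm) \<times> (nat \<Rightarrow> 'm)) set" where
  "permutation_splittings A = {(r, s). permutation_splitting A r s}"

definition binomial_bimonoids ::
    "(nat \<Rightarrow> 'o) \<Rightarrow> ((nat \<Rightarrow> nat \<Rightarrow> 'm) \<times> (nat \<Rightarrow> nat \<Rightarrow> 'm) \<times> 'm \<times> 'm) set" where
  "binomial_bimonoids A = {(\<mu>, \<delta>, \<eta>, \<epsilon>). binomial_bimonoid A \<mu> \<delta> \<eta> \<epsilon>}"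

text \<open>\<open>iterated_mult A \<mu> k q\<close> is the iterated multiplication with the \<open>q + 1\<close> indices
  \<open>k 0, \<dots>, k q\<close>; a single index gives the identity.  Likewise for \<open>iterated_comult\<close>.\<close>

fun iterated_mult ::
    "(nat \<Rightarrow> 'o) \<Rightarrow> (nat \<Rightarrow> nat \<Rightarrow> 'm) \<Rightarrow> (nat \<Rightarrow> nat) \<Rightarrow> nat \<Rightarrow> 'm" where
  "iterated_mult A \<mu> k 0 = ident C (A (k 0))"
| "iterated_mult A \<mu> k (Suc 0) = \<mu> (k 0) (k 1)"
| "iterated_mult A \<mu> k (Suc (Suc q)) =
     (iterated_mult A \<mu> k (Suc q) \<otimes>\<^sub>m ident C (A (k (Suc (Suc q)))))
       \<Zsemi> \<mu> (\<Sum>i\<le>Suc q. k i) (k (Suc (Suc q)))"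

fun iterated_comult ::
    "(nat \<Rightarrow> 'o) \<Rightarrow> (nat \<Rightarrow> nat \<Rightarrow> 'm) \<Rightarrow> (nat \<Rightarrow> nat) \<Rightarrow> nat \<Rightarrow> 'm" where
  "iterated_comult A \<delta> k 0 = ident C (A (k 0))"
| "iterated_comult A \<delta> k (Suc 0) = \<delta> (k 0) (k 1)"
| "iterated_comult A \<delta> k (Suc (Suc q)) =
     \<delta> (\<Sum>i\<le>Suc q. k i) (k (Suc (Suc q)))
       \<Zsemi> (iterated_comult A \<delta> k (Suc q) \<otimes>\<^sub>m ident C (A (k (Suc (Suc q)))))"

definition to_bimonoid :: "(nat \<Rightarrow> 'm) \<times> (nat \<Rightarrow> 'm) \<Rightarrow>
    (nat \<Rightarrow> nat \<Rightarrow> 'm) \<times> (nat \<Rightarrow> nat \<Rightarrow> 'm) \<times> 'm \<times> 'm" where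
  "to_bimonoid = (\<lambda>(r, s).
     (\<lambda>n p. (s n \<otimes>\<^sub>m s p) \<Zsemi> r (n + p),
      \<lambda>n p. of_nat ((n + p) choose n) \<odot>\<^sub>m (s (n + p) \<Zsemi> (r n \<otimes>\<^sub>m r p)),
      r 0,
      s 0))"

definition to_splitting :: "(nat \<Rightarrow> 'o) \<Rightarrow>
    (nat \<Rightarrow> nat \<Rightarrow> 'm) \<times> (nat \<Rightarrow> nat \<Rightarrow> 'm) \<times> 'm \<times> 'm \<Rightarrow> (nat \<Rightarrow> 'm) \<times> (nat \<Rightarrow> 'm)" where
  "to_splitting A = (\<lambda>(\<mu>, \<delta>, \<eta>, \<epsilon>).
     (\<lambda>n. if n = 0 then \<eta> else iterated_mult A \<mu> (\<lambda>_. 1) (n - 1),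
      \<lambda>n. if n = 0 then \<epsilon> else (1 / fact n) \<odot>\<^sub>m iterated_comult A \<delta> (\<lambda>_. 1) (n - 1)))"

end

end

(* In a permutation splitting, A n is the image of the symmetrizer P n, the average of the permutations
   of n tensor factors of X = A 1. All axioms of a binomial bimonoid then follow from the fact that P n
   absorbs permutations, except for the compatibility of multiplication and comultiplication. That one is
   a double coset formula: binomial (n + p) q times P (n + p) is the sum, over all 2x2 tables (a, b, c, d)
   with row sums n, p and column sums q, r, of binomial n a * binomial p c times the block permutation
   exchanging the b and c middle factors, symmetrized on both sides. It is proved by induction on p,
   with Pascal's rule for the coefficients, from the recursion expressing (N + 1) P (N + 1) as P N on the
   first N factors followed by the sum of the N + 1 ways to reinsert the last factor.

   Conversely, in a binomial bimonoid the iterated maps satisfy r (n + 1) = (r n \<otimes> id); mult n 1 and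
   s (n + 1) = 1 / (n + 1) * comult n 1; (s n \<otimes> id). The compatibility axiom for mult n 1; comult n 1
   has only two summands, and it turns r (n + 1); s (n + 1) into the double coset formula for P (n + 1),
   because A 0 is isomorphic to the unit object. *)

theory Submission
  imports Defs
begin

section \<open>Coxeter presentation of the symmetric groups\<close>

text \<open>The action of permutations is a definite description, so nothing can be computed with it
  before a homomorphism with the prescribed values on adjacent transpositions is known to exist and
  to be unique. Uniqueness is generation by adjacent transpositions. Existence is the Coxeter
  presentation, whose braid relation is the Yang-Baxter equation for the symmetry. After that,
  concrete permutations are mostly avoided: an arrow only has to be recognized as the image of some
  permutation, because symmetrizers absorb them all. Hom-sets have no subtraction, so summands
  cannot be cancelled from an equation. Positive scalars can, which is why the recursion and the
  double coset formula may carry the factors n + 1 and binomial (n + p) q on the side of the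
  symmetrizer.\<close>

fun cycle :: "nat \<Rightarrow> nat \<Rightarrow> nat \<Rightarrow> nat" where
  "cycle 0 k = id"
| "cycle (Suc j) k = transpose k (Suc k) \<circ> cycle j (Suc k)"

text \<open>The recursion spells the cycle as a reduced word in adjacent transpositions; the closed
  form shows its role. For \<open>k + j = n\<close> these are the shortest representatives of the
  cosets of the permutations fixing \<open>n\<close> in those of \<open>{..<Suc n}\<close>, and the
  value \<open>k\<close> at \<open>n\<close> names the coset.\<close>

lemma cycle_apply:
  "cycle j k i = (if i = k + j then k else if k \<le> i \<and> i < k + j then Suc i else i)"
  by (induction j arbitrary: k i) (auto simp: transpose_def)

lemma cycle_permutes: "k + j < n \<Longrightarrow> cycle j k permutes {..<n}"
proof (induction j arbitrary: k)
  case (Suc j)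
  have "transpose k (Suc k) permutes {..<n}"
    using Suc.prems by (intro permutes_swap_id) auto
  with Suc.IH[of "Suc k"] Suc.prems have "transpose k (Suc k) \<circ> cycle j (Suc k) permutes {..<n}"
    by (intro permutes_compose) auto
  then show ?case
    by (simp add: comp_def)
qed auto

lemma cycle_commute_below:
  assumes "Suc a < k"
  shows "transpose a (Suc a) \<circ> cycle j k = cycle j k \<circ> transpose a (Suc a)"
  using assms by (auto simp: fun_eq_iff cycle_apply transpose_def)

text \<open>Inside its range the cycle is the successor map, so conjugation by it raises the index
  of an adjacent transposition by one. \<open>S_cycle_commute_above\<close> has to derive the same
  from the relations alone.\<close>

lemma cycle_commute_above:
  assumes "k \<le> a" "Suc a < k + j"
  shows "transpose (Suc a) (Suc (Suc a)) \<circ> cycle j k = cycle j k \<circ> transpose a (Suc a)"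
  using assms by (auto simp: fun_eq_iff cycle_apply transpose_def)

lemma permutes_remove_last:
  assumes "\<sigma> permutes {..<Suc n}" "\<sigma> n = n"
  shows "\<sigma> permutes {..<n}"
proof -
  have "\<sigma> permutes insert n {..<n}"
    using assms by (simp add: lessThan_Suc)
  then show ?thesis
    by (rule permutes_superset) (use assms in auto)
qed

lemma permutes_last_le: "\<sigma> permutes {..<Suc n} \<Longrightarrow> \<sigma> n \<le> n"
  using permutes_in_image[of \<sigma> "{..<Suc n}" n] by simp

text \<open>The cycle sends \<open>n\<close> to \<open>\<sigma> n\<close>, so undoing it after
  \<open>\<sigma>\<close> makes \<open>n\<close> a fixed point. This is the first factor of the
  normal form.\<close>

lemma inv_cycle_permutes:
  assumes "\<sigma> permutes {..<Suc n}"
  shows "inv_into UNIV (cycle (n - \<sigma> n) (\<sigma> n)) \<circ> \<sigma> permutes {..<n}"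
proof -
  note le = permutes_last_le[OF assms]
  have c: "cycle (n - \<sigma> n) (\<sigma> n) permutes {..<Suc n}"
    using le by (intro cycle_permutes) auto
  have "inv_into UNIV (cycle (n - \<sigma> n) (\<sigma> n)) (\<sigma> n) = n"
    using le by (subst permutes_inv_eq[OF c]) (simp add: cycle_apply)
  then show ?thesis
    using permutes_compose[OF assms permutes_inv[OF c]] by (simp add: permutes_remove_last)
qed

lemma cycle_comp_inv_cycle:
  assumes "\<sigma> permutes {..<Suc n}"
  shows "cycle (n - \<sigma> n) (\<sigma> n) \<circ> (inv_into UNIV (cycle (n - \<sigma> n) (\<sigma> n)) \<circ> \<sigma>) = \<sigma>"
proof -
  have c: "cycle (n - \<sigma> n) (\<sigma> n) permutes {..<Suc n}"
    using permutes_last_le[OF assms] by (intro cycle_permutes) auto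
  show ?thesis
    by (simp add: o_assoc permutes_inv_o[OF c])
qed

text \<open>Splitting off one cycle per point writes \<open>\<sigma>\<close> as a product of cycles,
  and each cycle is a word in adjacent transpositions. The rule carries identities from the
  generators to all permutations.\<close>

lemma permutes_adjacent_induct [consumes 1, case_names id swap]:
  assumes "\<sigma> permutes {..<n}"
    and "P id"
    and swap: "\<And>a \<sigma>. Suc a < n \<Longrightarrow> \<sigma> permutes {..<n} \<Longrightarrow> P \<sigma> \<Longrightarrow> P (transpose a (Suc a) \<circ> \<sigma>)"
  shows "P \<sigma>"
proof -
  have cyc: "P (cycle j k \<circ> \<sigma>)" if "P \<sigma>" "\<sigma> permutes {..<n}" "k + j < n" for j k \<sigma>
    using that
  proof (induction j arbitrary: k)
    case (Suc j)
    have "P (cycle j (Suc k) \<circ> \<sigma>)"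
      using Suc.prems by (intro Suc.IH) auto
    moreover have "cycle j (Suc k) \<circ> \<sigma> permutes {..<n}"
      using Suc.prems by (intro permutes_compose cycle_permutes) auto
    ultimately have "P (transpose k (Suc k) \<circ> (cycle j (Suc k) \<circ> \<sigma>))"
      using Suc.prems by (intro swap) auto
    then show ?case
      by (simp add: comp_def)
  qed auto
  \<comment> \<open>The set of points that may move shrinks with \<open>m\<close>, while
    \<open>n\<close> stays fixed because the assumption \<open>swap\<close> speaks of permutations
    of \<open>{..<n}\<close>.\<close>
  have "P \<sigma>" if "\<sigma> permutes {..<m}" "m \<le> n" for m
    using that
  proof (induction m arbitrary: \<sigma>)
    case 0
    then show ?case using \<open>P id\<close> by (simp add: id_def)
  next
    case (Suc m)
    let ?\<tau> = "inv_into UNIV (cycle (m - \<sigma> m) (\<sigma> m)) \<circ> \<sigma>"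
    have \<tau>: "?\<tau> permutes {..<m}"
      using Suc.prems by (intro inv_cycle_permutes)
    have "P (cycle (m - \<sigma> m) (\<sigma> m) \<circ> ?\<tau>)"
      using \<tau> Suc permutes_last_le[OF Suc.prems(1)]
      by (intro cyc) (auto intro: permutes_subset[OF \<tau>])
    then show ?case
      using cycle_comp_inv_cycle[OF Suc.prems(1)] by simp
  qed
  then show ?thesis
    using assms(1) by blast
qed

text \<open>A monoid is enough: involutivity makes the generators invertible, so the endomorphisms
  of an object can serve as \<open>G\<close>.\<close>

locale coxeter_monoid = monoid G for G (structure) +
  fixes N :: nat and S :: "nat \<Rightarrow> 'a"
  assumes S_closed: "Suc a < N \<Longrightarrow> S a \<in> carrier G"
    and S_involution: "Suc a < N \<Longrightarrow> S a \<otimes> S a = \<one>"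
    and S_commute: "Suc a < b \<Longrightarrow> Suc b < N \<Longrightarrow> S a \<otimes> S b = S b \<otimes> S a"
    and S_braid: "Suc (Suc a) < N \<Longrightarrow>
      S a \<otimes> S (Suc a) \<otimes> S a = S (Suc a) \<otimes> S a \<otimes> S (Suc a)"
begin

text \<open>A permutation of \<open>n + 1\<close> points factors uniquely as a permutation fixing the last point followed by a
  cycle. The homomorphism is read off from this normal form: multiplying by a generator either
  lengthens or shortens the cycle, or passes through it by the commutation and braid relations.\<close>

primrec S_cycle :: "nat \<Rightarrow> nat \<Rightarrow> 'a" where
  "S_cycle 0 k = \<one>"
| "S_cycle (Suc j) k = S_cycle j (Suc k) \<otimes> S k"

primrec S_perm :: "nat \<Rightarrow> (nat \<Rightarrow> nat) \<Rightarrow> 'a" where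
  "S_perm 0 \<sigma> = \<one>"
| "S_perm (Suc n) \<sigma> =
     S_perm n (inv_into UNIV (cycle (n - \<sigma> n) (\<sigma> n)) \<circ> \<sigma>) \<otimes> S_cycle (n - \<sigma> n) (\<sigma> n)"

lemma S_cycle_closed: "k + j < N \<Longrightarrow> S_cycle j k \<in> carrier G"
  by (induction j arbitrary: k) (auto simp: S_closed)

lemma S_cycle_commute_below:
  "Suc a < k \<Longrightarrow> k + j < N \<Longrightarrow> S_cycle j k \<otimes> S a = S a \<otimes> S_cycle j k"
proof (induction j arbitrary: k)
  case 0
  then show ?case by (simp add: S_closed)
next
  case (Suc j)
  have cl: "S a \<in> carrier G" "S k \<in> carrier G" "S_cycle j (Suc k) \<in> carrier G"
    using Suc.prems by (auto intro: S_closed S_cycle_closed)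
  have "S_cycle j (Suc k) \<otimes> S k \<otimes> S a = S_cycle j (Suc k) \<otimes> S a \<otimes> S k"
    using cl S_commute[of a k] Suc.prems by (simp add: m_assoc)
  also have "\<dots> = S a \<otimes> (S_cycle j (Suc k) \<otimes> S k)"
    using cl Suc.IH[of "Suc k"] Suc.prems by (simp add: m_assoc)
  finally show ?case by simp
qed

text \<open>The braid relation enters only at \<open>a = k\<close>, where the word ends in
  \<open>S (Suc k) \<otimes> S k\<close> and meets \<open>S (Suc k)\<close>. It brings an
  \<open>S k\<close> to the front of these three letters, and this letter commutes with the rest of
  the word, whose indices are at least \<open>k + 2\<close>. For \<open>a > k\<close> the new letter
  passes \<open>S k\<close> and the induction takes over.\<close>

lemma S_cycle_commute_above:
  "k \<le> a \<Longrightarrow> Suc a < k + j \<Longrightarrow> k + j < N \<Longrightarrow> S_cycle j k \<otimes> S (Suc a) = S a \<otimes> S_cycle j k"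
proof (induction j arbitrary: k)
  case 0
  then show ?case by simp
next
  case (Suc j)
  note prems = Suc.prems
  show ?case
  proof (cases "a = k")
    case True
    then obtain i where j: "j = Suc i"
      using prems by (cases j) auto
    let ?c = "S_cycle i (Suc (Suc k))"
    have cl: "S (Suc k) \<in> carrier G" "S k \<in> carrier G" "?c \<in> carrier G"
      using prems j by (auto intro: S_closed S_cycle_closed)
    have "?c \<otimes> S (Suc k) \<otimes> S k \<otimes> S (Suc k) = ?c \<otimes> (S (Suc k) \<otimes> S k \<otimes> S (Suc k))"
      using cl by (simp add: m_assoc)
    also have "\<dots> = ?c \<otimes> (S k \<otimes> S (Suc k) \<otimes> S k)"
      using prems j True by (simp add: S_braid)
    also have "\<dots> = S k \<otimes> (?c \<otimes> S (Suc k) \<otimes> S k)"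
      using cl prems j S_cycle_commute_below[of k "Suc (Suc k)" i]
      by (simp add: m_assoc[symmetric])
    finally show ?thesis
      using True j by simp
  next
    case False
    let ?c = "S_cycle j (Suc k)"
    have cl: "S (Suc a) \<in> carrier G" "S k \<in> carrier G" "S a \<in> carrier G" "?c \<in> carrier G"
      using prems False by (auto intro: S_closed S_cycle_closed)
    have "?c \<otimes> S k \<otimes> S (Suc a) = ?c \<otimes> S (Suc a) \<otimes> S k"
      using cl S_commute[of k "Suc a"] prems False by (simp add: m_assoc)
    also have "\<dots> = S a \<otimes> (?c \<otimes> S k)"
      using cl Suc.IH[of "Suc k"] prems False by (simp add: m_assoc)
    finally show ?thesis
      by simp
  qed
qed

lemma S_perm_closed: "\<sigma> permutes {..<n} \<Longrightarrow> n \<le> N \<Longrightarrow> S_perm n \<sigma> \<in> carrier G"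
proof (induction n arbitrary: \<sigma>)
  case (Suc n)
  then show ?case
    using permutes_last_le[OF Suc.prems(1)]
    by (auto intro!: Suc.IH inv_cycle_permutes S_cycle_closed)
qed auto

lemma S_perm_id: "S_perm n id = \<one>"
  by (induction n) auto

lemma S_perm_transpose:
  "\<sigma> permutes {..<n} \<Longrightarrow> n \<le> N \<Longrightarrow> Suc a < n \<Longrightarrow>
    S_perm n (transpose a (Suc a) \<circ> \<sigma>) = S_perm n \<sigma> \<otimes> S a"
proof (induction n arbitrary: \<sigma> a)
  case 0
  then show ?case by simp
next
  case (Suc n)
  define k where "k = \<sigma> n"
  define j where "j = n - k"
  have k: "k \<le> n" and kj: "k + j = n"
    using permutes_last_le[OF Suc.prems(1)] by (auto simp: k_def j_def)
  let ?s = "transpose a (Suc a)"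
  let ?\<tau> = "inv_into UNIV (cycle j k) \<circ> \<sigma>"
  have \<tau>: "?\<tau> permutes {..<n}"
    using inv_cycle_permutes[OF Suc.prems(1)] by (simp only: j_def k_def)
  have cp: "cycle j k permutes {..<Suc n}"
    using kj by (intro cycle_permutes) auto
  have bij: "bij (cycle i l)" for i l
    using cycle_permutes[of l i "Suc (l + i)"] permutes_bij by auto
  have cl: "S_perm n ?\<tau> \<in> carrier G" "S_cycle j k \<in> carrier G" "S a \<in> carrier G"
    using Suc.prems kj S_perm_closed[OF \<tau>] by (auto intro!: S_cycle_closed S_closed)
  have rec: "S_perm (Suc n) \<sigma> = S_perm n ?\<tau> \<otimes> S_cycle j k"
    by (simp add: k_def j_def)
  \<comment> \<open>A transposition that passes through the cycle comes out with an index
    \<open>b\<close> and then acts on the first factor of the normal form, where the induction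
    hypothesis applies.\<close>
  have inv_comp: "inv_into UNIV (cycle j k) \<circ> (?s \<circ> \<sigma>) = transpose b (Suc b) \<circ> ?\<tau>"
    if eq: "?s \<circ> cycle j k = cycle j k \<circ> transpose b (Suc b)" for b
  proof
    fix x
    have "?s (\<sigma> x) = cycle j k (transpose b (Suc b) (?\<tau> x))"
      using fun_cong[OF eq, of "?\<tau> x"] by (simp add: permutes_inverses[OF cp])
    then show "(inv_into UNIV (cycle j k) \<circ> (?s \<circ> \<sigma>)) x = (transpose b (Suc b) \<circ> ?\<tau>) x"
      by (simp add: permutes_inverses[OF cp])
  qed
  \<comment> \<open>In this order: the cycle grows by one letter, loses one, lets the generator
    through with index \<open>a\<close>, or lets it through with index \<open>a - 1\<close>.\<close>
  consider "k = Suc a" | "k = a" | "Suc a < k" | "k < a" by linarith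
  then have "S_perm (Suc n) (?s \<circ> \<sigma>) = S_perm (Suc n) \<sigma> \<otimes> S a"
  proof cases
    case 1
    then have n: "n - a = Suc j" using kj by simp
    have sn: "?s k = a" using 1 by simp
    have c: "cycle (Suc j) a = ?s \<circ> cycle j k" using 1 by simp
    have "inv_into UNIV (cycle (Suc j) a) \<circ> (?s \<circ> \<sigma>) = ?\<tau>"
      unfolding c using bij[of j k]
      by (simp add: o_inv_distrib fun_eq_iff)
    then have "S_perm (Suc n) (?s \<circ> \<sigma>) = S_perm n ?\<tau> \<otimes> S_cycle (Suc j) a"
      using n sn by (simp add: k_def[symmetric] del: cycle.simps S_cycle.simps)
    then show ?thesis
      using cl 1 rec by (simp add: m_assoc del: S_perm.simps)
  next
    case 2
    then obtain i where j: "j = Suc i" using kj Suc.prems by (cases j) auto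
    have n: "n - Suc a = i" using kj j 2 by simp
    have sn: "?s k = Suc a" using 2 by simp
    have c: "cycle j k = ?s \<circ> cycle i (Suc a)" using 2 j by simp
    have "inv_into UNIV (cycle i (Suc a)) \<circ> (?s \<circ> \<sigma>) = ?\<tau>"
      unfolding c using bij[of i "Suc a"]
      by (simp add: o_inv_distrib fun_eq_iff)
    then have "S_perm (Suc n) (?s \<circ> \<sigma>) = S_perm n ?\<tau> \<otimes> S_cycle i (Suc a)"
      using n sn by (simp add: k_def[symmetric] del: cycle.simps S_cycle.simps)
    moreover have "S_cycle i (Suc a) \<in> carrier G"
      using kj j 2 Suc.prems by (auto intro: S_cycle_closed)
    ultimately show ?thesis
      using cl 2 rec j Suc.prems by (simp add: m_assoc S_involution del: S_perm.simps)
  next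
    case 3
    have sn: "?s k = k" using 3 by (simp add: transpose_def)
    have "S_perm (Suc n) (?s \<circ> \<sigma>) = S_perm n (?s \<circ> ?\<tau>) \<otimes> S_cycle j k"
      using sn inv_comp[OF cycle_commute_below[OF 3]] by (simp add: k_def[symmetric] j_def)
    also have "\<dots> = S_perm n ?\<tau> \<otimes> S a \<otimes> S_cycle j k"
      using Suc.IH[OF \<tau>] Suc.prems 3 k by (simp add: comp_def)
    also have "\<dots> = S_perm n ?\<tau> \<otimes> S_cycle j k \<otimes> S a"
      using cl 3 kj Suc.prems by (simp add: m_assoc S_cycle_commute_below)
    finally show ?thesis
      unfolding rec .
  next
    case 4
    then obtain b where a: "a = Suc b" by (cases a) auto
    have b: "k \<le> b" "Suc b < k + j" using 4 a kj Suc.prems by auto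
    have clb: "S b \<in> carrier G" using b kj Suc.prems by (auto intro: S_closed)
    have sn: "?s k = k" using 4 by (simp add: transpose_def)
    have "S_perm (Suc n) (?s \<circ> \<sigma>) = S_perm n (transpose b (Suc b) \<circ> ?\<tau>) \<otimes> S_cycle j k"
      using sn inv_comp[of b] cycle_commute_above[OF b] a
      by (simp add: k_def[symmetric] j_def del: S_perm.simps(1))
    also have "\<dots> = S_perm n ?\<tau> \<otimes> S b \<otimes> S_cycle j k"
      using Suc.IH[OF \<tau>] Suc.prems b kj by (simp add: comp_def)
    also have "\<dots> = S_perm n ?\<tau> \<otimes> S_cycle j k \<otimes> S a"
      using cl clb b kj Suc.prems by (simp add: m_assoc S_cycle_commute_above a)
    finally show ?thesis
      unfolding rec .
  qed
  then show ?case
    by (simp only: comp_def)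
qed

text \<open>Induction on the outer permutation \<open>\<tau>\<close> reduces this to
  \<open>S_perm_transpose\<close>, used for \<open>\<tau> \<circ> \<sigma>\<close> and for
  \<open>\<tau>\<close>. The factors are reversed because the permutation acting first stands on the
  left in \<open>G\<close>, as in diagrammatic composition.\<close>

theorem S_perm_comp:
  assumes "\<sigma> permutes {..<N}" "\<tau> permutes {..<N}"
  shows "S_perm N (\<tau> \<circ> \<sigma>) = S_perm N \<sigma> \<otimes> S_perm N \<tau>"
  using assms(2)
proof (induction rule: permutes_adjacent_induct)
  case id
  then show ?case
    using assms(1) by (simp only: id_comp S_perm_id) (simp add: S_perm_closed)
next
  case (swap a \<tau>)
  have "S_perm N (transpose a (Suc a) \<circ> (\<tau> \<circ> \<sigma>)) = S_perm N (\<tau> \<circ> \<sigma>) \<otimes> S a"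
    using swap assms by (intro S_perm_transpose permutes_compose) auto
  then show ?case
    using swap assms by (simp add: comp_def m_assoc S_perm_closed S_closed S_perm_transpose[unfolded comp_def])
qed

lemma S_perm_generator: "Suc a < N \<Longrightarrow> S_perm N (transpose a (Suc a)) = S a"
  using S_perm_transpose[of id N a] by (simp add: S_perm_id S_closed)

end

section \<open>Strict symmetric monoidal categories\<close>

text \<open>The simplifier decides the typing of composite arrows by computing sources and targets. The primed
  variants of the locale axioms below therefore replace hom-set premises, which leave objects
  to be guessed, by conditions on \<^const>\<open>src\<close> and \<^const>\<open>tgt\<close>.\<close>

lemma in_homset [simp]: "f \<in> homset C X Y \<longleftrightarrow> f \<in> Arr C \<and> src C f = X \<and> tgt C f = Y"
  by (simp add: homset_def)

declare tensor_pow.simps(2) [simp del]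

context category
begin

declare src_closed [simp] tgt_closed [simp]

lemma ident_arr [simp]:
  "X \<in> Obj C \<Longrightarrow> ident C X \<in> Arr C"
  "X \<in> Obj C \<Longrightarrow> src C (ident C X) = X"
  "X \<in> Obj C \<Longrightarrow> tgt C (ident C X) = X"
  using ident_closed by auto

lemma cmp_arr [simp]:
  assumes "f \<in> Arr C" "g \<in> Arr C" "tgt C f = src C g"
  shows "f \<Zsemi> g \<in> Arr C" "src C (f \<Zsemi> g) = src C f" "tgt C (f \<Zsemi> g) = tgt C g"
  using assms cmp_closed[of f "src C f" "tgt C f" g "tgt C g"] by auto

lemma cmp_assoc':
  "f \<in> Arr C \<Longrightarrow> g \<in> Arr C \<Longrightarrow> h \<in> Arr C \<Longrightarrow> tgt C f = src C g \<Longrightarrow> tgt C g = src C h \<Longrightarrow>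
    (f \<Zsemi> g) \<Zsemi> h = f \<Zsemi> (g \<Zsemi> h)"
  by (rule cmp_assoc) auto

lemma ident_cmp' [simp]: "f \<in> Arr C \<Longrightarrow> src C f = X \<Longrightarrow> ident C X \<Zsemi> f = f"
  by (rule ident_cmp) auto

lemma cmp_ident' [simp]: "f \<in> Arr C \<Longrightarrow> tgt C f = X \<Longrightarrow> f \<Zsemi> ident C X = f"
  by (rule cmp_ident) auto

end

context strict_symmetric_monoidal_category
begin

declare unit_closed [simp] tensor_obj_closed [simp]

lemma tensor_arr_arr [simp]:
  assumes "f \<in> Arr C" "g \<in> Arr C"
  shows "f \<otimes>\<^sub>m g \<in> Arr C"
    "src C (f \<otimes>\<^sub>m g) = src C f \<otimes>\<^sub>o src C g"
    "tgt C (f \<otimes>\<^sub>m g) = tgt C f \<otimes>\<^sub>o tgt C g"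
  using assms tensor_arr_closed[of f "src C f" "tgt C f" g "src C g" "tgt C g"] by auto

lemma symm_arr [simp]:
  assumes "X \<in> Obj C" "Y \<in> Obj C"
  shows "\<gamma> X Y \<in> Arr C" "src C (\<gamma> X Y) = X \<otimes>\<^sub>o Y" "tgt C (\<gamma> X Y) = Y \<otimes>\<^sub>o X"
  using assms symm_closed[of X Y] by auto

declare tensor_ident [simp] unit_tensor_obj [simp] tensor_obj_unit [simp]
  tensor_obj_assoc [simp] unit_tensor_arr [simp] tensor_arr_unit [simp] symm_inverse [simp]

lemma interchange':
  "f \<in> Arr C \<Longrightarrow> g \<in> Arr C \<Longrightarrow> f' \<in> Arr C \<Longrightarrow> g' \<in> Arr C \<Longrightarrow>
    tgt C f = src C g \<Longrightarrow> tgt C f' = src C g' \<Longrightarrow>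
    (f \<otimes>\<^sub>m f') \<Zsemi> (g \<otimes>\<^sub>m g') = (f \<Zsemi> g) \<otimes>\<^sub>m (f' \<Zsemi> g')"
  by (rule interchange[symmetric]) auto

lemma interchange_cmp:
  assumes "f \<in> Arr C" "g \<in> Arr C" "f' \<in> Arr C" "g' \<in> Arr C" "h \<in> Arr C"
    "tgt C f = src C g" "tgt C f' = src C g'" "src C h = tgt C g \<otimes>\<^sub>o tgt C g'"
  shows "(f \<otimes>\<^sub>m f') \<Zsemi> ((g \<otimes>\<^sub>m g') \<Zsemi> h) = ((f \<Zsemi> g) \<otimes>\<^sub>m (f' \<Zsemi> g')) \<Zsemi> h"
  using assms by (simp add: cmp_assoc'[symmetric] interchange'[symmetric])

lemma symm_natural':
  "f \<in> Arr C \<Longrightarrow> g \<in> Arr C \<Longrightarrow> tgt C f = Y \<Longrightarrow> tgt C g = Y' \<Longrightarrow>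
    (f \<otimes>\<^sub>m g) \<Zsemi> \<gamma> Y Y' = \<gamma> (src C f) (src C g) \<Zsemi> (g \<otimes>\<^sub>m f)"
  by (rule symm_natural) auto

text \<open>The given hexagon makes the right-hand side a left inverse of
  \<open>\<gamma> Z (X \<otimes>\<^sub>o Y)\<close>, whose inverse is the left-hand side.\<close>

lemma hexagon':
  assumes "X \<in> Obj C" "Y \<in> Obj C" "Z \<in> Obj C"
  shows "\<gamma> (X \<otimes>\<^sub>o Y) Z = (ident C X \<otimes>\<^sub>m \<gamma> Y Z) \<Zsemi> (\<gamma> X Z \<otimes>\<^sub>m ident C Y)"
proof -
  let ?f = "(ident C X \<otimes>\<^sub>m \<gamma> Y Z) \<Zsemi> (\<gamma> X Z \<otimes>\<^sub>m ident C Y)"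
  have "?f \<Zsemi> \<gamma> Z (X \<otimes>\<^sub>o Y) = ident C (X \<otimes>\<^sub>o (Y \<otimes>\<^sub>o Z))"
    using assms
    by (simp add: hexagon cmp_assoc' interchange' interchange_cmp)
  then have "(?f \<Zsemi> \<gamma> Z (X \<otimes>\<^sub>o Y)) \<Zsemi> \<gamma> (X \<otimes>\<^sub>o Y) Z = \<gamma> (X \<otimes>\<^sub>o Y) Z"
    using assms by simp
  then show ?thesis
    using assms by (simp add: cmp_assoc')
qed

text \<open>With two unit objects the hexagon says that this arrow is idempotent, and an invertible
  idempotent is an identity.\<close>

lemma symm_unit_right [simp]:
  assumes "X \<in> Obj C"
  shows "\<gamma> X (unit_obj C) = ident C X"
proof -
  let ?g = "\<gamma> X (unit_obj C)"
  have idem: "?g = ?g \<Zsemi> ?g"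
    using hexagon[of X "unit_obj C" "unit_obj C"] assms by simp
  have "?g = (\<gamma> X (unit_obj C) \<Zsemi> ?g) \<Zsemi> \<gamma> (unit_obj C) X"
    using assms by (simp add: cmp_assoc')
  also have "\<dots> = ident C X"
    using assms by (simp only: idem[symmetric]) simp
  finally show ?thesis .
qed

lemma symm_unit_left [simp]:
  assumes "X \<in> Obj C"
  shows "\<gamma> (unit_obj C) X = ident C X"
  using symm_inverse[OF assms unit_closed] assms by simp

text \<open>Naturality of \<open>\<gamma> X (X \<otimes>\<^sub>o X)\<close> with respect to
  \<open>\<gamma> X X\<close> in the second argument, with both occurrences expanded by the
  hexagon.\<close>

lemma yang_baxter:
  assumes "X \<in> Obj C"
  shows "(\<gamma> X X \<otimes>\<^sub>m ident C X) \<Zsemi> ((ident C X \<otimes>\<^sub>m \<gamma> X X) \<Zsemi> (\<gamma> X X \<otimes>\<^sub>m ident C X)) =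
    (ident C X \<otimes>\<^sub>m \<gamma> X X) \<Zsemi> ((\<gamma> X X \<otimes>\<^sub>m ident C X) \<Zsemi> (ident C X \<otimes>\<^sub>m \<gamma> X X))"
proof -
  have "(ident C X \<otimes>\<^sub>m \<gamma> X X) \<Zsemi> \<gamma> X (X \<otimes>\<^sub>o X) = \<gamma> X (X \<otimes>\<^sub>o X) \<Zsemi> (\<gamma> X X \<otimes>\<^sub>m ident C X)"
    using symm_natural'[of "ident C X" "\<gamma> X X"] assms by simp
  then show ?thesis
    using assms by (simp add: hexagon cmp_assoc')
qed

end

section \<open>Tensor powers and the action of permutations\<close>

context strict_symmetric_monoidal_category
begin

lemma tensor_pow_closed [simp]: "X \<in> Obj C \<Longrightarrow> tensor_pow C X n \<in> Obj C"
  by (induction n) (auto simp: tensor_pow.simps)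

lemma tensor_pow_add:
  "X \<in> Obj C \<Longrightarrow> tensor_pow C X m \<otimes>\<^sub>o tensor_pow C X n = tensor_pow C X (m + n)"
  by (induction n) (auto simp: tensor_pow.simps tensor_obj_assoc[symmetric] simp del: tensor_obj_assoc)

lemma tensor_pow_1: "X \<in> Obj C \<Longrightarrow> tensor_pow C X (Suc 0) = X"
  by (simp add: tensor_pow.simps)

end

section \<open>Tensor powers of one object\<close>

locale tensor_powers = strict_symmetric_monoidal_category C
  for C :: "('o, 'm, 'x) monoidal_category_scheme" (structure) +
  fixes X :: 'o
  assumes X_closed [simp]: "X \<in> Obj C"
begin

abbreviation pow :: "nat \<Rightarrow> 'o" where "pow \<equiv> tensor_pow C X"

abbreviation id_pow :: "nat \<Rightarrow> 'm" where "id_pow n \<equiv> ident C (pow n)"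

abbreviation braid :: "nat \<Rightarrow> nat \<Rightarrow> 'm" where "braid m n \<equiv> \<gamma> (pow m) (pow n)"

abbreviation endo :: "nat \<Rightarrow> 'm set" where "endo n \<equiv> homset C (pow n) (pow n)"

lemma pow_add [simp]: "pow m \<otimes>\<^sub>o pow n = pow (m + n)"
  by (simp add: tensor_pow_add)

lemma pow_1: "pow (Suc 0) = X"
  by (simp add: tensor_pow_1)

text \<open>The prescribed image of an adjacent transposition. Writing \<open>braid 1 1\<close> for
  \<open>\<gamma> X X\<close> keeps all objects tensor powers, so that \<open>pow_add\<close>
  computes their types.\<close>

definition adjacent :: "nat \<Rightarrow> nat \<Rightarrow> 'm" where
  "adjacent n a = id_pow a \<otimes>\<^sub>m braid 1 1 \<otimes>\<^sub>m id_pow (n - a - 2)"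

definition endo_monoid :: "nat \<Rightarrow> 'm monoid" where
  "endo_monoid n = \<lparr>carrier = endo n, monoid.mult = cmp C, one = id_pow n\<rparr>"

lemma endo_monoid_simps [simp]:
  "carrier (endo_monoid n) = endo n"
  "monoid.mult (endo_monoid n) = cmp C"
  "one (endo_monoid n) = id_pow n"
  by (simp_all add: endo_monoid_def)

lemma adjacent_arr [simp]:
  "Suc a < n \<Longrightarrow> adjacent n a \<in> Arr C"
  "Suc a < n \<Longrightarrow> src C (adjacent n a) = pow n"
  "Suc a < n \<Longrightarrow> tgt C (adjacent n a) = pow n"
  by (auto simp: adjacent_def dest!: less_imp_Suc_add)

lemma adjacent_involution: "Suc a < n \<Longrightarrow> adjacent n a \<Zsemi> adjacent n a = id_pow n"
  by (auto simp: adjacent_def interchange' dest!: less_imp_Suc_add)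

text \<open>Cutting the row of factors in front of position \<open>b\<close> puts the two symmetries
  on different sides of one tensor product, where interchange makes them commute.\<close>

lemma adjacent_commute:
  assumes "Suc a < b" "Suc b < n"
  shows "adjacent n a \<Zsemi> adjacent n b = adjacent n b \<Zsemi> adjacent n a"
proof -
  obtain p where b: "b = a + 2 + p"
    using assms le_Suc_ex[of "a + 2" b] by auto
  obtain q where n: "n = b + 2 + q"
    using assms le_Suc_ex[of "b + 2" n] by auto
  let ?f = "id_pow a \<otimes>\<^sub>m braid 1 1 \<otimes>\<^sub>m id_pow p" and ?g = "braid 1 1 \<otimes>\<^sub>m id_pow q"
  have "adjacent n a = ?f \<otimes>\<^sub>m id_pow (2 + q)"
    using b n by (simp add: adjacent_def tensor_arr_assoc add.assoc)
  moreover have "adjacent n b = id_pow (a + 2 + p) \<otimes>\<^sub>m ?g"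
    using b n by (simp add: adjacent_def tensor_arr_assoc)
  ultimately show ?thesis
    by (simp add: interchange' numeral_2_eq_2)
qed

lemma adjacent_braid:
  assumes "Suc (Suc a) < n"
  shows "adjacent n a \<Zsemi> adjacent n (Suc a) \<Zsemi> adjacent n a =
    adjacent n (Suc a) \<Zsemi> adjacent n a \<Zsemi> adjacent n (Suc a)"
proof -
  obtain q where n: "n = a + 3 + q"
    using assms le_Suc_ex[of "a + 3" n] by auto
  let ?g = "braid 1 1" and ?i = "id_pow 1"
  have a: "adjacent n a = id_pow a \<otimes>\<^sub>m (?g \<otimes>\<^sub>m ?i) \<otimes>\<^sub>m id_pow q"
    using n by (simp add: adjacent_def tensor_arr_assoc)
  have b: "adjacent n (Suc a) = id_pow a \<otimes>\<^sub>m (?i \<otimes>\<^sub>m ?g) \<otimes>\<^sub>m id_pow q"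
    using n by (simp add: adjacent_def tensor_arr_assoc[symmetric])
  have "(?g \<otimes>\<^sub>m ?i) \<Zsemi> ((?i \<otimes>\<^sub>m ?g) \<Zsemi> (?g \<otimes>\<^sub>m ?i)) =
      (?i \<otimes>\<^sub>m ?g) \<Zsemi> ((?g \<otimes>\<^sub>m ?i) \<Zsemi> (?i \<otimes>\<^sub>m ?g))"
    by (rule yang_baxter) simp
  then show ?thesis
    unfolding a b by (simp add: interchange' cmp_assoc')
qed

lemma coxeter_adjacent: "coxeter_monoid (endo_monoid n) n (adjacent n)"
proof unfold_locales
  show "Suc (Suc a) < n \<Longrightarrow>
    adjacent n a \<otimes>\<^bsub>endo_monoid n\<^esub> adjacent n (Suc a) \<otimes>\<^bsub>endo_monoid n\<^esub> adjacent n a =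
    adjacent n (Suc a) \<otimes>\<^bsub>endo_monoid n\<^esub> adjacent n a \<otimes>\<^bsub>endo_monoid n\<^esub> adjacent n (Suc a)" for a
    using adjacent_braid by simp
next
  show "Suc a < b \<Longrightarrow> Suc b < n \<Longrightarrow> adjacent n a \<otimes>\<^bsub>endo_monoid n\<^esub> adjacent n b =
    adjacent n b \<otimes>\<^bsub>endo_monoid n\<^esub> adjacent n a" for a b
    using adjacent_commute by simp
qed (auto simp: cmp_assoc' adjacent_involution)

abbreviation act :: "nat \<Rightarrow> (nat \<Rightarrow> nat) \<Rightarrow> 'm" where "act \<equiv> perm_action C X"

text \<open>This gives the definite description in \<open>perm_action\<close> its meaning. The
  witness is the homomorphism \<open>S_perm\<close> of the Coxeter presentation. Uniqueness is
  induction over adjacent transpositions, with extensionality settling the values outside the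
  symmetric group.\<close>

lemma ex1_perm_action:
  "\<exists>!\<rho>. \<rho> \<in> {\<sigma>. \<sigma> permutes {..<n}} \<rightarrow>\<^sub>E endo n \<and>
     \<rho> id = id_pow n \<and>
     (\<forall>a. Suc a < n \<longrightarrow> \<rho> (transpose a (Suc a)) =
        id_pow a \<otimes>\<^sub>m \<gamma> X X \<otimes>\<^sub>m id_pow (n - a - 2)) \<and>
     (\<forall>\<sigma> \<tau>. \<sigma> permutes {..<n} \<longrightarrow> \<tau> permutes {..<n} \<longrightarrow> \<rho> (\<tau> \<circ> \<sigma>) = \<rho> \<sigma> \<Zsemi> \<rho> \<tau>)"
  (is "\<exists>!\<rho>. ?P \<rho>")
proof (rule ex_ex1I)
  interpret coxeter_monoid "endo_monoid n" n "adjacent n"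
    by (rule coxeter_adjacent)
  let ?\<rho> = "restrict (S_perm n) {\<sigma>. \<sigma> permutes {..<n}}"
  have "?\<rho> (transpose a (Suc a)) = id_pow a \<otimes>\<^sub>m \<gamma> X X \<otimes>\<^sub>m id_pow (n - a - 2)"
    if "Suc a < n" for a
  proof -
    have "transpose a (Suc a) permutes {..<n}"
      using that by (intro permutes_swap_id) auto
    then show ?thesis
      using S_perm_generator[OF that] by (simp add: adjacent_def pow_1)
  qed
  moreover have "?\<rho> \<in> {\<sigma>. \<sigma> permutes {..<n}} \<rightarrow>\<^sub>E endo n"
    using S_perm_closed[of _ n] by auto
  moreover have "?\<rho> id = id_pow n"
    using S_perm_id[of n] by (simp add: permutes_id)
  moreover have "?\<rho> (\<tau> \<circ> \<sigma>) = ?\<rho> \<sigma> \<Zsemi> ?\<rho> \<tau>"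
    if "\<sigma> permutes {..<n}" "\<tau> permutes {..<n}" for \<sigma> \<tau>
    using S_perm_comp[OF that] permutes_compose[OF that] that by simp
  ultimately show "\<exists>\<rho>. ?P \<rho>"
    by blast
next
  fix \<rho>1 \<rho>2
  assume 1: "?P \<rho>1" and 2: "?P \<rho>2"
  have "\<rho>1 \<sigma> = \<rho>2 \<sigma>" if "\<sigma> permutes {..<n}" for \<sigma>
    using that
  proof (induction rule: permutes_adjacent_induct)
    case id
    then show ?case using 1 2 by (simp add: id_def)
  next
    case (swap a \<sigma>)
    moreover have "transpose a (Suc a) permutes {..<n}"
      using swap by (intro permutes_swap_id) auto
    ultimately show ?case
      using 1 2 by metis
  qed
  moreover have "\<rho>1 \<sigma> = \<rho>2 \<sigma>" if "\<not> \<sigma> permutes {..<n}" for \<sigma>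
    using 1 2 that by (auto simp: PiE_def extensional_def)
  ultimately show "\<rho>1 = \<rho>2"
    by (simp add: fun_eq_iff) metis
qed

lemmas perm_action_spec = theI'[OF ex1_perm_action, folded perm_action_def]

lemma act_arr [simp]:
  assumes "\<sigma> permutes {..<n}"
  shows "act n \<sigma> \<in> Arr C" "src C (act n \<sigma>) = pow n" "tgt C (act n \<sigma>) = pow n"
  using perm_action_spec[of n] assms by auto

lemma act_id [simp]: "act n id = id_pow n"
  using perm_action_spec by blast

lemmas act_id' [simp] = act_id[unfolded id_def]

lemma act_transpose: "Suc a < n \<Longrightarrow> act n (transpose a (Suc a)) = adjacent n a"
  using perm_action_spec by (simp add: adjacent_def pow_1)

lemma act_comp:
  "\<sigma> permutes {..<n} \<Longrightarrow> \<tau> permutes {..<n} \<Longrightarrow> act n (\<tau> \<circ> \<sigma>) = act n \<sigma> \<Zsemi> act n \<tau>"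
  using perm_action_spec by blast

text \<open>What absorbs one permutation will absorb all, so it is enough to know that an arrow
  comes from some permutation. Closure under composition and tensor then replaces the computation of
  block permutations.\<close>

definition perm_arrows :: "nat \<Rightarrow> 'm set" where
  "perm_arrows n = act n ` {\<sigma>. \<sigma> permutes {..<n}}"

lemma perm_arrows_endo: "w \<in> perm_arrows n \<Longrightarrow> w \<in> endo n"
  by (auto simp: perm_arrows_def)

lemma perm_arrows_arr:
  assumes "w \<in> perm_arrows n"
  shows "w \<in> Arr C" "src C w = pow n" "tgt C w = pow n"
  using perm_arrows_endo[OF assms] by auto

lemma id_perm_arrows [intro]: "id_pow n \<in> perm_arrows n"
  unfolding perm_arrows_def by (rule image_eqI[of _ _ id]) (auto simp: permutes_id)

lemma cmp_perm_arrows [intro]: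
  "v \<in> perm_arrows n \<Longrightarrow> w \<in> perm_arrows n \<Longrightarrow> v \<Zsemi> w \<in> perm_arrows n"
  unfolding perm_arrows_def by (auto simp: act_comp[symmetric] intro!: imageI permutes_compose)

lemma adjacent_perm_arrows: "Suc a < n \<Longrightarrow> adjacent n a \<in> perm_arrows n"
  unfolding perm_arrows_def
  by (rule image_eqI[where x = "transpose a (Suc a)"])
    (auto simp: act_transpose intro: permutes_swap_id)

lemma act_tensor_id:
  assumes "\<sigma> permutes {..<m}"
  shows "act m \<sigma> \<otimes>\<^sub>m id_pow n = act (m + n) \<sigma>"
  using assms
proof (induction rule: permutes_adjacent_induct)
  case id
  then show ?case by simp
next
  case (swap a \<sigma>)
  have t: "transpose a (Suc a) permutes {..<m}" "transpose a (Suc a) permutes {..<m + n}"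
    using swap by (auto intro: permutes_swap_id)
  have \<sigma>: "\<sigma> permutes {..<m + n}"
    by (rule permutes_subset[OF swap.hyps(2)]) auto
  have "act m (transpose a (Suc a) \<circ> \<sigma>) \<otimes>\<^sub>m id_pow n =
      (act m \<sigma> \<Zsemi> adjacent m a) \<otimes>\<^sub>m (id_pow n \<Zsemi> id_pow n)"
    using swap t by (simp add: act_comp act_transpose)
  also have "\<dots> = act (m + n) \<sigma> \<Zsemi> (adjacent m a \<otimes>\<^sub>m id_pow n)"
    unfolding swap.IH[symmetric] using swap.hyps by (simp add: interchange')
  also have "adjacent m a \<otimes>\<^sub>m id_pow n = adjacent (m + n) a"
    using swap by (simp add: adjacent_def tensor_arr_assoc)
  finally show ?case
    using swap.hyps act_comp[OF \<sigma> t(2)] by (simp add: act_transpose comp_def)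
qed

lemma perm_arrows_tensor_id:
  "w \<in> perm_arrows m \<Longrightarrow> w \<otimes>\<^sub>m id_pow n \<in> perm_arrows (m + n)"
  unfolding perm_arrows_def
  by (auto simp: act_tensor_id intro!: imageI permutes_subset[of _ "{..<m}" "{..<m + n}"])

text \<open>Tensoring on the left shifts the index of every transposition by \<open>m\<close>.
  Unlike in \<open>act_tensor_id\<close>, the resulting permutation is left unnamed.\<close>

lemma id_tensor_act: "\<sigma> permutes {..<n} \<Longrightarrow> id_pow m \<otimes>\<^sub>m act n \<sigma> \<in> perm_arrows (m + n)"
proof (induction rule: permutes_adjacent_induct)
  case id
  then show ?case by auto
next
  case (swap a \<sigma>)
  have t: "transpose a (Suc a) permutes {..<n}"
    using swap by (auto intro: permutes_swap_id)
  have "id_pow m \<otimes>\<^sub>m act n (transpose a (Suc a) \<circ> \<sigma>) =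
      (id_pow m \<Zsemi> id_pow m) \<otimes>\<^sub>m (act n \<sigma> \<Zsemi> adjacent n a)"
    using swap t by (simp add: act_comp act_transpose)
  also have "\<dots> = (id_pow m \<otimes>\<^sub>m act n \<sigma>) \<Zsemi> (id_pow m \<otimes>\<^sub>m adjacent n a)"
    using swap.hyps by (simp add: interchange')
  also have "id_pow m \<otimes>\<^sub>m adjacent n a = adjacent (m + n) (m + a)"
    using swap by (simp add: adjacent_def tensor_arr_assoc[symmetric])
  finally show ?case
    using swap.hyps cmp_perm_arrows[OF swap.IH adjacent_perm_arrows[of "m + a" "m + n"]]
    by (simp add: comp_def)
qed

lemma id_tensor_perm_arrows:
  "w \<in> perm_arrows n \<Longrightarrow> id_pow m \<otimes>\<^sub>m w \<in> perm_arrows (m + n)"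
  using id_tensor_act by (auto simp: perm_arrows_def[of n])

lemma tensor_perm_arrows:
  assumes "v \<in> perm_arrows m" "w \<in> perm_arrows n"
  shows "v \<otimes>\<^sub>m w \<in> perm_arrows (m + n)"
proof -
  have "v \<otimes>\<^sub>m w = (v \<otimes>\<^sub>m id_pow n) \<Zsemi> (id_pow m \<otimes>\<^sub>m w)"
    using assms by (simp add: interchange' perm_arrows_arr)
  then show ?thesis
    using assms by (auto intro: perm_arrows_tensor_id id_tensor_perm_arrows)
qed

lemma braid_add_right:
  "braid m (n + p) = (braid m n \<otimes>\<^sub>m id_pow p) \<Zsemi> (id_pow n \<otimes>\<^sub>m braid m p)"
  using hexagon[of "pow m" "pow n" "pow p"] by simp

lemma braid_add_left:
  "braid (m + n) p = (id_pow m \<otimes>\<^sub>m braid n p) \<Zsemi> (braid m p \<otimes>\<^sub>m id_pow n)"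
  using hexagon'[of "pow m" "pow n" "pow p"] by simp

text \<open>One hexagon reduces the size of the right block to one, the other then reduces the left
  block, and what remains is an adjacent exchange.\<close>

lemma braid_perm_arrows: "braid m n \<in> perm_arrows (m + n)"
proof (induction n)
  case 0
  then show ?case by auto
next
  case (Suc n)
  have 1: "braid m 1 \<in> perm_arrows (m + 1)" for m
  proof (induction m)
    case 0
    then show ?case by auto
  next
    case (Suc m)
    have "id_pow m \<otimes>\<^sub>m braid 1 1 = adjacent (m + 2) m"
      by (simp add: adjacent_def)
    then show ?case
      using braid_add_left[of m 1 1] perm_arrows_tensor_id[OF Suc, of 1]
        adjacent_perm_arrows[of m "m + 2"]
      by auto
  qed
  show ?case
    using braid_add_right[of m n 1] perm_arrows_tensor_id[OF Suc, of 1]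
      id_tensor_perm_arrows[OF 1, of n m]
    by (auto simp: ac_simps)
qed

text \<open>The cycle carries a single factor across the \<open>j\<close> factors before it. Taking
  off one adjacent transposition is the hexagon \<open>braid_add_left\<close> with a first block of
  size one.\<close>

lemma act_cycle: "k + j < n \<Longrightarrow> act n (cycle j k) = id_pow k \<otimes>\<^sub>m braid j 1 \<otimes>\<^sub>m id_pow (n - k - j - 1)"
proof (induction j arbitrary: k)
  case 0
  then show ?case by simp
next
  case (Suc j)
  obtain p where n: "n = k + Suc j + 1 + p"
    using Suc.prems le_Suc_ex[of "k + Suc j + 1" n] by auto
  have t: "transpose k (Suc k) permutes {..<n}" "cycle j (Suc k) permutes {..<n}"
    using Suc.prems by (auto intro!: permutes_swap_id cycle_permutes)
  have "act n (cycle (Suc j) k) = act n (cycle j (Suc k)) \<Zsemi> adjacent n k"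
    using t Suc.prems act_comp[OF t(2,1)] by (simp add: act_transpose comp_def)
  also have "act n (cycle j (Suc k)) = id_pow k \<otimes>\<^sub>m (id_pow 1 \<otimes>\<^sub>m braid j 1) \<otimes>\<^sub>m id_pow p"
    using Suc.IH[of "Suc k"] n by (simp add: tensor_arr_assoc[symmetric])
  also have "adjacent n k = id_pow k \<otimes>\<^sub>m (braid 1 1 \<otimes>\<^sub>m id_pow j) \<otimes>\<^sub>m id_pow p"
    using n by (simp add: adjacent_def tensor_arr_assoc)
  also have "(id_pow k \<otimes>\<^sub>m (id_pow 1 \<otimes>\<^sub>m braid j 1) \<otimes>\<^sub>m id_pow p) \<Zsemi> \<dots> =
      id_pow k \<otimes>\<^sub>m braid (1 + j) 1 \<otimes>\<^sub>m id_pow p"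
    by (subst braid_add_left) (simp add: interchange')
  finally show ?case
    using n by simp
qed

end

section \<open>Sums of parallel arrows\<close>

context nnrat_linear_symmetric_monoidal_category
begin

abbreviation hsum :: "'o \<Rightarrow> 'o \<Rightarrow> ('i \<Rightarrow> 'm) \<Rightarrow> 'i set \<Rightarrow> 'm" where
  "hsum X Y \<equiv> finprod (hom_monoid C X Y)"

lemma hom_monoid_simps [simp]:
  "carrier (hom_monoid C X Y) = homset C X Y"
  "monoid.mult (hom_monoid C X Y) = add_arr C"
  "one (hom_monoid C X Y) = zero_arr C X Y"
  by (simp_all add: hom_monoid_def)

lemma arr_add_arr [simp]:
  assumes "f \<in> Arr C" "g \<in> Arr C" "src C f = src C g" "tgt C f = tgt C g"
  shows "f \<oplus>\<^sub>m g \<in> Arr C" "src C (f \<oplus>\<^sub>m g) = src C g" "tgt C (f \<oplus>\<^sub>m g) = tgt C g"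
proof -
  interpret comm_monoid "hom_monoid C (src C g) (tgt C g)"
    using assms by (intro hom_comm_monoid) auto
  show "f \<oplus>\<^sub>m g \<in> Arr C" "src C (f \<oplus>\<^sub>m g) = src C g" "tgt C (f \<oplus>\<^sub>m g) = tgt C g"
    using m_closed[of f g] assms by auto
qed

lemma arr_zero_arr [simp]:
  assumes "X \<in> Obj C" "Y \<in> Obj C"
  shows "zero_arr C X Y \<in> Arr C" "src C (zero_arr C X Y) = X" "tgt C (zero_arr C X Y) = Y"
proof -
  interpret comm_monoid "hom_monoid C X Y"
    using assms by (intro hom_comm_monoid) auto
  show "zero_arr C X Y \<in> Arr C" "src C (zero_arr C X Y) = X" "tgt C (zero_arr C X Y) = Y"
    using one_closed by auto
qed

lemma scale_arr [simp]:
  assumes "f \<in> Arr C" "0 \<le> a"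
  shows "a \<odot>\<^sub>m f \<in> Arr C" "src C (a \<odot>\<^sub>m f) = src C f" "tgt C (a \<odot>\<^sub>m f) = tgt C f"
  using scale_closed[of a f "src C f" "tgt C f"] assms by auto

lemma scale_one' [simp]: "f \<in> Arr C \<Longrightarrow> 1 \<odot>\<^sub>m f = f"
  by (rule scale_one) auto

lemma scale_scale [simp]:
  "0 \<le> a \<Longrightarrow> 0 \<le> b \<Longrightarrow> f \<in> Arr C \<Longrightarrow> a \<odot>\<^sub>m b \<odot>\<^sub>m f = (a * b) \<odot>\<^sub>m f"
  by (rule scale_mult[symmetric]) auto

lemma scale_cmp' [simp]:
  "0 \<le> a \<Longrightarrow> f \<in> Arr C \<Longrightarrow> g \<in> Arr C \<Longrightarrow> tgt C f = src C g \<Longrightarrow> (a \<odot>\<^sub>m f) \<Zsemi> g = a \<odot>\<^sub>m (f \<Zsemi> g)"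
  by (rule scale_cmp) auto

lemma cmp_scale' [simp]:
  "0 \<le> a \<Longrightarrow> f \<in> Arr C \<Longrightarrow> g \<in> Arr C \<Longrightarrow> tgt C f = src C g \<Longrightarrow> f \<Zsemi> (a \<odot>\<^sub>m g) = a \<odot>\<^sub>m (f \<Zsemi> g)"
  by (rule cmp_scale) auto

lemma scale_tensor' [simp]:
  "0 \<le> a \<Longrightarrow> f \<in> Arr C \<Longrightarrow> g \<in> Arr C \<Longrightarrow> (a \<odot>\<^sub>m f) \<otimes>\<^sub>m g = a \<odot>\<^sub>m (f \<otimes>\<^sub>m g)"
  by (rule scale_tensor) auto

lemma tensor_scale' [simp]:
  "0 \<le> a \<Longrightarrow> f \<in> Arr C \<Longrightarrow> g \<in> Arr C \<Longrightarrow> f \<otimes>\<^sub>m (a \<odot>\<^sub>m g) = a \<odot>\<^sub>m (f \<otimes>\<^sub>m g)"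
  by (rule tensor_scale) auto

lemma scale_add_right':
  "0 \<le> a \<Longrightarrow> f \<in> Arr C \<Longrightarrow> g \<in> Arr C \<Longrightarrow> src C f = src C g \<Longrightarrow> tgt C f = tgt C g \<Longrightarrow>
    a \<odot>\<^sub>m (f \<oplus>\<^sub>m g) = a \<odot>\<^sub>m f \<oplus>\<^sub>m a \<odot>\<^sub>m g"
  by (rule scale_add_right) auto

lemma add_cmp':
  "f \<in> Arr C \<Longrightarrow> f' \<in> Arr C \<Longrightarrow> g \<in> Arr C \<Longrightarrow> src C f = src C f' \<Longrightarrow> tgt C f = tgt C f' \<Longrightarrow>
    tgt C f = src C g \<Longrightarrow> (f \<oplus>\<^sub>m f') \<Zsemi> g = (f \<Zsemi> g) \<oplus>\<^sub>m (f' \<Zsemi> g)"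
  by (rule add_cmp) auto

lemma cmp_add':
  "f \<in> Arr C \<Longrightarrow> g \<in> Arr C \<Longrightarrow> g' \<in> Arr C \<Longrightarrow> src C g = src C g' \<Longrightarrow> tgt C g = tgt C g' \<Longrightarrow>
    tgt C f = src C g \<Longrightarrow> f \<Zsemi> (g \<oplus>\<^sub>m g') = (f \<Zsemi> g) \<oplus>\<^sub>m (f \<Zsemi> g')"
  by (rule cmp_add) auto

lemma add_tensor':
  "f \<in> Arr C \<Longrightarrow> f' \<in> Arr C \<Longrightarrow> g \<in> Arr C \<Longrightarrow> src C f = src C f' \<Longrightarrow> tgt C f = tgt C f' \<Longrightarrow>
    (f \<oplus>\<^sub>m f') \<otimes>\<^sub>m g = (f \<otimes>\<^sub>m g) \<oplus>\<^sub>m (f' \<otimes>\<^sub>m g)"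
  by (rule add_tensor) auto

lemma tensor_add':
  "f \<in> Arr C \<Longrightarrow> g \<in> Arr C \<Longrightarrow> g' \<in> Arr C \<Longrightarrow> src C g = src C g' \<Longrightarrow> tgt C g = tgt C g' \<Longrightarrow>
    f \<otimes>\<^sub>m (g \<oplus>\<^sub>m g') = (f \<otimes>\<^sub>m g) \<oplus>\<^sub>m (f \<otimes>\<^sub>m g')"
  by (rule tensor_add) auto

lemma zero_tensor' [simp]:
  "X \<in> Obj C \<Longrightarrow> Y \<in> Obj C \<Longrightarrow> g \<in> Arr C \<Longrightarrow>
    zero_arr C X Y \<otimes>\<^sub>m g = zero_arr C (X \<otimes>\<^sub>o src C g) (Y \<otimes>\<^sub>o tgt C g)"
  by (rule zero_tensor) auto

lemma tensor_zero' [simp]: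
  "X \<in> Obj C \<Longrightarrow> Y \<in> Obj C \<Longrightarrow> g \<in> Arr C \<Longrightarrow>
    g \<otimes>\<^sub>m zero_arr C X Y = zero_arr C (src C g \<otimes>\<^sub>o X) (tgt C g \<otimes>\<^sub>o Y)"
  by (rule tensor_zero) auto

lemma zero_cmp' [simp]:
  "X \<in> Obj C \<Longrightarrow> g \<in> Arr C \<Longrightarrow> src C g = Y \<Longrightarrow> zero_arr C X Y \<Zsemi> g = zero_arr C X (tgt C g)"
  by (rule zero_cmp) auto

lemma cmp_zero' [simp]:
  "f \<in> Arr C \<Longrightarrow> Z \<in> Obj C \<Longrightarrow> tgt C f = Y \<Longrightarrow> f \<Zsemi> zero_arr C Y Z = zero_arr C (src C f) Z"
  by (rule cmp_zero) auto

lemma scale_zero_left' [simp]: "f \<in> Arr C \<Longrightarrow> 0 \<odot>\<^sub>m f = zero_arr C (src C f) (tgt C f)"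
  by (rule scale_zero_left) auto

lemma add_zero [simp]:
  assumes "f \<in> Arr C" "src C f = X" "tgt C f = Y"
  shows "f \<oplus>\<^sub>m zero_arr C X Y = f" "zero_arr C X Y \<oplus>\<^sub>m f = f"
proof -
  interpret comm_monoid "hom_monoid C X Y"
    using assms by (intro hom_comm_monoid) auto
  show "f \<oplus>\<^sub>m zero_arr C X Y = f" "zero_arr C X Y \<oplus>\<^sub>m f = f"
    using r_one[of f] l_one[of f] assms by auto
qed

context
  fixes X Y :: 'o and f :: "'i \<Rightarrow> 'm" and S :: "'i set"
  assumes X: "X \<in> Obj C" and Y: "Y \<in> Obj C"
    and f: "\<And>i. i \<in> S \<Longrightarrow> f i \<in> homset C X Y"
begin

interpretation comm_monoid "hom_monoid C X Y"
  using X Y by (rule hom_comm_monoid)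

lemma hsum_closed: "hsum X Y f S \<in> homset C X Y"
  using finprod_closed[of f S] f by auto

text \<open>Stated for an arbitrary additive map \<open>\<phi>\<close> between hom-sets, so that a
  whole context such as \<open>\<lambda>x. v \<Zsemi> ((x \<otimes>\<^sub>m id_pow 1) \<Zsemi>
  R)\<close> can be moved inside a sum at once.\<close>

lemma hsum_linear:
  assumes S: "finite S"
    and Z: "Z \<in> Obj C" "W \<in> Obj C"
    and zero: "\<phi> (zero_arr C X Y) = zero_arr C Z W"
    and add: "\<And>g h. g \<in> homset C X Y \<Longrightarrow> h \<in> homset C X Y \<Longrightarrow> \<phi> (g \<oplus>\<^sub>m h) = \<phi> g \<oplus>\<^sub>m \<phi> h"
    and closed: "\<And>g. g \<in> homset C X Y \<Longrightarrow> \<phi> g \<in> homset C Z W"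
  shows "\<phi> (hsum X Y f S) = hsum Z W (\<lambda>i. \<phi> (f i)) S"
proof -
  interpret ZW: comm_monoid "hom_monoid C Z W"
    using Z by (rule hom_comm_monoid)
  show ?thesis
    using S f
  proof (induction S)
    case empty
    then show ?case
      using zero finprod_empty ZW.finprod_empty by simp
  next
    case (insert i S)
    have f: "f \<in> S \<rightarrow> homset C X Y" "f i \<in> homset C X Y"
      using insert by auto
    have g: "(\<lambda>i. \<phi> (f i)) \<in> S \<rightarrow> homset C Z W" "\<phi> (f i) \<in> homset C Z W"
      using f closed by (blast, blast)
    have "hsum X Y f S \<in> homset C X Y"
      using finprod_closed[of f S] f by auto
    then show ?case
      using insert f g add finprod_insert[of S i f] ZW.finprod_insert[of S i "\<lambda>i. \<phi> (f i)"]
      by simp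
  qed
qed

lemma hsum_cmp:
  "finite S \<Longrightarrow> g \<in> homset C Y Z \<Longrightarrow> hsum X Y f S \<Zsemi> g = hsum X Z (\<lambda>i. f i \<Zsemi> g) S"
  using X Y by (intro hsum_linear) (auto simp: add_cmp')

lemma cmp_hsum:
  "finite S \<Longrightarrow> g \<in> homset C Z X \<Longrightarrow> g \<Zsemi> hsum X Y f S = hsum Z Y (\<lambda>i. g \<Zsemi> f i) S"
  using X Y by (intro hsum_linear) (auto simp: cmp_add')

lemma hsum_tensor:
  "finite S \<Longrightarrow> g \<in> homset C Z W \<Longrightarrow>
    hsum X Y f S \<otimes>\<^sub>m g = hsum (X \<otimes>\<^sub>o Z) (Y \<otimes>\<^sub>o W) (\<lambda>i. f i \<otimes>\<^sub>m g) S"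
  using X Y by (intro hsum_linear) (auto intro: zero_tensor add_tensor)

end

lemma hsum_cong:
  assumes "X \<in> Obj C" "Y \<in> Obj C"
    and "\<And>i. i \<in> S \<Longrightarrow> g i \<in> homset C X Y" "\<And>i. i \<in> S \<Longrightarrow> f i = g i"
  shows "hsum X Y f S = hsum X Y g S"
proof -
  interpret comm_monoid "hom_monoid C X Y"
    using assms(1,2) by (rule hom_comm_monoid)
  show ?thesis
    using assms(3,4) by (intro finprod_cong') auto
qed

lemma hsum_const:
  assumes f: "f \<in> homset C X Y" and S: "finite S"
  shows "hsum X Y (\<lambda>_. f) S = of_nat (card S) \<odot>\<^sub>m f"
proof -
  interpret comm_monoid "hom_monoid C X Y"
    using f by (intro hom_comm_monoid) auto
  show ?thesis
    using S
  proof (induction S)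
    case empty
    then show ?case using finprod_empty f by simp
  next
    case (insert i S)
    then have "hsum X Y (\<lambda>_. f) (insert i S) = f \<oplus>\<^sub>m of_nat (card S) \<odot>\<^sub>m f"
      using finprod_insert[of S i "\<lambda>_. f"] f by simp
    also have "\<dots> = (1 + of_nat (card S)) \<odot>\<^sub>m f"
      using f scale_add_left[of 1 "of_nat (card S)" f X Y] by simp
    finally show ?case
      using insert by simp
  qed
qed

lemma hsum_reindex:
  assumes "X \<in> Obj C" "Y \<in> Obj C" "inj_on h S" "\<And>i. i \<in> S \<Longrightarrow> f (h i) \<in> homset C X Y"
  shows "hsum X Y f (h ` S) = hsum X Y (\<lambda>i. f (h i)) S"
proof -
  interpret comm_monoid "hom_monoid C X Y"
    using assms(1,2) by (rule hom_comm_monoid)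
  show ?thesis
    using assms(3,4) by (intro finprod_reindex) auto
qed

lemma hsum_add:
  assumes "X \<in> Obj C" "Y \<in> Obj C"
    and "\<And>i. i \<in> S \<Longrightarrow> f i \<in> homset C X Y" "\<And>i. i \<in> S \<Longrightarrow> g i \<in> homset C X Y"
  shows "hsum X Y (\<lambda>i. f i \<oplus>\<^sub>m g i) S = hsum X Y f S \<oplus>\<^sub>m hsum X Y g S"
proof -
  interpret comm_monoid "hom_monoid C X Y"
    using assms(1,2) by (rule hom_comm_monoid)
  show ?thesis
    using assms(3,4) finprod_multf[of f S g] by auto
qed

lemma hsum_Un_disjoint:
  assumes "X \<in> Obj C" "Y \<in> Obj C" "finite S" "finite T" "S \<inter> T = {}"
    and "\<And>i. i \<in> S \<union> T \<Longrightarrow> f i \<in> homset C X Y"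
  shows "hsum X Y f (S \<union> T) = hsum X Y f S \<oplus>\<^sub>m hsum X Y f T"
proof -
  interpret comm_monoid "hom_monoid C X Y"
    using assms(1,2) by (rule hom_comm_monoid)
  show ?thesis
    using assms(3-) finprod_Un_disjoint[of S T f] by auto
qed

lemma hsum_UN_disjoint:
  assumes "X \<in> Obj C" "Y \<in> Obj C" "finite I" "\<And>i. i \<in> I \<Longrightarrow> finite (S i)"
    and "\<And>i j. i \<in> I \<Longrightarrow> j \<in> I \<Longrightarrow> i \<noteq> j \<Longrightarrow> S i \<inter> S j = {}"
    and "\<And>i k. i \<in> I \<Longrightarrow> k \<in> S i \<Longrightarrow> f k \<in> homset C X Y"
  shows "hsum X Y f (\<Union>i\<in>I. S i) = hsum X Y (\<lambda>i. hsum X Y f (S i)) I"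
proof -
  interpret comm_monoid "hom_monoid C X Y"
    using assms(1,2) by (rule hom_comm_monoid)
  show ?thesis
    using assms(3-) by (intro finprod_UN_disjoint) (auto simp: pairwise_def disjnt_def)
qed

lemma hsum_restrict:
  assumes "X \<in> Obj C" "Y \<in> Obj C" "finite S" "T \<subseteq> S"
    and "\<And>i. i \<in> S - T \<Longrightarrow> f i = zero_arr C X Y" "\<And>i. i \<in> S \<Longrightarrow> f i \<in> homset C X Y"
  shows "hsum X Y f S = hsum X Y f T"
proof -
  interpret comm_monoid "hom_monoid C X Y"
    using assms(1,2) by (rule hom_comm_monoid)
  show ?thesis
    using assms(3-) by (intro finprod_mono_neutral_cong_right) auto
qed

lemma hsum_singleton:
  assumes "f i \<in> homset C X Y"
  shows "hsum X Y f {i} = f i"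
proof -
  interpret comm_monoid "hom_monoid C X Y"
    using assms by (intro hom_comm_monoid) auto
  show ?thesis
    using assms finprod_insert[of "{}" i f] finprod_empty by simp
qed

end

section \<open>The symmetrizer\<close>

locale linear_tensor_powers =
  nnrat_linear_symmetric_monoidal_category C + tensor_powers C X
  for C :: "('o, 'm, 'x) linear_monoidal_category_scheme" (structure) and X :: 'o
begin

text \<open>The idempotent \<open>P n\<close> of the overview.\<close>

definition sym :: "nat \<Rightarrow> 'm" where
  "sym n = (1 / fact n) \<odot>\<^sub>m hsum (pow n) (pow n) (act n) {\<sigma>. \<sigma> permutes {..<n}}"

lemma finite_perms [simp]: "finite {\<sigma>. \<sigma> permutes {..<n::nat}}"
  by (rule finite_permutations) auto

lemma hsum_act_closed:
  "hsum (pow n) (pow n) (act n) {\<sigma>. \<sigma> permutes {..<n}} \<in> endo n"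
  by (rule hsum_closed) auto

lemma sym_arr [simp]: "sym n \<in> Arr C" "src C (sym n) = pow n" "tgt C (sym n) = pow n"
  using hsum_act_closed[of n] by (auto simp: sym_def)

lemma sym_0 [simp]: "sym 0 = ident C (unit_obj C)"
proof -
  have "{\<sigma>::nat \<Rightarrow> nat. \<sigma> permutes {..<0}} = {id}"
    by (auto simp: permutes_id)
  then show ?thesis
    by (simp add: sym_def hsum_singleton)
qed

lemma sym_1: "sym (Suc 0) = id_pow (Suc 0)"
proof -
  have "{\<sigma>::nat \<Rightarrow> nat. \<sigma> permutes {..<Suc 0}} = {id}"
    by (auto simp: permutes_id lessThan_Suc)
  then show ?thesis
    by (simp add: sym_def hsum_singleton)
qed

text \<open>Composition with a fixed permutation is a translation of the symmetric group, so it only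
  reindexes the sum.\<close>

lemma perm_cmp_sym:
  assumes "w \<in> perm_arrows n"
  shows "w \<Zsemi> sym n = sym n"
proof -
  let ?S = "{\<sigma>. \<sigma> permutes {..<n}}"
  obtain \<sigma> where \<sigma>: "\<sigma> permutes {..<n}" and w: "w = act n \<sigma>"
    using assms by (auto simp: perm_arrows_def)
  have "act n \<sigma> \<Zsemi> hsum (pow n) (pow n) (act n) ?S =
      hsum (pow n) (pow n) (\<lambda>\<tau>. act n \<sigma> \<Zsemi> act n \<tau>) ?S"
    using \<sigma> by (intro cmp_hsum) auto
  also have "\<dots> = hsum (pow n) (pow n) (\<lambda>\<tau>. act n (\<tau> \<circ> \<sigma>)) ?S"
    using \<sigma> by (intro hsum_cong) (auto simp: act_comp permutes_compose)
  also have "\<dots> = hsum (pow n) (pow n) (act n) ((\<lambda>\<tau>. \<tau> \<circ> \<sigma>) ` ?S)"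
  proof (intro hsum_reindex[symmetric])
    show "inj_on (\<lambda>\<tau>. \<tau> \<circ> \<sigma>) ?S"
      using permutes_inv_o(1)[OF \<sigma>] by (intro inj_onI) (metis comp_assoc comp_id)
  qed (use permutes_compose[OF \<sigma>] in \<open>auto simp: comp_def\<close>)
  also have "(\<lambda>\<tau>. \<tau> \<circ> \<sigma>) ` ?S = ?S"
    using image_compose_permutations_right[OF \<sigma>] by (auto simp: image_def)
  finally show ?thesis
    unfolding w sym_def using \<sigma> hsum_act_closed[of n] by simp
qed

lemma sym_cmp_perm:
  assumes "w \<in> perm_arrows n"
  shows "sym n \<Zsemi> w = sym n"
proof -
  let ?S = "{\<sigma>. \<sigma> permutes {..<n}}"
  obtain \<sigma> where \<sigma>: "\<sigma> permutes {..<n}" and w: "w = act n \<sigma>"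
    using assms by (auto simp: perm_arrows_def)
  have "hsum (pow n) (pow n) (act n) ?S \<Zsemi> act n \<sigma> =
      hsum (pow n) (pow n) (\<lambda>\<tau>. act n \<tau> \<Zsemi> act n \<sigma>) ?S"
    using \<sigma> by (intro hsum_cmp) auto
  also have "\<dots> = hsum (pow n) (pow n) (\<lambda>\<tau>. act n (\<sigma> \<circ> \<tau>)) ?S"
    using \<sigma> by (intro hsum_cong) (auto simp: act_comp permutes_compose)
  also have "\<dots> = hsum (pow n) (pow n) (act n) ((\<lambda>\<tau>. \<sigma> \<circ> \<tau>) ` ?S)"
  proof (intro hsum_reindex[symmetric])
    show "inj_on (\<lambda>\<tau>. \<sigma> \<circ> \<tau>) ?S"
      using permutes_inv_o(2)[OF \<sigma>] by (intro inj_onI) (metis comp_assoc id_comp)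
  qed (use permutes_compose[OF _ \<sigma>] in \<open>auto simp: comp_def\<close>)
  also have "(\<lambda>\<tau>. \<sigma> \<circ> \<tau>) ` ?S = ?S"
    using image_compose_permutations_left[OF \<sigma>] by (auto simp: image_def)
  finally show ?thesis
    unfolding w sym_def using \<sigma> hsum_act_closed[of n] by simp
qed

text \<open>The average of equal values is that value. Hence an arrow that absorbs the permutations
  of a block of factors absorbs the symmetrizer of the block.\<close>

lemma sym_linear:
  assumes Z: "Z \<in> Obj C" "W \<in> Obj C"
    and zero: "\<phi> (zero_arr C (pow n) (pow n)) = zero_arr C Z W"
    and add: "\<And>g h. g \<in> endo n \<Longrightarrow> h \<in> endo n \<Longrightarrow> \<phi> (g \<oplus>\<^sub>m h) = \<phi> g \<oplus>\<^sub>m \<phi> h"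
    and scale: "\<And>a g. 0 \<le> a \<Longrightarrow> g \<in> endo n \<Longrightarrow> \<phi> (a \<odot>\<^sub>m g) = a \<odot>\<^sub>m \<phi> g"
    and closed: "\<And>g. g \<in> endo n \<Longrightarrow> \<phi> g \<in> homset C Z W"
    and R: "R \<in> homset C Z W" "\<And>w. w \<in> perm_arrows n \<Longrightarrow> \<phi> w = R"
  shows "\<phi> (sym n) = R"
proof -
  let ?S = "{\<sigma>. \<sigma> permutes {..<n}}"
  have "\<phi> (hsum (pow n) (pow n) (act n) ?S) = hsum Z W (\<lambda>\<sigma>. \<phi> (act n \<sigma>)) ?S"
    using assms by (intro hsum_linear) auto
  also have "\<dots> = hsum Z W (\<lambda>_. R) ?S"
    using assms by (intro hsum_cong) (auto simp: perm_arrows_def)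
  also have "\<dots> = fact n \<odot>\<^sub>m R"
    using R(1) by (subst hsum_const) (auto simp: card_permutations)
  finally show ?thesis
    unfolding sym_def using scale[OF _ hsum_act_closed[of n]] R(1) by simp
qed

lemma tensor_sym_cmp:
  assumes R: "R \<in> Arr C" "src C R = pow (k + n + l)"
    and inv: "\<And>w. w \<in> perm_arrows (k + n + l) \<Longrightarrow> w \<Zsemi> R = R"
  shows "(id_pow k \<otimes>\<^sub>m sym n \<otimes>\<^sub>m id_pow l) \<Zsemi> R = R"
proof (rule sym_linear[where \<phi> = "\<lambda>g. (id_pow k \<otimes>\<^sub>m g \<otimes>\<^sub>m id_pow l) \<Zsemi> R"
      and Z = "pow (k + n + l)" and W = "tgt C R"])
  fix w
  assume "w \<in> perm_arrows n"
  then have "id_pow k \<otimes>\<^sub>m w \<otimes>\<^sub>m id_pow l \<in> perm_arrows (k + n + l)"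
    by (intro tensor_perm_arrows) auto
  then show "(id_pow k \<otimes>\<^sub>m w \<otimes>\<^sub>m id_pow l) \<Zsemi> R = R"
    by (rule inv)
qed (use R in \<open>auto simp: tensor_add' add_tensor' add_cmp'\<close>)

lemma cmp_tensor_sym:
  assumes R: "R \<in> Arr C" "tgt C R = pow (k + n + l)"
    and inv: "\<And>w. w \<in> perm_arrows (k + n + l) \<Longrightarrow> R \<Zsemi> w = R"
  shows "R \<Zsemi> (id_pow k \<otimes>\<^sub>m sym n \<otimes>\<^sub>m id_pow l) = R"
proof (rule sym_linear[where \<phi> = "\<lambda>g. R \<Zsemi> (id_pow k \<otimes>\<^sub>m g \<otimes>\<^sub>m id_pow l)"
      and Z = "src C R" and W = "pow (k + n + l)"])
  fix w
  assume "w \<in> perm_arrows n"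
  then have "id_pow k \<otimes>\<^sub>m w \<otimes>\<^sub>m id_pow l \<in> perm_arrows (k + n + l)"
    by (intro tensor_perm_arrows) auto
  then show "R \<Zsemi> (id_pow k \<otimes>\<^sub>m w \<otimes>\<^sub>m id_pow l) = R"
    by (rule inv)
qed (use R in \<open>auto simp: tensor_add' add_tensor' cmp_add'\<close>)

lemma sym_idem: "sym n \<Zsemi> sym n = sym n"
  using tensor_sym_cmp[of "sym n" 0 n 0] by (simp add: perm_cmp_sym)

lemma tensor_syms_cmp:
  assumes R: "R \<in> Arr C" "src C R = pow (m + n)"
    and inv: "\<And>w. w \<in> perm_arrows (m + n) \<Longrightarrow> w \<Zsemi> R = R"
  shows "(sym m \<otimes>\<^sub>m sym n) \<Zsemi> R = R"
proof -
  have "(sym m \<otimes>\<^sub>m sym n) \<Zsemi> R = (sym m \<otimes>\<^sub>m id_pow n) \<Zsemi> ((id_pow m \<otimes>\<^sub>m sym n) \<Zsemi> R)"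
    using R by (simp add: interchange_cmp)
  then show ?thesis
    using tensor_sym_cmp[of R m n 0] tensor_sym_cmp[of R 0 m n] R inv by simp
qed

lemma cmp_tensor_syms:
  assumes R: "R \<in> Arr C" "tgt C R = pow (m + n)"
    and inv: "\<And>w. w \<in> perm_arrows (m + n) \<Longrightarrow> R \<Zsemi> w = R"
  shows "R \<Zsemi> (sym m \<otimes>\<^sub>m sym n) = R"
proof -
  have "R \<Zsemi> (sym m \<otimes>\<^sub>m sym n) = (R \<Zsemi> (sym m \<otimes>\<^sub>m id_pow n)) \<Zsemi> (id_pow m \<otimes>\<^sub>m sym n)"
    using R by (simp add: interchange' cmp_assoc')
  then show ?thesis
    using cmp_tensor_sym[of R m n 0] cmp_tensor_sym[of R 0 m n] R inv by simp
qed

lemma tensor_syms_cmp_sym [simp]: "(sym m \<otimes>\<^sub>m sym n) \<Zsemi> sym (m + n) = sym (m + n)"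
  by (rule tensor_syms_cmp) (auto simp: perm_cmp_sym)

lemma sym_cmp_tensor_syms [simp]: "sym (m + n) \<Zsemi> (sym m \<otimes>\<^sub>m sym n) = sym (m + n)"
  by (rule cmp_tensor_syms) (auto simp: sym_cmp_perm)

lemma perms_cmp_tensor_syms:
  assumes "v \<in> perm_arrows m" "w \<in> perm_arrows n"
  shows "(v \<otimes>\<^sub>m w) \<Zsemi> (sym m \<otimes>\<^sub>m sym n) = sym m \<otimes>\<^sub>m sym n"
  using assms perm_arrows_arr[of v m] perm_arrows_arr[of w n]
  by (simp add: interchange' perm_cmp_sym)

lemma tensor_syms_cmp_perms:
  assumes "v \<in> perm_arrows m" "w \<in> perm_arrows n"
  shows "(sym m \<otimes>\<^sub>m sym n) \<Zsemi> (v \<otimes>\<^sub>m w) = sym m \<otimes>\<^sub>m sym n"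
  using assms perm_arrows_arr[of v m] perm_arrows_arr[of w n]
  by (simp add: interchange' sym_cmp_perm)

text \<open>The coset representative \<open>cycle (n - k) k\<close> as an arrow: the last factor
  jumps to position \<open>k\<close>, across the \<open>n - k\<close> factors in between.\<close>

definition insert_last :: "nat \<Rightarrow> nat \<Rightarrow> 'm" where
  "insert_last n k = id_pow k \<otimes>\<^sub>m braid (n - k) 1"

lemma insert_last_arr [simp]:
  "k \<le> n \<Longrightarrow> insert_last n k \<in> Arr C"
  "k \<le> n \<Longrightarrow> src C (insert_last n k) = pow (Suc n)"
  "k \<le> n \<Longrightarrow> tgt C (insert_last n k) = pow (Suc n)"
  by (auto simp: insert_last_def)

lemma act_cycle_last: "k \<le> n \<Longrightarrow> act (Suc n) (cycle (n - k) k) = insert_last n k"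
  using act_cycle[of k "n - k" "Suc n"] by (simp add: insert_last_def)

text \<open>The permutations of \<open>Suc n\<close> points are the disjoint union of
  \<open>n + 1\<close> cosets of those fixing \<open>n\<close>, told apart by the image
  \<open>k\<close> of \<open>n\<close>.\<close>

lemma sum_act_Suc:
  "hsum (pow (Suc n)) (pow (Suc n)) (act (Suc n)) {\<sigma>. \<sigma> permutes {..<Suc n}} =
    (hsum (pow n) (pow n) (act n) {\<sigma>. \<sigma> permutes {..<n}} \<otimes>\<^sub>m id_pow 1) \<Zsemi>
      hsum (pow (Suc n)) (pow (Suc n)) (insert_last n) {..n}"
proof -
  let ?S = "\<lambda>n. {\<sigma>. \<sigma> permutes {..<n::nat}}"
  let ?c = "\<lambda>k \<tau>. cycle (n - k) k \<circ> \<tau>"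
  let ?sum = "hsum (pow (Suc n)) (pow (Suc n))"
  have perm: "?c k \<tau> permutes {..<Suc n}" if "k \<le> n" "\<tau> permutes {..<n}" for k \<tau>
    using that by (intro permutes_compose cycle_permutes permutes_subset[OF that(2)]) auto
  have last: "?c k \<tau> n = k" if "k \<le> n" "\<tau> permutes {..<n}" for k \<tau>
    using that permutes_not_in[OF that(2), of n] by (simp add: cycle_apply)
  have cover: "?S (Suc n) = (\<Union>k\<in>{..n}. ?c k ` ?S n)"
  proof (intro equalityI subsetI)
    fix \<sigma>
    assume "\<sigma> \<in> ?S (Suc n)"
    then have \<sigma>: "\<sigma> permutes {..<Suc n}" by simp
    have "\<sigma> \<in> ?c (\<sigma> n) ` ?S n"
      by (rule image_eqI[where x = "inv_into UNIV (cycle (n - \<sigma> n) (\<sigma> n)) \<circ> \<sigma>"])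
        (use inv_cycle_permutes[OF \<sigma>] cycle_comp_inv_cycle[OF \<sigma>] in auto)
    then show "\<sigma> \<in> (\<Union>k\<in>{..n}. ?c k ` ?S n)"
      using permutes_last_le[OF \<sigma>] by blast
  next
    fix \<sigma>
    assume "\<sigma> \<in> (\<Union>k\<in>{..n}. ?c k ` ?S n)"
    then show "\<sigma> \<in> ?S (Suc n)"
      using perm by auto
  qed
  have disj: "?c k ` ?S n \<inter> ?c l ` ?S n = {}" if "k \<le> n" "l \<le> n" "k \<noteq> l" for k l
  proof -
    have "?c k \<tau> \<noteq> ?c l \<tau>'" if "\<tau> \<in> ?S n" "\<tau>' \<in> ?S n" for \<tau> \<tau>'
    proof
      assume "?c k \<tau> = ?c l \<tau>'"
      then have "?c k \<tau> n = ?c l \<tau>' n" by (rule fun_cong)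
      then show False
        using last[of k \<tau>] last[of l \<tau>'] that \<open>k \<le> n\<close> \<open>l \<le> n\<close> \<open>k \<noteq> l\<close> by simp
    qed
    then show ?thesis by blast
  qed
  have summand: "?sum (act (Suc n)) (?c k ` ?S n) =
      (hsum (pow n) (pow n) (act n) (?S n) \<otimes>\<^sub>m id_pow 1) \<Zsemi> insert_last n k"
    if k: "k \<le> n" for k
  proof -
    have cp: "cycle (n - k) k permutes {..<Suc n}"
      using k by (intro cycle_permutes) auto
    have "inj_on (?c k) (?S n)"
      using permutes_inj[OF cp] by (auto simp: inj_on_def fun_eq_iff)
    then have "?sum (act (Suc n)) (?c k ` ?S n) = ?sum (\<lambda>\<tau>. act (Suc n) (?c k \<tau>)) (?S n)"
      using perm[OF k] by (intro hsum_reindex) auto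
    also have "\<dots> = ?sum (\<lambda>\<tau>. (act n \<tau> \<otimes>\<^sub>m id_pow 1) \<Zsemi> insert_last n k) (?S n)"
    proof (intro hsum_cong)
      fix \<tau>
      assume "\<tau> \<in> ?S n"
      then have \<tau>: "\<tau> permutes {..<n}" by simp
      have \<tau>': "\<tau> permutes {..<Suc n}"
        by (rule permutes_subset[OF \<tau>]) auto
      show "act (Suc n) (?c k \<tau>) = (act n \<tau> \<otimes>\<^sub>m id_pow 1) \<Zsemi> insert_last n k"
        using act_comp[OF \<tau>' cp] act_tensor_id[OF \<tau>, of 1] k by (simp add: act_cycle_last)
      show "(act n \<tau> \<otimes>\<^sub>m id_pow 1) \<Zsemi> insert_last n k \<in> endo (Suc n)"
        using \<tau> k by simp
    qed auto
    also have "\<dots> = ?sum (\<lambda>\<tau>. act n \<tau> \<otimes>\<^sub>m id_pow 1) (?S n) \<Zsemi> insert_last n k"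
      using k by (intro hsum_cmp[symmetric]) auto
    also have "?sum (\<lambda>\<tau>. act n \<tau> \<otimes>\<^sub>m id_pow 1) (?S n) =
        hsum (pow n) (pow n) (act n) (?S n) \<otimes>\<^sub>m id_pow 1"
      using hsum_tensor[of "pow n" "pow n" "?S n" "act n" "id_pow 1" "pow 1" "pow 1"] by simp
    finally show ?thesis .
  qed
  have "?sum (act (Suc n)) (?S (Suc n)) = ?sum (\<lambda>k. ?sum (act (Suc n)) (?c k ` ?S n)) {..n}"
    unfolding cover using perm disj by (intro hsum_UN_disjoint) auto
  also have "\<dots> = ?sum (\<lambda>k. (hsum (pow n) (pow n) (act n) (?S n) \<otimes>\<^sub>m id_pow 1) \<Zsemi> insert_last n k) {..n}"
    using hsum_act_closed[of n] by (intro hsum_cong) (auto simp: summand)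
  also have "\<dots> = (hsum (pow n) (pow n) (act n) (?S n) \<otimes>\<^sub>m id_pow 1) \<Zsemi> ?sum (insert_last n) {..n}"
    using hsum_act_closed[of n] by (intro cmp_hsum[symmetric]) auto
  finally show ?thesis .
qed

lemma sym_Suc:
  "of_nat (Suc n) \<odot>\<^sub>m sym (Suc n) =
    (sym n \<otimes>\<^sub>m id_pow 1) \<Zsemi> hsum (pow (Suc n)) (pow (Suc n)) (insert_last n) {..n}"
proof -
  have "hsum (pow (Suc n)) (pow (Suc n)) (insert_last n) {..n} \<in> endo (Suc n)"
    by (rule hsum_closed) auto
  moreover have "of_nat (Suc n) / fact (Suc n) = (1 / fact n :: rat)"
    by (simp add: divide_simps)
  ultimately show ?thesis
    unfolding sym_def sum_act_Suc using hsum_act_closed[of n]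
    by (simp del: of_nat_Suc fact_Suc)
qed

text \<open>Up to symmetrization there are only two insertions. For \<open>k \<ge> q\<close> just
  the last \<open>r\<close> positions are permuted, and \<open>sym r\<close> absorbs this. For
  \<open>k < q\<close> the hexagon factors the jump into one to position \<open>q - 1\<close>, the
  last of the first \<open>q\<close>, followed by a permutation of the first \<open>q\<close>
  positions, which \<open>sym q\<close> absorbs.\<close>

lemma insert_last_cmp_syms:
  assumes "q + r = Suc n" "k \<le> n"
  shows "insert_last n k \<Zsemi> (sym q \<otimes>\<^sub>m sym r) =
    (if q \<le> k then sym q \<otimes>\<^sub>m sym r else insert_last n (q - 1) \<Zsemi> (sym q \<otimes>\<^sub>m sym r))"
proof (cases "q \<le> k")
  case True
  have "insert_last n k = id_pow q \<otimes>\<^sub>m (id_pow (k - q) \<otimes>\<^sub>m braid (n - k) 1)"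
    using True by (simp add: insert_last_def tensor_arr_assoc[symmetric])
  moreover have "id_pow (k - q) \<otimes>\<^sub>m braid (n - k) 1 \<in> perm_arrows (k - q + (n - k + 1))"
    by (intro tensor_perm_arrows braid_perm_arrows id_perm_arrows)
  moreover have "k - q + (n - k + 1) = r"
    using assms True by simp
  ultimately show ?thesis
    using True perms_cmp_tensor_syms[of "id_pow q" q "id_pow (k - q) \<otimes>\<^sub>m braid (n - k) 1" r]
    by auto
next
  case False
  define j where "j = q - 1 - k"
  have q: "q = k + j + 1" and n: "n - k = j + r" "n - (q - 1) = r"
    using False assms by (auto simp: j_def)
  have arr: "id_pow k \<otimes>\<^sub>m braid j 1 \<in> perm_arrows q"
    unfolding q add.assoc by (intro tensor_perm_arrows braid_perm_arrows id_perm_arrows)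
  have "insert_last n k = id_pow k \<otimes>\<^sub>m ((id_pow j \<otimes>\<^sub>m braid r 1) \<Zsemi> (braid j 1 \<otimes>\<^sub>m id_pow r))"
    unfolding insert_last_def n by (simp add: braid_add_left)
  also have "\<dots> = (id_pow (k + j) \<otimes>\<^sub>m braid r 1) \<Zsemi> ((id_pow k \<otimes>\<^sub>m braid j 1) \<otimes>\<^sub>m id_pow r)"
  proof -
    have "id_pow (k + j) \<otimes>\<^sub>m braid r 1 = id_pow k \<otimes>\<^sub>m (id_pow j \<otimes>\<^sub>m braid r 1)"
      by (simp add: tensor_arr_assoc[symmetric])
    moreover have "(id_pow k \<otimes>\<^sub>m braid j 1) \<otimes>\<^sub>m id_pow r = id_pow k \<otimes>\<^sub>m (braid j 1 \<otimes>\<^sub>m id_pow r)"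
      by (simp add: tensor_arr_assoc)
    ultimately show ?thesis
      by (simp add: interchange')
  qed
  also have "id_pow (k + j) \<otimes>\<^sub>m braid r 1 = insert_last n (q - 1)"
    unfolding insert_last_def n by (simp add: q)
  finally have "insert_last n k \<Zsemi> (sym q \<otimes>\<^sub>m sym r) =
      insert_last n (q - 1) \<Zsemi> (((id_pow k \<otimes>\<^sub>m braid j 1) \<otimes>\<^sub>m id_pow r) \<Zsemi> (sym q \<otimes>\<^sub>m sym r))"
    using assms False perm_arrows_arr[OF arr] by (simp add: cmp_assoc' q)
  then show ?thesis
    using False perms_cmp_tensor_syms[OF arr id_perm_arrows[of r]] by simp
qed

text \<open>\<open>sym (Suc n)\<close> absorbs \<open>sym q \<otimes>\<^sub>m sym r\<close> on its
  right, and in the recursion \<open>sym_Suc\<close> this collapses the insertions to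
  \<open>r\<close> copies of one arrow and \<open>q\<close> copies of another. After rescaling, the
  coefficients are the two summands of Pascal's rule.\<close>

lemma sym_Suc_split:
  assumes "q + r = Suc n"
  shows "of_nat (Suc n choose q) \<odot>\<^sub>m sym (Suc n) =
    of_nat (n choose q) \<odot>\<^sub>m ((sym n \<otimes>\<^sub>m id_pow 1) \<Zsemi> (sym q \<otimes>\<^sub>m sym r)) \<oplus>\<^sub>m
    (if q = 0 then zero_arr C (pow (Suc n)) (pow (Suc n))
     else of_nat (n choose (q - 1)) \<odot>\<^sub>m
       ((sym n \<otimes>\<^sub>m id_pow 1) \<Zsemi> (insert_last n (q - 1) \<Zsemi> (sym q \<otimes>\<^sub>m sym r))))"
proof -
  define R where "R = sym q \<otimes>\<^sub>m sym r"
  \<comment> \<open>The common value of the insertions at positions below \<open>q\<close>. For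
    \<open>q = 0\<close> there are none, and a zero arrow stands in for the meaningless position
    \<open>q - 1\<close>.\<close>
  define G where "G = (if q = 0 then zero_arr C (pow (Suc n)) (pow (Suc n))
    else insert_last n (q - 1) \<Zsemi> R)"
  let ?P = "sym n \<otimes>\<^sub>m id_pow 1"
  let ?sum = "hsum (pow (Suc n)) (pow (Suc n))"
  have R [simp]: "R \<in> Arr C" "src C R = pow (Suc n)" "tgt C R = pow (Suc n)"
    using assms by (auto simp: R_def)
  have G [simp]: "G \<in> Arr C" "src C G = pow (Suc n)" "tgt C G = pow (Suc n)"
    using assms R by (auto simp: G_def)
  have ins: "insert_last n k \<Zsemi> R = (if q \<le> k then R else G)" if "k \<le> n" for k
    using insert_last_cmp_syms[OF assms that] by (auto simp: R_def G_def)
  have sumR: "?sum (insert_last n) {..n} \<Zsemi> R = of_nat q \<odot>\<^sub>m G \<oplus>\<^sub>m of_nat r \<odot>\<^sub>m R"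
  proof -
    have split: "{..n} = {..<q} \<union> {q..n}"
      using assms by auto
    have "?sum (insert_last n) {..n} \<Zsemi> R = ?sum (\<lambda>k. insert_last n k \<Zsemi> R) {..n}"
      using R by (intro hsum_cmp) auto
    also have "\<dots> = ?sum (\<lambda>k. if q \<le> k then R else G) {..n}"
      by (intro hsum_cong) (auto simp: ins)
    also have "?sum (\<lambda>k. if q \<le> k then R else G) {..n} =
        ?sum (\<lambda>k. if q \<le> k then R else G) {..<q} \<oplus>\<^sub>m ?sum (\<lambda>k. if q \<le> k then R else G) {q..n}"
      unfolding split by (intro hsum_Un_disjoint) auto
    also have "?sum (\<lambda>k. if q \<le> k then R else G) {..<q} = ?sum (\<lambda>k. G) {..<q}"
      using G by (intro hsum_cong) auto
    also have "\<dots> = of_nat q \<odot>\<^sub>m G"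
      using G by (subst hsum_const) auto
    also have "?sum (\<lambda>k. if q \<le> k then R else G) {q..n} = ?sum (\<lambda>k. R) {q..n}"
      using R by (intro hsum_cong) auto
    also have "\<dots> = of_nat (card {q..n}) \<odot>\<^sub>m R"
      using R by (subst hsum_const) auto
    also have "card {q..n} = r"
      using assms by auto
    finally show ?thesis .
  qed
  have S: "?sum (insert_last n) {..n} \<in> endo (Suc n)"
    by (rule hsum_closed) auto
  have "of_nat (Suc n) \<odot>\<^sub>m sym (Suc n) = (of_nat (Suc n) \<odot>\<^sub>m sym (Suc n)) \<Zsemi> R"
    using sym_cmp_tensor_syms[of q r] assms by (simp add: R_def del: of_nat_Suc)
  also have "\<dots> = ?P \<Zsemi> (?sum (insert_last n) {..n} \<Zsemi> R)"
    unfolding sym_Suc using S by (simp add: cmp_assoc')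
  also have "\<dots> = of_nat q \<odot>\<^sub>m (?P \<Zsemi> G) \<oplus>\<^sub>m of_nat r \<odot>\<^sub>m (?P \<Zsemi> R)"
    unfolding sumR by (simp add: cmp_add')
  finally have eq: "of_nat (Suc n) \<odot>\<^sub>m sym (Suc n) = of_nat q \<odot>\<^sub>m (?P \<Zsemi> G) \<oplus>\<^sub>m of_nat r \<odot>\<^sub>m (?P \<Zsemi> R)" .
  \<comment> \<open>The factor that turns the number \<open>q\<close> of insertions into
    \<open>n choose (q - 1)\<close> and the number \<open>r\<close> into \<open>n choose q\<close>,
    by the absorption identities for binomial coefficients.\<close>
  let ?b = "of_nat (Suc n choose q) / of_nat (Suc n) :: rat"
  have q: "?b * of_nat q = of_nat (n choose (q - 1))" if "q \<noteq> 0"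
  proof -
    have "Suc n * (n choose (q - 1)) = (Suc n choose q) * q"
      using Suc_times_binomial_eq[of n "q - 1"] that by simp
    then have "of_nat (Suc n) * of_nat (n choose (q - 1)) = (of_nat (Suc n choose q) * of_nat q :: rat)"
      by (metis of_nat_mult)
    then show ?thesis
      by (simp add: field_simps del: of_nat_Suc)
  qed
  have r: "?b * of_nat r = of_nat (n choose q)"
  proof -
    have "Suc n * (n choose q) = (Suc n choose q) * r"
    proof (cases "r = 0")
      case True
      then show ?thesis using assms by (simp add: binomial_eq_0)
    next
      case False
      then have "q \<le> n" "r = Suc n - q" using assms by auto
      then show ?thesis
        using binomial_absorb_comp[of "Suc n" q] by (simp add: mult.commute)
    qed
    then have "of_nat (Suc n) * of_nat (n choose q) = (of_nat (Suc n choose q) * of_nat r :: rat)"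
      by (metis of_nat_mult)
    then show ?thesis
      by (simp add: field_simps del: of_nat_Suc)
  qed
  have PG: "?P \<Zsemi> G \<in> endo (Suc n)" and PR: "?P \<Zsemi> R \<in> endo (Suc n)"
    using R G by auto
  have "of_nat (Suc n choose q) \<odot>\<^sub>m sym (Suc n) = ?b \<odot>\<^sub>m of_nat (Suc n) \<odot>\<^sub>m sym (Suc n)"
    by (simp del: of_nat_Suc)
  also have "\<dots> = (?b * of_nat q) \<odot>\<^sub>m (?P \<Zsemi> G) \<oplus>\<^sub>m (?b * of_nat r) \<odot>\<^sub>m (?P \<Zsemi> R)"
    unfolding eq using PG PR by (simp add: scale_add_right' del: of_nat_Suc cmp_arr)
  also have "\<dots> = (?b * of_nat r) \<odot>\<^sub>m (?P \<Zsemi> R) \<oplus>\<^sub>m (?b * of_nat q) \<odot>\<^sub>m (?P \<Zsemi> G)"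
    using PG PR comm_monoid.m_comm[OF hom_comm_monoid[of "pow (Suc n)" "pow (Suc n)"]]
    by (simp del: of_nat_Suc cmp_arr)
  also have "(?b * of_nat q) \<odot>\<^sub>m (?P \<Zsemi> G) = (if q = 0 then zero_arr C (pow (Suc n)) (pow (Suc n))
     else of_nat (n choose (q - 1)) \<odot>\<^sub>m (?P \<Zsemi> G))"
    using q by (auto simp: G_def simp del: of_nat_Suc)
  finally show ?thesis
    unfolding r by (simp add: G_def R_def)
qed

end

text \<open>These tables index the double cosets of \<open>S\<^sub>n \<times> S\<^sub>p\<close> and \<open>S\<^sub>q \<times> S\<^sub>r\<close> in the symmetric group on
  \<open>n + p = q + r\<close> points: \<open>b\<close>, say, counts the points of the first \<open>n\<close> sent to the last \<open>r\<close>.\<close>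

definition contingency_tables :: "nat \<Rightarrow> nat \<Rightarrow> nat \<Rightarrow> nat \<Rightarrow> (nat \<times> nat \<times> nat \<times> nat) set" where
  "contingency_tables n p q r = {(a, b, c, d). a + b = n \<and> c + d = p \<and> a + c = q \<and> b + d = r}"

lemma finite_contingency_tables [simp]: "finite (contingency_tables n p q r)"
proof (rule finite_subset)
  show "contingency_tables n p q r \<subseteq> {..n} \<times> {..n} \<times> {..p} \<times> {..p}"
    by (auto simp: contingency_tables_def)
qed auto

section \<open>The double coset formula\<close>

context linear_tensor_powers
begin

text \<open>The uniform average over the double coset with table \<open>(a, b, c, d)\<close>. The
  exchange of the blocks \<open>b\<close> and \<open>c\<close> in the middle is its shortest
  representative.\<close>

definition double_coset :: "nat \<Rightarrow> nat \<Rightarrow> nat \<Rightarrow> nat \<Rightarrow> 'm" where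
  "double_coset a b c d = (sym (a + b) \<otimes>\<^sub>m sym (c + d)) \<Zsemi>
     ((id_pow a \<otimes>\<^sub>m braid b c \<otimes>\<^sub>m id_pow d) \<Zsemi> (sym (a + c) \<otimes>\<^sub>m sym (b + d)))"

lemma double_coset_arr [simp]:
  "double_coset a b c d \<in> Arr C"
  "src C (double_coset a b c d) = pow (a + b + c + d)"
  "tgt C (double_coset a b c d) = pow (a + b + c + d)"
  by (auto simp: double_coset_def add_ac)

lemma sym_cmp_sym_tensor_id: "sym (m + n) \<Zsemi> (sym m \<otimes>\<^sub>m id_pow n) = sym (m + n)"
  using cmp_tensor_sym[of "sym (m + n)" 0 m n] by (simp add: sym_cmp_perm)

lemma sym_tensor_id_cmp_sym: "(sym m \<otimes>\<^sub>m id_pow n) \<Zsemi> sym (m + n) = sym (m + n)"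
  using tensor_sym_cmp[of "sym (m + n)" 0 m n] by (simp add: perm_cmp_sym)

text \<open>A new last factor that stays last joins the block \<open>d\<close>. The exchange of
  \<open>b\<close> and \<open>c\<close> does not see it, and the old symmetrizers are absorbed by
  the larger ones around them.\<close>

lemma double_coset_Suc_right:
  "(sym (a + b) \<otimes>\<^sub>m sym (c + Suc d)) \<Zsemi> ((double_coset a b c d \<otimes>\<^sub>m id_pow 1) \<Zsemi>
    (sym (a + c) \<otimes>\<^sub>m sym (b + Suc d))) = double_coset a b c (Suc d)"
proof -
  define v where "v = sym (a + b) \<otimes>\<^sub>m sym (c + Suc d)"
  define u where "u = (sym (a + b) \<otimes>\<^sub>m sym (c + d)) \<otimes>\<^sub>m id_pow 1"
  define m where "m = (id_pow a \<otimes>\<^sub>m braid b c \<otimes>\<^sub>m id_pow d) \<otimes>\<^sub>m id_pow 1"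
  define w where "w = (sym (a + c) \<otimes>\<^sub>m sym (b + d)) \<otimes>\<^sub>m id_pow 1"
  define R where "R = sym (a + c) \<otimes>\<^sub>m sym (b + Suc d)"
  let ?N = "a + b + c + Suc d"
  have arr: "x \<in> Arr C" "src C x = pow ?N" "tgt C x = pow ?N" if "x \<in> {v, u, m, w, R}" for x
    using that by (auto simp: v_def u_def m_def w_def R_def add_ac)
  note [simp] = arr[of v, simplified] arr[of u, simplified] arr[of m, simplified]
    arr[of w, simplified] arr[of R, simplified]
  have D: "double_coset a b c d \<otimes>\<^sub>m id_pow 1 = u \<Zsemi> (m \<Zsemi> w)"
    by (simp add: double_coset_def u_def m_def w_def interchange' add_ac)
  have v: "v \<Zsemi> u = v"
    using sym_cmp_sym_tensor_id[of "c + d" 1]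
    by (simp add: v_def u_def interchange' tensor_arr_assoc sym_idem)
  have R: "w \<Zsemi> R = R"
    using sym_tensor_id_cmp_sym[of "b + d" 1]
    by (simp add: R_def w_def interchange' tensor_arr_assoc sym_idem)
  have m: "m = id_pow a \<otimes>\<^sub>m braid b c \<otimes>\<^sub>m id_pow (Suc d)"
    by (simp add: m_def tensor_arr_assoc)
  have "v \<Zsemi> ((u \<Zsemi> (m \<Zsemi> w)) \<Zsemi> R) = (v \<Zsemi> u) \<Zsemi> (m \<Zsemi> (w \<Zsemi> R))"
    by (simp add: cmp_assoc')
  also have "\<dots> = v \<Zsemi> (m \<Zsemi> R)"
    unfolding v R ..
  also have "\<dots> = double_coset a b c (Suc d)"
    by (simp add: v_def m R_def double_coset_def)
  finally show ?thesis
    unfolding D[symmetric] by (simp add: v_def R_def)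
qed

text \<open>A new last factor that jumps behind the first \<open>a + c\<close> positions joins the
  block \<open>c\<close>. On its way it crosses \<open>d\<close>, which the left symmetrizer
  absorbs, and \<open>b\<close>, which enlarges the block exchange.\<close>

lemma double_coset_Suc_left:
  "(sym (a + b) \<otimes>\<^sub>m sym (Suc c + d)) \<Zsemi> ((double_coset a b c d \<otimes>\<^sub>m id_pow 1) \<Zsemi>
    (insert_last (a + b + c + d) (a + c) \<Zsemi> (sym (Suc (a + c)) \<otimes>\<^sub>m sym (b + d)))) =
    double_coset a b (Suc c) d"
proof -
  define v where "v = sym (a + b) \<otimes>\<^sub>m sym (Suc c + d)"
  define u where "u = (sym (a + b) \<otimes>\<^sub>m sym (c + d)) \<otimes>\<^sub>m id_pow 1"
  define m where "m = (id_pow a \<otimes>\<^sub>m braid b c \<otimes>\<^sub>m id_pow d) \<otimes>\<^sub>m id_pow 1"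
  define w where "w = (sym (a + c) \<otimes>\<^sub>m sym (b + d)) \<otimes>\<^sub>m id_pow 1"
  define w' where "w' = sym (a + c) \<otimes>\<^sub>m id_pow 1 \<otimes>\<^sub>m sym (b + d)"
  define i where "i = insert_last (a + b + c + d) (a + c)"
  define R where "R = sym (Suc (a + c)) \<otimes>\<^sub>m sym (b + d)"
  define s where "s = id_pow (a + b) \<otimes>\<^sub>m (id_pow c \<otimes>\<^sub>m braid d 1)"
  define m' where "m' = id_pow a \<otimes>\<^sub>m braid b (c + 1) \<otimes>\<^sub>m id_pow d"
  let ?N = "a + b + c + Suc d"
  have arr: "x \<in> Arr C" "src C x = pow ?N" "tgt C x = pow ?N"
    if "x \<in> {v, u, m, w, w', i, R, s, m'}" for x
    using that
    by (auto simp: v_def u_def m_def w_def w'_def i_def R_def s_def m'_def add_ac)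
  note [simp] = arr[of v, simplified] arr[of u, simplified] arr[of m, simplified]
    arr[of w, simplified] arr[of w', simplified] arr[of i, simplified] arr[of R, simplified]
    arr[of s, simplified] arr[of m', simplified]
  have D: "double_coset a b c d \<otimes>\<^sub>m id_pow 1 = u \<Zsemi> (m \<Zsemi> w)"
    by (simp add: double_coset_def u_def m_def w_def interchange' add_ac)
  have v: "v \<Zsemi> u = v"
    using sym_cmp_sym_tensor_id[of "c + d" 1]
    by (simp add: v_def u_def interchange' tensor_arr_assoc sym_idem)
  have i: "i = id_pow (a + c) \<otimes>\<^sub>m braid (b + d) 1"
    by (simp add: i_def insert_last_def)
  \<comment> \<open>Naturality: the jumping factor passes the symmetrizer on the last
    \<open>b + d\<close> factors and ends up between the two symmetrizers.\<close>
  have wi: "w \<Zsemi> i = i \<Zsemi> w'"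
    unfolding i w_def w'_def
    by (simp add: tensor_arr_assoc interchange' symm_natural')
  have R: "w' \<Zsemi> R = R"
    using sym_tensor_id_cmp_sym[of "a + c" 1]
    by (simp add: R_def w'_def interchange' sym_idem)
  \<comment> \<open>The jump crosses \<open>d\<close> first and \<open>b\<close> second. The
    crossing of \<open>d\<close> can be done ahead of the block exchange, where it permutes only the
    last \<open>c + d + 1\<close> factors; the crossing of \<open>b\<close> completes
    \<open>braid b c\<close> to \<open>braid b (c + 1)\<close>.\<close>
  have mi: "m \<Zsemi> i = s \<Zsemi> m'"
  proof -
    have "i = id_pow (a + c) \<otimes>\<^sub>m ((id_pow b \<otimes>\<^sub>m braid d 1) \<Zsemi> (braid b 1 \<otimes>\<^sub>m id_pow d))"
      by (simp add: i braid_add_left)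
    also have "\<dots> = (id_pow (a + c) \<otimes>\<^sub>m (id_pow b \<otimes>\<^sub>m braid d 1)) \<Zsemi>
        (id_pow (a + c) \<otimes>\<^sub>m (braid b 1 \<otimes>\<^sub>m id_pow d))"
      by (simp add: interchange')
    also have "id_pow (a + c) \<otimes>\<^sub>m (id_pow b \<otimes>\<^sub>m braid d 1) = id_pow (a + c + b) \<otimes>\<^sub>m braid d 1"
      by (simp add: tensor_arr_assoc[symmetric])
    also have "id_pow (a + c) \<otimes>\<^sub>m (braid b 1 \<otimes>\<^sub>m id_pow d) = id_pow a \<otimes>\<^sub>m ((id_pow c \<otimes>\<^sub>m braid b 1) \<otimes>\<^sub>m id_pow d)"
      by (simp add: tensor_arr_assoc[symmetric])
    finally have i2: "i = (id_pow (a + c + b) \<otimes>\<^sub>m braid d 1) \<Zsemi>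
      (id_pow a \<otimes>\<^sub>m ((id_pow c \<otimes>\<^sub>m braid b 1) \<otimes>\<^sub>m id_pow d))" .
    have m2: "m = (id_pow a \<otimes>\<^sub>m braid b c) \<otimes>\<^sub>m id_pow (d + 1)"
      by (simp add: m_def tensor_arr_assoc)
    have "m \<Zsemi> (id_pow (a + c + b) \<otimes>\<^sub>m braid d 1) = (id_pow a \<otimes>\<^sub>m braid b c) \<otimes>\<^sub>m braid d 1"
      unfolding m2 by (simp add: interchange' add_ac)
    also have "\<dots> = s \<Zsemi> ((id_pow a \<otimes>\<^sub>m braid b c) \<otimes>\<^sub>m id_pow (1 + d))"
    proof -
      have "s = id_pow (a + (b + c)) \<otimes>\<^sub>m braid d 1"
        by (simp add: s_def tensor_arr_assoc[symmetric] add_ac)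
      then show ?thesis
        by (simp add: interchange')
    qed
    also have "(id_pow a \<otimes>\<^sub>m braid b c) \<otimes>\<^sub>m id_pow (1 + d) =
        id_pow a \<otimes>\<^sub>m ((braid b c \<otimes>\<^sub>m id_pow 1) \<otimes>\<^sub>m id_pow d)"
      by (simp add: tensor_arr_assoc)
    finally have "m \<Zsemi> i = s \<Zsemi> (id_pow a \<otimes>\<^sub>m ((braid b c \<otimes>\<^sub>m id_pow 1) \<otimes>\<^sub>m id_pow d)) \<Zsemi>
      (id_pow a \<otimes>\<^sub>m ((id_pow c \<otimes>\<^sub>m braid b 1) \<otimes>\<^sub>m id_pow d))"
      unfolding i2 by (simp add: cmp_assoc'[symmetric] add_ac)
    also have "\<dots> = s \<Zsemi> ((id_pow a \<otimes>\<^sub>m ((braid b c \<otimes>\<^sub>m id_pow 1) \<otimes>\<^sub>m id_pow d)) \<Zsemi>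
      (id_pow a \<otimes>\<^sub>m ((id_pow c \<otimes>\<^sub>m braid b 1) \<otimes>\<^sub>m id_pow d)))"
      by (simp add: cmp_assoc' add_ac)
    also have "\<dots> = s \<Zsemi> (id_pow a \<otimes>\<^sub>m (braid b (c + 1) \<otimes>\<^sub>m id_pow d))"
      by (subst braid_add_right) (simp add: interchange' add_ac)
    also have "\<dots> = s \<Zsemi> m'"
      by (simp add: m'_def tensor_arr_assoc)
    finally show ?thesis .
  qed
  have vs: "v \<Zsemi> s = v"
    unfolding v_def s_def
    using tensor_syms_cmp_perms[of "id_pow (a + b)" "a + b" "id_pow c \<otimes>\<^sub>m braid d 1" "Suc c + d"]
      tensor_perm_arrows[OF id_perm_arrows[of c] braid_perm_arrows[of d 1]]
    by auto
  have "v \<Zsemi> ((u \<Zsemi> (m \<Zsemi> w)) \<Zsemi> (i \<Zsemi> R)) = (v \<Zsemi> u) \<Zsemi> (m \<Zsemi> ((w \<Zsemi> i) \<Zsemi> R))"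
    by (simp add: cmp_assoc')
  also have "\<dots> = v \<Zsemi> ((m \<Zsemi> i) \<Zsemi> (w' \<Zsemi> R))"
    unfolding v wi by (simp add: cmp_assoc')
  also have "\<dots> = (v \<Zsemi> s) \<Zsemi> (m' \<Zsemi> R)"
    unfolding mi R by (simp add: cmp_assoc')
  also have "\<dots> = double_coset a b (Suc c) d"
    unfolding vs by (simp add: v_def m'_def R_def double_coset_def)
  finally show ?thesis
    unfolding D[symmetric] by (simp add: v_def i_def R_def)
qed

text \<open>The coefficients are hypergeometric. Under a random permutation the points sent to the
  first \<open>q\<close> positions form a random set of size \<open>q\<close>, and dividing the
  coefficient by \<open>(n + p) choose q\<close> gives the probability that it contains
  \<open>a\<close> of the first \<open>n\<close> and \<open>c\<close> of the last \<open>p\<close>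
  points. This is the share of the double coset in the whole group.\<close>

theorem sym_eq_sum_double_cosets:
  assumes "n + p = q + r"
  shows "of_nat ((n + p) choose q) \<odot>\<^sub>m sym (n + p) =
    hsum (pow (n + p)) (pow (n + p))
      (\<lambda>(a, b, c, d). of_nat ((n choose a) * (p choose c)) \<odot>\<^sub>m double_coset a b c d)
      (contingency_tables n p q r)"
  using assms
proof (induction p arbitrary: q r)
  case 0
  then have n: "n = q + r"
    by simp
  moreover have "contingency_tables (q + r) 0 q r = {(q, r, 0, 0)}"
    by (auto simp: contingency_tables_def)
  moreover have "double_coset q r 0 0 = sym (q + r)"
    using sym_cmp_tensor_syms[of q r] by (simp add: double_coset_def)
  ultimately show ?case
    by (simp add: hsum_singleton)
next
  case (Suc p)
  let ?N = "n + p"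
  have qr: "q + r = Suc ?N"
    using Suc.prems by simp
  \<comment> \<open>\<open>sym (Suc ?N)\<close> absorbs \<open>v\<close>, so \<open>v\<close> may be
    put in front. It supplies the left symmetrizer on \<open>Suc p\<close> factors, where the
    induction hypothesis has one on \<open>p\<close> only.\<close>
  define v where "v = sym n \<otimes>\<^sub>m sym (Suc p)"
  define R where "R = sym q \<otimes>\<^sub>m sym r"
  let ?T = "contingency_tables n (Suc p) q r"
  let ?sum = "hsum (pow (Suc ?N)) (pow (Suc ?N))"
  have arr [simp]: "v \<in> Arr C" "src C v = pow (Suc ?N)" "tgt C v = pow (Suc ?N)"
    "R \<in> Arr C" "src C R = pow (Suc ?N)" "tgt C R = pow (Suc ?N)"
    using qr by (auto simp: v_def R_def)
  note sum_simps = add_tensor' add_cmp' cmp_add'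
  (* The sums of f and g are the contributions of the two summands of Pascal's rule for
     Suc p choose c: the last factor is sent to the last r or to the first q positions. *)
  define f where "f = (\<lambda>(a, b, c, d). of_nat ((n choose a) * (p choose c)) \<odot>\<^sub>m double_coset a b c d)"
  define g where "g = (\<lambda>(a, b, c, d). of_nat ((n choose a) * (if c = 0 then 0 else p choose (c - 1))) \<odot>\<^sub>m
    double_coset a b c d)"
  have f_arr: "f t \<in> endo (Suc ?N)" and g_arr: "g t \<in> endo (Suc ?N)" if "t \<in> ?T" for t
    using that by (auto simp: f_def g_def contingency_tables_def add_ac)
  have sum_f: "v \<Zsemi> (((of_nat (?N choose q) \<odot>\<^sub>m sym ?N) \<otimes>\<^sub>m id_pow 1) \<Zsemi> R) = ?sum f ?T"
  proof (cases r)
    case 0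
    \<comment> \<open>\<open>r = 0\<close> forces \<open>q = Suc ?N\<close> and
      \<open>c = Suc p\<close>, so \<open>?N choose q\<close> and every \<open>p choose c\<close>
      vanish.\<close>
    then have "?sum f ?T = ?sum f {}"
      using f_arr
      by (intro hsum_restrict finite_contingency_tables) (auto simp: f_def contingency_tables_def binomial_eq_0)
    also have "\<dots> = zero_arr C (pow (Suc ?N)) (pow (Suc ?N))"
      using comm_monoid.finprod_empty[OF hom_comm_monoid[of "pow (Suc ?N)" "pow (Suc ?N)"]] by simp
    finally show ?thesis
      using 0 qr by (simp add: binomial_eq_0)
  next
    case (Suc r')
    let ?T' = "contingency_tables n p q r'"
    let ?h = "\<lambda>(a, b, c, d). (a, b, c, Suc d) :: nat \<times> nat \<times> nat \<times> nat"
    have f': "f t \<in> endo ?N" if "t \<in> ?T'" for t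
      using that by (auto simp: f_def contingency_tables_def add_ac)
    have "of_nat (?N choose q) \<odot>\<^sub>m sym ?N = hsum (pow ?N) (pow ?N) f ?T'"
      unfolding f_def using Suc qr by (intro Suc.IH) auto
    then have "v \<Zsemi> (((of_nat (?N choose q) \<odot>\<^sub>m sym ?N) \<otimes>\<^sub>m id_pow 1) \<Zsemi> R) =
        v \<Zsemi> ((hsum (pow ?N) (pow ?N) f ?T' \<otimes>\<^sub>m id_pow 1) \<Zsemi> R)"
      by simp
    also have "\<dots> = ?sum (\<lambda>t. v \<Zsemi> ((f t \<otimes>\<^sub>m id_pow 1) \<Zsemi> R)) ?T'"
      using f' by (intro hsum_linear[where \<phi> = "\<lambda>x. v \<Zsemi> ((x \<otimes>\<^sub>m id_pow 1) \<Zsemi> R)"])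
        (auto simp: sum_simps)
    also have "\<dots> = ?sum (\<lambda>t. f (?h t)) ?T'"
    proof (intro hsum_cong)
      fix t
      assume "t \<in> ?T'"
      then obtain a b c d where t: "t = (a, b, c, d)" "n = a + b" "p = c + d" "q = a + c" "r' = b + d"
        by (auto simp: contingency_tables_def)
      show "v \<Zsemi> ((f t \<otimes>\<^sub>m id_pow 1) \<Zsemi> R) = f (?h t)"
        using double_coset_Suc_right[of a b c d] by (simp add: t Suc f_def v_def R_def add_ac)
      show "f (?h t) \<in> endo (Suc ?N)"
        by (simp add: t f_def add_ac)
    qed auto
    also have "\<dots> = ?sum f (?h ` ?T')"
      using Suc by (intro hsum_reindex[symmetric] inj_onI f_arr) (auto simp: contingency_tables_def)
    also have "\<dots> = ?sum f ?T"
    proof (rule hsum_restrict[symmetric])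
      \<comment> \<open>A table outside the image of \<open>?h\<close> has \<open>d = 0\<close>,
        hence \<open>c = Suc p\<close>, and there \<open>p choose c\<close> is 0.\<close>
      show "f t = zero_arr C (pow (Suc ?N)) (pow (Suc ?N))" if t: "t \<in> ?T - ?h ` ?T'" for t
      proof -
        obtain a b c d where abcd: "t = (a, b, c, d)"
          by (cases t)
        have "d = 0"
        proof (cases d)
          case (Suc d')
          then have "t = ?h (a, b, c, d')" "(a, b, c, d') \<in> ?T'"
            using t abcd \<open>r = Suc r'\<close> by (auto simp: contingency_tables_def)
          then show ?thesis using t by blast
        qed
        then show ?thesis
          using t abcd f_arr[of t] by (auto simp: f_def contingency_tables_def binomial_eq_0 add_ac)
      qed
      show "?h ` ?T' \<subseteq> ?T"
        using Suc by (auto simp: contingency_tables_def)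
    qed (use f_arr in auto)
    finally show ?thesis .
  qed
  have sum_g: "(if q = 0 then zero_arr C (pow (Suc ?N)) (pow (Suc ?N))
     else v \<Zsemi> (((of_nat (?N choose (q - 1)) \<odot>\<^sub>m sym ?N) \<otimes>\<^sub>m id_pow 1) \<Zsemi> (insert_last ?N (q - 1) \<Zsemi> R)))
      = ?sum g ?T"
  proof (cases q)
    case 0
    then have "?sum g ?T = ?sum g {}"
      using g_arr
      by (intro hsum_restrict finite_contingency_tables) (auto simp: g_def contingency_tables_def)
    also have "\<dots> = zero_arr C (pow (Suc ?N)) (pow (Suc ?N))"
      using comm_monoid.finprod_empty[OF hom_comm_monoid[of "pow (Suc ?N)" "pow (Suc ?N)"]] by simp
    finally show ?thesis
      using 0 by simp
  next
    case (Suc q')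
    let ?T' = "contingency_tables n p q' r"
    let ?h = "\<lambda>(a, b, c, d). (a, b, Suc c, d) :: nat \<times> nat \<times> nat \<times> nat"
    define S where "S = insert_last ?N q' \<Zsemi> R"
    have S [simp]: "S \<in> Arr C" "src C S = pow (Suc ?N)" "tgt C S = pow (Suc ?N)"
      using Suc qr by (auto simp: S_def)
    have f': "f t \<in> endo ?N" if "t \<in> ?T'" for t
      using that by (auto simp: f_def contingency_tables_def add_ac)
    have "of_nat (?N choose q') \<odot>\<^sub>m sym ?N = hsum (pow ?N) (pow ?N) f ?T'"
      unfolding f_def using Suc qr by (intro Suc.IH) auto
    then have "v \<Zsemi> (((of_nat (?N choose q') \<odot>\<^sub>m sym ?N) \<otimes>\<^sub>m id_pow 1) \<Zsemi> S) =
        v \<Zsemi> ((hsum (pow ?N) (pow ?N) f ?T' \<otimes>\<^sub>m id_pow 1) \<Zsemi> S)"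
      by simp
    also have "\<dots> = ?sum (\<lambda>t. v \<Zsemi> ((f t \<otimes>\<^sub>m id_pow 1) \<Zsemi> S)) ?T'"
      using f' by (intro hsum_linear[where \<phi> = "\<lambda>x. v \<Zsemi> ((x \<otimes>\<^sub>m id_pow 1) \<Zsemi> S)"])
        (auto simp: sum_simps)
    also have "\<dots> = ?sum (\<lambda>t. g (?h t)) ?T'"
    proof (intro hsum_cong)
      fix t
      assume "t \<in> ?T'"
      then obtain a b c d where t: "t = (a, b, c, d)" "n = a + b" "p = c + d" "q' = a + c" "r = b + d"
        by (auto simp: contingency_tables_def)
      show "v \<Zsemi> ((f t \<otimes>\<^sub>m id_pow 1) \<Zsemi> S) = g (?h t)"
        using double_coset_Suc_left[of a b c d] by (simp add: t Suc f_def g_def S_def v_def R_def add_ac)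
      show "g (?h t) \<in> endo (Suc ?N)"
        by (simp add: t g_def add_ac)
    qed auto
    also have "\<dots> = ?sum g (?h ` ?T')"
      using Suc by (intro hsum_reindex[symmetric] inj_onI g_arr) (auto simp: contingency_tables_def)
    also have "\<dots> = ?sum g ?T"
    proof (rule hsum_restrict[symmetric])
      \<comment> \<open>A table outside the image of \<open>?h\<close> has \<open>c = 0\<close>,
        where the coefficient in \<open>g\<close> was set to 0.\<close>
      show "g t = zero_arr C (pow (Suc ?N)) (pow (Suc ?N))" if t: "t \<in> ?T - ?h ` ?T'" for t
      proof -
        obtain a b c d where abcd: "t = (a, b, c, d)"
          by (cases t)
        have "c = 0"
        proof (cases c)
          case (Suc c')
          then have "t = ?h (a, b, c', d)" "(a, b, c', d) \<in> ?T'"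
            using t abcd \<open>q = Suc q'\<close> by (auto simp: contingency_tables_def)
          then show ?thesis using t by blast
        qed
        then show ?thesis
          using t abcd g_arr[of t] by (auto simp: g_def contingency_tables_def add_ac)
      qed
      show "?h ` ?T' \<subseteq> ?T"
        using Suc by (auto simp: contingency_tables_def)
    qed (use g_arr in auto)
    finally show ?thesis
      using Suc by (simp add: S_def)
  qed
  have "of_nat (Suc ?N choose q) \<odot>\<^sub>m sym (Suc ?N) = v \<Zsemi> (of_nat (Suc ?N choose q) \<odot>\<^sub>m sym (Suc ?N))"
    using tensor_syms_cmp_sym[of n "Suc p"] by (simp add: v_def)
  also have "\<dots> = ?sum f ?T \<oplus>\<^sub>m ?sum g ?T"
  proof (cases "q = 0")
    case True
    then show ?thesis
      unfolding sum_f[symmetric] sum_g[symmetric] sym_Suc_split[OF qr, folded R_def] by simp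
  next
    case False
    define S where "S = insert_last ?N (q - 1) \<Zsemi> R"
    have S [simp]: "S \<in> Arr C" "src C S = pow (Suc ?N)" "tgt C S = pow (Suc ?N)"
      using False qr by (auto simp: S_def)
    show ?thesis
      unfolding sum_f[symmetric] sum_g[symmetric] sym_Suc_split[OF qr, folded R_def] S_def[symmetric]
      using False by (simp add: cmp_add')
  qed
  also have "\<dots> = ?sum (\<lambda>t. f t \<oplus>\<^sub>m g t) ?T"
    using f_arr g_arr by (intro hsum_add[symmetric]) auto
  also have "\<dots> = ?sum (\<lambda>(a, b, c, d). of_nat ((n choose a) * (Suc p choose c)) \<odot>\<^sub>m double_coset a b c d) ?T"
  proof (intro hsum_cong)
    fix t
    assume "t \<in> ?T"
    then obtain a b c d where t: "t = (a, b, c, d)" "n = a + b" "Suc p = c + d" "q = a + c" "r = b + d"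
      by (auto simp: contingency_tables_def)
    have "Suc p choose c = (p choose c) + (if c = 0 then 0 else p choose (c - 1))"
      by (cases c) auto
    then show "f t \<oplus>\<^sub>m g t =
        (case t of (a, b, c, d) \<Rightarrow> of_nat ((n choose a) * (Suc p choose c)) \<odot>\<^sub>m double_coset a b c d)"
      by (simp add: t(1) f_def g_def scale_add_left[symmetric] distrib_left del: binomial_Suc_Suc)
    show "(case t of (a, b, c, d) \<Rightarrow> of_nat ((n choose a) * (Suc p choose c)) \<odot>\<^sub>m double_coset a b c d)
        \<in> endo (Suc ?N)"
      using t(1,2) t(3)[symmetric] by (simp add: add_ac)
  qed auto
  finally show ?case
    by simp
qed

end

section \<open>From permutation splittings to binomial bimonoids\<close>

locale splitting = nnrat_linear_symmetric_monoidal_category C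
  for C :: "('o, 'm, 'x) linear_monoidal_category_scheme" (structure) +
  fixes A :: "nat \<Rightarrow> 'o" and r s :: "nat \<Rightarrow> 'm"
  assumes A_closed [simp]: "A n \<in> Obj C"
    and splitting: "permutation_splitting A r s"

sublocale splitting \<subseteq> linear_tensor_powers C "A (Suc 0)"
  by unfold_locales simp

context splitting
begin

lemma r_arr [simp]: "r n \<in> Arr C" "src C (r n) = pow n" "tgt C (r n) = A n"
  and s_arr [simp]: "s n \<in> Arr C" "src C (s n) = A n" "tgt C (s n) = pow n"
  using splitting by (auto simp: permutation_splitting_def)

lemma r_cmp_s [simp]: "r n \<Zsemi> s n = sym n"
  using splitting by (simp add: permutation_splitting_def sym_def)

lemma s_cmp_r [simp]: "s n \<Zsemi> r n = ident C (A n)"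
  using splitting by (simp add: permutation_splitting_def)

lemma r_1: "r (Suc 0) = ident C (A (Suc 0))"
  and s_1: "s (Suc 0) = ident C (A (Suc 0))"
  using splitting by (auto simp: permutation_splitting_def)

lemma sym_cmp_r [simp]: "sym n \<Zsemi> r n = r n"
  unfolding r_cmp_s[symmetric] by (simp add: cmp_assoc' del: r_cmp_s)

lemma s_cmp_sym [simp]: "s n \<Zsemi> sym n = s n"
  unfolding r_cmp_s[symmetric] by (simp add: cmp_assoc'[symmetric] del: r_cmp_s)

lemma perm_cmp_r:
  assumes "w \<in> perm_arrows n"
  shows "w \<Zsemi> r n = r n"
proof -
  have "(w \<Zsemi> sym n) \<Zsemi> r n = w \<Zsemi> r n"
    using perm_arrows_arr[OF assms] by (simp add: cmp_assoc')
  then show ?thesis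
    using assms by (simp add: perm_cmp_sym)
qed

lemma s_cmp_perm:
  assumes "w \<in> perm_arrows n"
  shows "s n \<Zsemi> w = s n"
proof -
  have "s n \<Zsemi> (sym n \<Zsemi> w) = s n \<Zsemi> w"
    using perm_arrows_arr[OF assms] by (simp add: cmp_assoc'[symmetric])
  then show ?thesis
    using assms by (simp add: sym_cmp_perm)
qed

lemma syms_cmp_r [simp]: "(sym m \<otimes>\<^sub>m sym n) \<Zsemi> r (m + n) = r (m + n)"
  by (rule tensor_syms_cmp) (auto simp: perm_cmp_r)

lemma s_cmp_syms [simp]: "s (m + n) \<Zsemi> (sym m \<otimes>\<^sub>m sym n) = s (m + n)"
  by (rule cmp_tensor_syms) (auto simp: s_cmp_perm)

lemma sym_tensor_id_cmp_r: "(sym m \<otimes>\<^sub>m id_pow n) \<Zsemi> r (m + n) = r (m + n)"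
  using tensor_sym_cmp[of "r (m + n)" 0 m n] by (simp add: perm_cmp_r)

lemma id_tensor_sym_cmp_r: "(id_pow m \<otimes>\<^sub>m sym n) \<Zsemi> r (m + n) = r (m + n)"
  using tensor_sym_cmp[of "r (m + n)" m n 0] by (simp add: perm_cmp_r)

lemma s_cmp_sym_tensor_id: "s (m + n) \<Zsemi> (sym m \<otimes>\<^sub>m id_pow n) = s (m + n)"
  using cmp_tensor_sym[of "s (m + n)" 0 m n] by (simp add: s_cmp_perm)

lemma s_cmp_id_tensor_sym: "s (m + n) \<Zsemi> (id_pow m \<otimes>\<^sub>m sym n) = s (m + n)"
  using cmp_tensor_sym[of "s (m + n)" m n 0] by (simp add: s_cmp_perm)

definition mult :: "nat \<Rightarrow> nat \<Rightarrow> 'm" where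
  "mult n p = (s n \<otimes>\<^sub>m s p) \<Zsemi> r (n + p)"

definition comult :: "nat \<Rightarrow> nat \<Rightarrow> 'm" where
  "comult n p = of_nat ((n + p) choose n) \<odot>\<^sub>m (s (n + p) \<Zsemi> (r n \<otimes>\<^sub>m r p))"

lemma mult_arr [simp]:
  "mult n p \<in> Arr C" "src C (mult n p) = A n \<otimes>\<^sub>o A p" "tgt C (mult n p) = A (n + p)"
  by (auto simp: mult_def)

lemma comult_arr [simp]:
  "comult n p \<in> Arr C" "src C (comult n p) = A (n + p)" "tgt C (comult n p) = A n \<otimes>\<^sub>o A p"
  by (auto simp: comult_def)

text \<open>In both composites the inner \<open>r\<close> meets an \<open>s\<close> and becomes the
  symmetrizer of a block, which the outer \<open>r\<close> absorbs. Both are then the same threefold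
  product.\<close>

lemma mult_assoc:
  "(mult n p \<otimes>\<^sub>m ident C (A q)) \<Zsemi> mult (n + p) q = (ident C (A n) \<otimes>\<^sub>m mult p q) \<Zsemi> mult n (p + q)"
proof -
  let ?s = "s n \<otimes>\<^sub>m s p \<otimes>\<^sub>m s q" and ?r = "r (n + p + q)"
  have "(mult n p \<otimes>\<^sub>m ident C (A q)) \<Zsemi> mult (n + p) q =
      (((s n \<otimes>\<^sub>m s p) \<Zsemi> sym (n + p)) \<otimes>\<^sub>m (s q \<Zsemi> id_pow q)) \<Zsemi> ?r"
    by (simp add: mult_def interchange_cmp cmp_assoc')
  also have "\<dots> = ?s \<Zsemi> ((sym (n + p) \<otimes>\<^sub>m id_pow q) \<Zsemi> ?r)"
    by (simp add: interchange_cmp)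
  also have "\<dots> = ?s \<Zsemi> ((id_pow n \<otimes>\<^sub>m sym (p + q)) \<Zsemi> ?r)"
    using sym_tensor_id_cmp_r[of "n + p" q] id_tensor_sym_cmp_r[of n "p + q"]
    by (simp add: add.assoc)
  also have "\<dots> = (s n \<otimes>\<^sub>m (s p \<otimes>\<^sub>m s q)) \<Zsemi> ((id_pow n \<otimes>\<^sub>m sym (p + q)) \<Zsemi> r (n + (p + q)))"
    by (simp add: tensor_arr_assoc add.assoc)
  also have "\<dots> = ((s n \<Zsemi> id_pow n) \<otimes>\<^sub>m ((s p \<otimes>\<^sub>m s q) \<Zsemi> sym (p + q))) \<Zsemi> r (n + (p + q))"
    by (simp add: interchange_cmp)
  also have "\<dots> = (ident C (A n) \<otimes>\<^sub>m mult p q) \<Zsemi> mult n (p + q)"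
    by (simp add: mult_def interchange_cmp cmp_assoc')
  finally show ?thesis .
qed

lemma comult_coassoc:
  "comult (n + p) q \<Zsemi> (comult n p \<otimes>\<^sub>m ident C (A q)) =
    comult n (p + q) \<Zsemi> (ident C (A n) \<otimes>\<^sub>m comult p q)"
proof -
  let ?r = "r n \<otimes>\<^sub>m r p \<otimes>\<^sub>m r q" and ?s = "s (n + p + q)"
  let ?d = "\<lambda>n p. s (n + p) \<Zsemi> (r n \<otimes>\<^sub>m r p)"
  have "?d (n + p) q \<Zsemi> (?d n p \<otimes>\<^sub>m ident C (A q)) =
      ?s \<Zsemi> ((r (n + p) \<otimes>\<^sub>m r q) \<Zsemi> (?d n p \<otimes>\<^sub>m ident C (A q)))"
    by (simp add: cmp_assoc')
  also have "\<dots> = ?s \<Zsemi> ((sym (n + p) \<Zsemi> (r n \<otimes>\<^sub>m r p)) \<otimes>\<^sub>m (id_pow q \<Zsemi> r q))"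
    by (simp add: interchange' cmp_assoc'[symmetric])
  also have "\<dots> = (?s \<Zsemi> (sym (n + p) \<otimes>\<^sub>m id_pow q)) \<Zsemi> ?r"
    by (simp add: interchange' cmp_assoc')
  also have "\<dots> = (?s \<Zsemi> (id_pow n \<otimes>\<^sub>m sym (p + q))) \<Zsemi> ?r"
    using s_cmp_sym_tensor_id[of "n + p" q] s_cmp_id_tensor_sym[of n "p + q"]
    by (simp add: add.assoc)
  also have "\<dots> = (s (n + (p + q)) \<Zsemi> (id_pow n \<otimes>\<^sub>m sym (p + q))) \<Zsemi> (r n \<otimes>\<^sub>m (r p \<otimes>\<^sub>m r q))"
    by (simp add: tensor_arr_assoc add.assoc)
  also have "\<dots> = s (n + (p + q)) \<Zsemi> ((id_pow n \<Zsemi> r n) \<otimes>\<^sub>m (sym (p + q) \<Zsemi> (r p \<otimes>\<^sub>m r q)))"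
    by (simp add: interchange' cmp_assoc')
  also have "\<dots> = s (n + (p + q)) \<Zsemi> ((r n \<otimes>\<^sub>m r (p + q)) \<Zsemi> (ident C (A n) \<otimes>\<^sub>m ?d p q))"
    by (simp add: interchange' cmp_assoc'[symmetric])
  also have "\<dots> = ?d n (p + q) \<Zsemi> (ident C (A n) \<otimes>\<^sub>m ?d p q)"
    by (simp add: cmp_assoc')
  finally have d: "?d (n + p) q \<Zsemi> (?d n p \<otimes>\<^sub>m ident C (A q)) = ?d n (p + q) \<Zsemi> (ident C (A n) \<otimes>\<^sub>m ?d p q)" .
  \<comment> \<open>Both products are the trinomial coefficient of \<open>n\<close>,
    \<open>p\<close>, \<open>q\<close>.\<close>
  have "((n + p + q) choose (n + p)) * ((n + p) choose n) =
      ((n + (p + q)) choose n) * ((p + q) choose p)"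
    using choose_mult[of n "n + p" "n + p + q"] by (simp add: add.assoc)
  then have "of_nat ((n + p + q) choose (n + p)) * of_nat ((n + p) choose n) =
      (of_nat ((n + (p + q)) choose n) * of_nat ((p + q) choose p) :: rat)"
    by (metis of_nat_mult)
  then show ?thesis
    using d by (simp add: comult_def mult.commute)
qed

text \<open>Naturality turns the symmetry of \<open>A n\<close> and \<open>A p\<close> into a block
  permutation of tensor powers, which \<open>r\<close> absorbs.\<close>

lemma mult_comm: "\<gamma> (A n) (A p) \<Zsemi> mult p n = mult n p"
proof -
  have "\<gamma> (A n) (A p) \<Zsemi> mult p n = (\<gamma> (A n) (A p) \<Zsemi> (s p \<otimes>\<^sub>m s n)) \<Zsemi> r (p + n)"
    by (simp add: mult_def cmp_assoc')
  also have "\<gamma> (A n) (A p) \<Zsemi> (s p \<otimes>\<^sub>m s n) = (s n \<otimes>\<^sub>m s p) \<Zsemi> braid n p"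
    by (simp add: symm_natural')
  also have "((s n \<otimes>\<^sub>m s p) \<Zsemi> braid n p) \<Zsemi> r (p + n) = (s n \<otimes>\<^sub>m s p) \<Zsemi> (braid n p \<Zsemi> r (n + p))"
    by (simp add: cmp_assoc' add.commute)
  also have "\<dots> = mult n p"
    by (simp add: mult_def perm_cmp_r braid_perm_arrows)
  finally show ?thesis .
qed

lemma comult_cocomm: "comult n p \<Zsemi> \<gamma> (A n) (A p) = comult p n"
proof -
  have "(s (n + p) \<Zsemi> (r n \<otimes>\<^sub>m r p)) \<Zsemi> \<gamma> (A n) (A p) = s (n + p) \<Zsemi> ((r n \<otimes>\<^sub>m r p) \<Zsemi> \<gamma> (A n) (A p))"
    by (simp add: cmp_assoc')
  also have "(r n \<otimes>\<^sub>m r p) \<Zsemi> \<gamma> (A n) (A p) = braid n p \<Zsemi> (r p \<otimes>\<^sub>m r n)"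
    by (simp add: symm_natural')
  also have "s (n + p) \<Zsemi> (braid n p \<Zsemi> (r p \<otimes>\<^sub>m r n)) = (s (n + p) \<Zsemi> braid n p) \<Zsemi> (r p \<otimes>\<^sub>m r n)"
    by (simp add: cmp_assoc' add.commute)
  also have "\<dots> = s (p + n) \<Zsemi> (r p \<otimes>\<^sub>m r n)"
    by (simp add: s_cmp_perm braid_perm_arrows add.commute)
  finally have "(s (n + p) \<Zsemi> (r n \<otimes>\<^sub>m r p)) \<Zsemi> \<gamma> (A n) (A p) = s (p + n) \<Zsemi> (r p \<otimes>\<^sub>m r n)" .
  moreover have "(n + p) choose n = (p + n) choose p"
    using binomial_symmetric[of n "n + p"] by (simp add: add.commute)
  ultimately show ?thesis
    by (simp add: comult_def)
qed

lemma comult_mult: "comult n p \<Zsemi> mult n p = of_nat ((n + p) choose n) \<odot>\<^sub>m ident C (A (n + p))"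
proof -
  have "(s (n + p) \<Zsemi> (r n \<otimes>\<^sub>m r p)) \<Zsemi> ((s n \<otimes>\<^sub>m s p) \<Zsemi> r (n + p)) =
      (s (n + p) \<Zsemi> (sym n \<otimes>\<^sub>m sym p)) \<Zsemi> r (n + p)"
    by (simp add: cmp_assoc' interchange_cmp del: s_cmp_syms syms_cmp_r)
  then show ?thesis
    by (simp add: comult_def mult_def)
qed

text \<open>Naturality moves the inner \<open>r\<close> and \<open>s\<close> past the symmetry until
  they meet and form symmetrizers, which the outer \<open>r\<close> absorb. The symmetrizers inside
  \<open>double_coset\<close> can be inserted for the same reason, since the outer \<open>s\<close>
  and \<open>r\<close> absorb them.\<close>

lemma comult_swap_mult:
  "(comult a b \<otimes>\<^sub>m comult c d) \<Zsemi> (ident C (A a) \<otimes>\<^sub>m \<gamma> (A b) (A c) \<otimes>\<^sub>m ident C (A d))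
      \<Zsemi> (mult a c \<otimes>\<^sub>m mult b d) =
    of_nat (((a + b) choose a) * ((c + d) choose c)) \<odot>\<^sub>m
      ((s (a + b) \<otimes>\<^sub>m s (c + d)) \<Zsemi> (double_coset a b c d \<Zsemi> (r (a + c) \<otimes>\<^sub>m r (b + d))))"
proof -
  let ?S = "s (a + b) \<otimes>\<^sub>m s (c + d)" and ?R = "r (a + c) \<otimes>\<^sub>m r (b + d)"
  let ?M = "id_pow a \<otimes>\<^sub>m braid b c \<otimes>\<^sub>m id_pow d"
  let ?U = "(r a \<otimes>\<^sub>m r b) \<otimes>\<^sub>m (r c \<otimes>\<^sub>m r d)" and ?V = "(s a \<otimes>\<^sub>m s c) \<otimes>\<^sub>m (s b \<otimes>\<^sub>m s d)"
  let ?mid = "ident C (A a) \<otimes>\<^sub>m \<gamma> (A b) (A c) \<otimes>\<^sub>m ident C (A d)"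
  let ?P = "(sym a \<otimes>\<^sub>m sym c) \<otimes>\<^sub>m (sym b \<otimes>\<^sub>m sym d)"
  have core: "?U \<Zsemi> (?mid \<Zsemi> ?V) = ?M \<Zsemi> ?P"
  proof -
    have "?U \<Zsemi> (?mid \<Zsemi> ?V) = (r a \<otimes>\<^sub>m (r b \<otimes>\<^sub>m r c) \<otimes>\<^sub>m r d) \<Zsemi> (?mid \<Zsemi> (s a \<otimes>\<^sub>m (s c \<otimes>\<^sub>m s b) \<otimes>\<^sub>m s d))"
      by (simp add: tensor_arr_assoc)
    also have "\<dots> = sym a \<otimes>\<^sub>m ((r b \<otimes>\<^sub>m r c) \<Zsemi> (\<gamma> (A b) (A c) \<Zsemi> (s c \<otimes>\<^sub>m s b))) \<otimes>\<^sub>m sym d"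
      by (simp add: interchange')
    also have "(r b \<otimes>\<^sub>m r c) \<Zsemi> (\<gamma> (A b) (A c) \<Zsemi> (s c \<otimes>\<^sub>m s b)) =
        ((r b \<otimes>\<^sub>m r c) \<Zsemi> \<gamma> (A b) (A c)) \<Zsemi> (s c \<otimes>\<^sub>m s b)"
      by (simp add: cmp_assoc')
    also have "\<dots> = braid b c \<Zsemi> (sym c \<otimes>\<^sub>m sym b)"
      by (simp add: symm_natural' cmp_assoc' interchange')
    also have "sym a \<otimes>\<^sub>m (braid b c \<Zsemi> (sym c \<otimes>\<^sub>m sym b)) \<otimes>\<^sub>m sym d =
        ?M \<Zsemi> (sym a \<otimes>\<^sub>m (sym c \<otimes>\<^sub>m sym b) \<otimes>\<^sub>m sym d)"
      by (simp add: interchange' add.commute)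
    also have "\<dots> = ?M \<Zsemi> ?P"
      by (simp add: tensor_arr_assoc)
    finally show ?thesis .
  qed
  have PR: "?P \<Zsemi> ?R = ?R"
    by (simp add: interchange')
  let ?d = "\<lambda>n p. s (n + p) \<Zsemi> (r n \<otimes>\<^sub>m r p)"
  have U: "?d a b \<otimes>\<^sub>m ?d c d = ?S \<Zsemi> ?U" and V: "mult a c \<otimes>\<^sub>m mult b d = ?V \<Zsemi> ?R"
    by (simp_all add: interchange' mult_def)
  have "(?d a b \<otimes>\<^sub>m ?d c d) \<Zsemi> ?mid \<Zsemi> (mult a c \<otimes>\<^sub>m mult b d) =
      ?S \<Zsemi> ((?U \<Zsemi> (?mid \<Zsemi> ?V)) \<Zsemi> ?R)"
    unfolding U V by (simp add: cmp_assoc')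
  also have "\<dots> = ?S \<Zsemi> (?M \<Zsemi> (?P \<Zsemi> ?R))"
    unfolding core by (simp add: cmp_assoc' add_ac)
  also have "\<dots> = ?S \<Zsemi> (?M \<Zsemi> ?R)"
    unfolding PR ..
  also have "\<dots> = ?S \<Zsemi> (double_coset a b c d \<Zsemi> ?R)"
  proof -
    have "?S \<Zsemi> (double_coset a b c d \<Zsemi> ?R) =
        (?S \<Zsemi> (sym (a + b) \<otimes>\<^sub>m sym (c + d))) \<Zsemi> (?M \<Zsemi> ((sym (a + c) \<otimes>\<^sub>m sym (b + d)) \<Zsemi> ?R))"
      by (simp add: double_coset_def cmp_assoc' add_ac)
    then show ?thesis
      by (simp add: interchange')
  qed
  finally have eq: "(?d a b \<otimes>\<^sub>m ?d c d) \<Zsemi> ?mid \<Zsemi> (mult a c \<otimes>\<^sub>m mult b d) =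
      ?S \<Zsemi> (double_coset a b c d \<Zsemi> ?R)" .
  show ?thesis
    unfolding comult_def eq[symmetric] by (simp add: mult.commute)
qed

text \<open>The \<open>r\<close> of \<open>mult n p\<close> meets the \<open>s\<close> of
  \<open>comult q t\<close> in a symmetrizer, so this is the double coset formula with
  \<open>S\<close> in front and \<open>R\<close> behind. The binomial factors of the
  comultiplications are exactly its coefficients.\<close>

lemma mult_comult:
  assumes "n + p = q + t"
  shows "mult n p \<Zsemi> comult q t =
    hsum (A n \<otimes>\<^sub>o A p) (A q \<otimes>\<^sub>o A t)
      (\<lambda>(a, b, c, d). (comult a b \<otimes>\<^sub>m comult c d)
        \<Zsemi> (ident C (A a) \<otimes>\<^sub>m \<gamma> (A b) (A c) \<otimes>\<^sub>m ident C (A d))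
        \<Zsemi> (mult a c \<otimes>\<^sub>m mult b d))
      (contingency_tables n p q t)"
proof -
  define S where "S = s n \<otimes>\<^sub>m s p"
  define R where "R = r q \<otimes>\<^sub>m r t"
  let ?N = "n + p"
  let ?f = "\<lambda>(a, b, c, d). of_nat ((n choose a) * (p choose c)) \<odot>\<^sub>m double_coset a b c d"
  have [simp]: "S \<in> Arr C" "src C S = A n \<otimes>\<^sub>o A p" "tgt C S = pow ?N"
    by (auto simp: S_def)
  have [simp]: "R \<in> Arr C" "src C R = pow ?N" "tgt C R = A q \<otimes>\<^sub>o A t"
    using assms by (auto simp: R_def)
  have f: "?f i \<in> endo ?N" if "i \<in> contingency_tables n p q t" for i
    using that by (auto simp: contingency_tables_def add_ac)
  have "mult n p \<Zsemi> comult q t = (S \<Zsemi> r ?N) \<Zsemi> (of_nat (?N choose q) \<odot>\<^sub>m (s ?N \<Zsemi> R))"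
    using assms by (simp add: mult_def comult_def S_def R_def)
  also have "\<dots> = of_nat (?N choose q) \<odot>\<^sub>m (S \<Zsemi> ((r ?N \<Zsemi> s ?N) \<Zsemi> R))"
    by (simp add: cmp_assoc' del: r_cmp_s)
  also have "\<dots> = S \<Zsemi> ((of_nat (?N choose q) \<odot>\<^sub>m sym ?N) \<Zsemi> R)"
    by simp
  also have "\<dots> = S \<Zsemi> (hsum (pow ?N) (pow ?N) ?f (contingency_tables n p q t) \<Zsemi> R)"
    unfolding sym_eq_sum_double_cosets[OF assms] ..
  also have "\<dots> = hsum (A n \<otimes>\<^sub>o A p) (A q \<otimes>\<^sub>o A t) (\<lambda>i. S \<Zsemi> (?f i \<Zsemi> R)) (contingency_tables n p q t)"
    using f by (intro hsum_linear[where \<phi> = "\<lambda>x. S \<Zsemi> (x \<Zsemi> R)"])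
      (auto simp: add_cmp' cmp_add')
  also have "\<dots> = hsum (A n \<otimes>\<^sub>o A p) (A q \<otimes>\<^sub>o A t)
      (\<lambda>(a, b, c, d). (comult a b \<otimes>\<^sub>m comult c d)
        \<Zsemi> (ident C (A a) \<otimes>\<^sub>m \<gamma> (A b) (A c) \<otimes>\<^sub>m ident C (A d))
        \<Zsemi> (mult a c \<otimes>\<^sub>m mult b d))
      (contingency_tables n p q t)"
  proof (intro hsum_cong)
    fix i
    assume "i \<in> contingency_tables n p q t"
    then obtain a b c d where i: "i = (a, b, c, d)" "n = a + b" "p = c + d" "q = a + c" "t = b + d"
      by (auto simp: contingency_tables_def)
    show "S \<Zsemi> (?f i \<Zsemi> R) = (case i of (a, b, c, d) \<Rightarrow> (comult a b \<otimes>\<^sub>m comult c d)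
        \<Zsemi> (ident C (A a) \<otimes>\<^sub>m \<gamma> (A b) (A c) \<otimes>\<^sub>m ident C (A d))
        \<Zsemi> (mult a c \<otimes>\<^sub>m mult b d))"
      by (simp add: i comult_swap_mult S_def R_def add_ac)
    show "(case i of (a, b, c, d) \<Rightarrow> (comult a b \<otimes>\<^sub>m comult c d)
        \<Zsemi> (ident C (A a) \<otimes>\<^sub>m \<gamma> (A b) (A c) \<otimes>\<^sub>m ident C (A d))
        \<Zsemi> (mult a c \<otimes>\<^sub>m mult b d)) \<in> homset C (A n \<otimes>\<^sub>o A p) (A q \<otimes>\<^sub>o A t)"
      by (simp add: i)
  qed auto
  finally show ?thesis .
qed

lemma mult_unit: "(r 0 \<otimes>\<^sub>m ident C (A n)) \<Zsemi> mult 0 n = ident C (A n)"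
  by (simp add: mult_def interchange_cmp)

lemma comult_counit: "comult 0 n \<Zsemi> (s 0 \<otimes>\<^sub>m ident C (A n)) = ident C (A n)"
  by (simp add: comult_def interchange' cmp_assoc')

theorem binomial_bimonoid_mult_comult: "binomial_bimonoid A mult comult (r 0) (s 0)"
proof -
  have "mult 0 0 \<Zsemi> s 0 = s 0 \<otimes>\<^sub>m s 0"
    by (simp add: mult_def cmp_assoc')
  moreover have "r 0 \<Zsemi> comult 0 0 = r 0 \<otimes>\<^sub>m r 0"
    by (simp add: comult_def cmp_assoc'[symmetric])
  moreover have "r 0 \<Zsemi> s 0 = ident C (unit_obj C)"
    by simp
  moreover have "s 0 \<Zsemi> r 0 = ident C (A 0)"
    by simp
  ultimately show ?thesis
    unfolding binomial_bimonoid_def contingency_tables_def[symmetric]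
    using mult_unit mult_assoc mult_comm comult_counit comult_coassoc comult_cocomm
      mult_comult comult_mult
    by (intro conjI allI impI) (auto simp: r_arr s_arr)
qed

section \<open>Recovering a splitting from its bimonoid\<close>

lemma to_bimonoid_eq: "to_bimonoid (r, s) = (mult, comult, r 0, s 0)"
  by (simp add: to_bimonoid_def mult_def comult_def fun_eq_iff)

text \<open>Parameter \<open>n\<close> means \<open>n + 1\<close> factors. As \<open>s\<close> is
  the identity in degree 1, a further factor contributes a symmetrizer on the previous ones, which
  \<open>r\<close> absorbs. Two factors are a case of their own in \<open>iterated_mult\<close>,
  hence the two base cases.\<close>

lemma iterated_mult_eq_r: "iterated_mult A mult (\<lambda>_. 1) n = r (Suc n)"
proof (induction n rule: induct_nat_012)
  case 0
  show ?case by (simp add: r_1)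
next
  case 1
  show ?case
    by (simp add: mult_def s_1 tensor_pow.simps)
next
  case (ge2 n)
  let ?n = "Suc (Suc n)"
  have "iterated_mult A mult (\<lambda>_. 1) ?n = (r ?n \<otimes>\<^sub>m ident C (A (Suc 0))) \<Zsemi> mult ?n (Suc 0)"
    using ge2.IH(2) by simp
  also have "\<dots> = (sym ?n \<otimes>\<^sub>m id_pow 1) \<Zsemi> r (?n + 1)"
    by (simp add: mult_def interchange_cmp s_1 tensor_pow_1 tensor_pow.simps(2)[symmetric])
  also have "\<dots> = r (Suc ?n)"
    unfolding sym_tensor_id_cmp_r by simp
  finally show ?case .
qed

text \<open>Each comultiplication splitting off one factor brings the binomial coefficient of its
  total degree over 1. Their product is the factorial that the scalar removes.\<close>

lemma iterated_comult_eq_s: "(1 / fact (Suc n)) \<odot>\<^sub>m iterated_comult A comult (\<lambda>_. 1) n = s (Suc n)"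
proof -
  have "iterated_comult A comult (\<lambda>_. 1) n = fact (Suc n) \<odot>\<^sub>m s (Suc n)"
  proof (induction n rule: induct_nat_012)
    case 0
    show ?case by (simp add: s_1)
  next
    case 1
    show ?case
      by (simp add: comult_def r_1 tensor_pow.simps)
  next
    case (ge2 n)
    let ?n = "Suc (Suc n)"
    have "iterated_comult A comult (\<lambda>_. 1) ?n = comult ?n (Suc 0) \<Zsemi> ((fact ?n \<odot>\<^sub>m s ?n) \<otimes>\<^sub>m ident C (A (Suc 0)))"
      using ge2.IH(2) by simp
    also have "\<dots> = (of_nat (Suc ?n) * fact ?n) \<odot>\<^sub>m ((s (?n + 1) \<Zsemi> (r ?n \<otimes>\<^sub>m r 1)) \<Zsemi> (s ?n \<otimes>\<^sub>m ident C (A (Suc 0))))"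
      by (simp add: comult_def mult.commute del: fact_Suc of_nat_Suc)
    also have "(s (?n + 1) \<Zsemi> (r ?n \<otimes>\<^sub>m r 1)) \<Zsemi> (s ?n \<otimes>\<^sub>m ident C (A (Suc 0))) = s (?n + 1) \<Zsemi> (sym ?n \<otimes>\<^sub>m id_pow 1)"
      by (simp add: interchange' cmp_assoc' r_1 tensor_pow_1 tensor_pow.simps(2)[symmetric])
    also have "\<dots> = s (?n + 1)"
      by (rule s_cmp_sym_tensor_id)
    finally show ?case
      by (simp only: fact_Suc[symmetric] of_nat_id) (simp del: fact_Suc)
  qed
  then show ?thesis
    by (simp del: fact_Suc)
qed

theorem to_splitting_to_bimonoid: "to_splitting A (to_bimonoid (r, s)) = (r, s)"
proof -
  have "iterated_mult A mult (\<lambda>_. 1) (n - 1) = r n" if "n \<noteq> 0" for n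
    using that iterated_mult_eq_r[of "n - 1"] by simp
  moreover have "(1 / fact n) \<odot>\<^sub>m iterated_comult A comult (\<lambda>_. 1) (n - 1) = s n" if "n \<noteq> 0" for n
    using that iterated_comult_eq_s[of "n - 1"] by (cases n) (simp_all del: fact_Suc)
  ultimately show ?thesis
    unfolding to_bimonoid_eq to_splitting_def by (auto simp: fun_eq_iff)
qed

end

section \<open>From binomial bimonoids to permutation splittings\<close>

locale bimonoid = nnrat_linear_symmetric_monoidal_category C
  for C :: "('o, 'm, 'x) linear_monoidal_category_scheme" (structure) +
  fixes A :: "nat \<Rightarrow> 'o" and \<mu> \<delta> :: "nat \<Rightarrow> nat \<Rightarrow> 'm" and \<eta> \<epsilon> :: 'm
  assumes A_closed [simp]: "A n \<in> Obj C"
    and bimonoid: "binomial_bimonoid A \<mu> \<delta> \<eta> \<epsilon>"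

sublocale bimonoid \<subseteq> linear_tensor_powers C "A (Suc 0)"
  by unfold_locales simp

context bimonoid
begin

lemma structure_arr [simp]:
  "\<mu> n p \<in> Arr C" "src C (\<mu> n p) = A n \<otimes>\<^sub>o A p" "tgt C (\<mu> n p) = A (n + p)"
  "\<delta> n p \<in> Arr C" "src C (\<delta> n p) = A (n + p)" "tgt C (\<delta> n p) = A n \<otimes>\<^sub>o A p"
  "\<eta> \<in> Arr C" "src C \<eta> = unit_obj C" "tgt C \<eta> = A 0"
  "\<epsilon> \<in> Arr C" "src C \<epsilon> = A 0" "tgt C \<epsilon> = unit_obj C"
  using bimonoid unfolding binomial_bimonoid_def by auto

lemma
  unit_left: "(\<eta> \<otimes>\<^sub>m ident C (A n)) \<Zsemi> \<mu> 0 n = ident C (A n)" and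
  assoc: "(\<mu> n p \<otimes>\<^sub>m ident C (A q)) \<Zsemi> \<mu> (n + p) q = (ident C (A n) \<otimes>\<^sub>m \<mu> p q) \<Zsemi> \<mu> n (p + q)" and
  comm: "\<gamma> (A n) (A p) \<Zsemi> \<mu> p n = \<mu> n p" and
  counit_left: "\<delta> 0 n \<Zsemi> (\<epsilon> \<otimes>\<^sub>m ident C (A n)) = ident C (A n)" and
  coassoc: "\<delta> (n + p) q \<Zsemi> (\<delta> n p \<otimes>\<^sub>m ident C (A q)) =
    \<delta> n (p + q) \<Zsemi> (ident C (A n) \<otimes>\<^sub>m \<delta> p q)" and
  cocomm: "\<delta> n p \<Zsemi> \<gamma> (A n) (A p) = \<delta> p n" and
  unit_counit [simp]: "\<eta> \<Zsemi> \<epsilon> = ident C (unit_obj C)" and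
  compat: "n + p = q + r \<Longrightarrow> \<mu> n p \<Zsemi> \<delta> q r =
    hsum (A n \<otimes>\<^sub>o A p) (A q \<otimes>\<^sub>o A r)
      (\<lambda>(a, b, c, d). (\<delta> a b \<otimes>\<^sub>m \<delta> c d)
        \<Zsemi> (ident C (A a) \<otimes>\<^sub>m \<gamma> (A b) (A c) \<otimes>\<^sub>m ident C (A d))
        \<Zsemi> (\<mu> a c \<otimes>\<^sub>m \<mu> b d))
      (contingency_tables n p q r)" and
  counit_unit [simp]: "\<epsilon> \<Zsemi> \<eta> = ident C (A 0)" and
  special: "\<delta> n p \<Zsemi> \<mu> n p = of_nat ((n + p) choose n) \<odot>\<^sub>m ident C (A (n + p))"
  using bimonoid unfolding binomial_bimonoid_def contingency_tables_def by blast+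

text \<open>\<open>\<eta>\<close> and \<open>\<epsilon>\<close> are mutually inverse, so the right
  unit law can be solved for the multiplication.\<close>

lemma mult_zero_right: "\<mu> n 0 = ident C (A n) \<otimes>\<^sub>m \<epsilon>"
proof -
  have "(ident C (A n) \<otimes>\<^sub>m \<eta>) \<Zsemi> \<mu> n 0 = ((ident C (A n) \<otimes>\<^sub>m \<eta>) \<Zsemi> \<gamma> (A n) (A 0)) \<Zsemi> \<mu> 0 n"
    unfolding comm[of n 0, symmetric] by (simp add: cmp_assoc')
  also have "\<dots> = ident C (A n)"
    by (simp add: symm_natural' unit_left)
  finally have unit_right: "(ident C (A n) \<otimes>\<^sub>m \<eta>) \<Zsemi> \<mu> n 0 = ident C (A n)" .
  have "\<mu> n 0 = (ident C (A n) \<otimes>\<^sub>m (\<epsilon> \<Zsemi> \<eta>)) \<Zsemi> \<mu> n 0"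
    by simp
  also have "\<dots> = (ident C (A n) \<otimes>\<^sub>m \<epsilon>) \<Zsemi> ((ident C (A n) \<otimes>\<^sub>m \<eta>) \<Zsemi> \<mu> n 0)"
    by (simp add: interchange_cmp del: counit_unit)
  also have "\<dots> = ident C (A n) \<otimes>\<^sub>m \<epsilon>"
    by (simp add: unit_right)
  finally show ?thesis .
qed

lemma comult_zero_right: "\<delta> n 0 = ident C (A n) \<otimes>\<^sub>m \<eta>"
proof -
  have "\<delta> n 0 \<Zsemi> (ident C (A n) \<otimes>\<^sub>m \<epsilon>) = \<delta> 0 n \<Zsemi> (\<gamma> (A 0) (A n) \<Zsemi> (ident C (A n) \<otimes>\<^sub>m \<epsilon>))"
    unfolding cocomm[of 0 n, symmetric] by (simp add: cmp_assoc')
  also have "\<gamma> (A 0) (A n) \<Zsemi> (ident C (A n) \<otimes>\<^sub>m \<epsilon>) = \<epsilon> \<otimes>\<^sub>m ident C (A n)"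
    using symm_natural'[of \<epsilon> "ident C (A n)" "unit_obj C" "A n"] by simp
  finally have counit_right: "\<delta> n 0 \<Zsemi> (ident C (A n) \<otimes>\<^sub>m \<epsilon>) = ident C (A n)"
    by (simp add: counit_left)
  have "\<delta> n 0 = \<delta> n 0 \<Zsemi> (ident C (A n) \<otimes>\<^sub>m (\<epsilon> \<Zsemi> \<eta>))"
    by simp
  also have "\<dots> = (\<delta> n 0 \<Zsemi> (ident C (A n) \<otimes>\<^sub>m \<epsilon>)) \<Zsemi> (ident C (A n) \<otimes>\<^sub>m \<eta>)"
    by (simp add: interchange' cmp_assoc' del: counit_unit)
  also have "\<dots> = ident C (A n) \<otimes>\<^sub>m \<eta>"
    by (simp add: counit_right)
  finally show ?thesis .
qed

text \<open>Conjugation by the isomorphism \<open>\<epsilon>\<close> moves the symmetry to the unit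
  object, where it is trivial.\<close>

lemma symm_A0: "\<gamma> (A 0) (A 0) = ident C (A 0 \<otimes>\<^sub>o A 0)"
proof -
  have "\<gamma> (A 0) (A 0) = ((\<epsilon> \<Zsemi> \<eta>) \<otimes>\<^sub>m (\<epsilon> \<Zsemi> \<eta>)) \<Zsemi> \<gamma> (A 0) (A 0)"
    by simp
  also have "\<dots> = (\<epsilon> \<otimes>\<^sub>m \<epsilon>) \<Zsemi> ((\<eta> \<otimes>\<^sub>m \<eta>) \<Zsemi> \<gamma> (A 0) (A 0))"
    by (simp add: interchange_cmp del: counit_unit)
  also have "(\<eta> \<otimes>\<^sub>m \<eta>) \<Zsemi> \<gamma> (A 0) (A 0) = \<eta> \<otimes>\<^sub>m \<eta>"
    by (simp add: symm_natural')
  also have "(\<epsilon> \<otimes>\<^sub>m \<epsilon>) \<Zsemi> (\<eta> \<otimes>\<^sub>m \<eta>) = ident C (A 0 \<otimes>\<^sub>o A 0)"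
    by (simp add: interchange')
  finally show ?thesis .
qed

text \<open>Only two tables have margins \<open>(Suc m, 1)\<close> in both directions: the single
  factor stays alone, or it changes places with one factor of the block. The degree 0 parts
  disappear because \<open>A 0\<close> is isomorphic to the unit object.\<close>

lemma mult_one_comult_one:
  "\<mu> (Suc m) (Suc 0) \<Zsemi> \<delta> (Suc m) (Suc 0) = ident C (A (Suc m) \<otimes>\<^sub>o A (Suc 0)) \<oplus>\<^sub>m
    (\<delta> m (Suc 0) \<otimes>\<^sub>m ident C (A (Suc 0))) \<Zsemi> (ident C (A m) \<otimes>\<^sub>m \<gamma> (A (Suc 0)) (A (Suc 0)))
      \<Zsemi> (\<mu> m (Suc 0) \<otimes>\<^sub>m ident C (A (Suc 0)))"
proof -
  let ?n = "Suc m" and ?A1 = "A (Suc 0)"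
  let ?f = "\<lambda>(a, b, c, d). (\<delta> a b \<otimes>\<^sub>m \<delta> c d)
        \<Zsemi> (ident C (A a) \<otimes>\<^sub>m \<gamma> (A b) (A c) \<otimes>\<^sub>m ident C (A d))
        \<Zsemi> (\<mu> a c \<otimes>\<^sub>m \<mu> b d)"
  have T: "contingency_tables ?n 1 ?n 1 = {(?n, 0, 0, 1)} \<union> {(m, 1, 1, 0)}"
    by (auto simp: contingency_tables_def)
  have f1: "?f (?n, 0, 0, 1) = ident C (A ?n \<otimes>\<^sub>o ?A1)"
  proof -
    have "?f (?n, 0, 0, 1) = (\<delta> ?n 0 \<Zsemi> \<mu> ?n 0) \<otimes>\<^sub>m (\<delta> 0 1 \<Zsemi> \<mu> 0 1)"
      by (simp add: symm_A0 interchange')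
    then show ?thesis
      by (simp add: special)
  qed
  have f2: "?f (m, 1, 1, 0) = (\<delta> m 1 \<otimes>\<^sub>m ident C ?A1) \<Zsemi> (ident C (A m) \<otimes>\<^sub>m \<gamma> ?A1 ?A1)
      \<Zsemi> (\<mu> m 1 \<otimes>\<^sub>m ident C ?A1)"
  proof -
    have "?f (m, 1, 1, 0) = (((\<delta> m 1 \<otimes>\<^sub>m ident C ?A1) \<otimes>\<^sub>m \<eta>) \<Zsemi>
        ((ident C (A m) \<otimes>\<^sub>m \<gamma> ?A1 ?A1) \<otimes>\<^sub>m ident C (A 0))) \<Zsemi> ((\<mu> m 1 \<otimes>\<^sub>m ident C ?A1) \<otimes>\<^sub>m \<epsilon>)"
      by (simp add: comult_zero_right mult_zero_right tensor_arr_assoc)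
    also have "\<dots> = ((\<delta> m 1 \<otimes>\<^sub>m ident C ?A1) \<Zsemi> (ident C (A m) \<otimes>\<^sub>m \<gamma> ?A1 ?A1)
      \<Zsemi> (\<mu> m 1 \<otimes>\<^sub>m ident C ?A1)) \<otimes>\<^sub>m (\<eta> \<Zsemi> ident C (A 0) \<Zsemi> \<epsilon>)"
      by (subst interchange', simp_all)+
    finally show ?thesis
      by simp
  qed
  have "\<mu> ?n 1 \<Zsemi> \<delta> ?n 1 = hsum (A ?n \<otimes>\<^sub>o A 1) (A ?n \<otimes>\<^sub>o A 1) ?f ({(?n, 0, 0, 1)} \<union> {(m, 1, 1, 0)})"
    unfolding T[symmetric] by (rule compat) simp
  also have "\<dots> = hsum (A ?n \<otimes>\<^sub>o A 1) (A ?n \<otimes>\<^sub>o A 1) ?f {(?n, 0, 0, 1)} \<oplus>\<^sub>m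
      hsum (A ?n \<otimes>\<^sub>o A 1) (A ?n \<otimes>\<^sub>o A 1) ?f {(m, 1, 1, 0)}"
    by (intro hsum_Un_disjoint) auto
  also have "hsum (A ?n \<otimes>\<^sub>o A 1) (A ?n \<otimes>\<^sub>o A 1) ?f {(?n, 0, 0, 1)} = ?f (?n, 0, 0, 1)"
    by (rule hsum_singleton) auto
  also have "hsum (A ?n \<otimes>\<^sub>o A 1) (A ?n \<otimes>\<^sub>o A 1) ?f {(m, 1, 1, 0)} = ?f (m, 1, 1, 0)"
    by (rule hsum_singleton) auto
  finally show ?thesis
    unfolding f1 f2 by simp
qed

section \<open>The splitting attached to a bimonoid\<close>

definition R :: "nat \<Rightarrow> 'm" where "R = fst (to_splitting A (\<mu>, \<delta>, \<eta>, \<epsilon>))"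

definition S :: "nat \<Rightarrow> 'm" where "S = snd (to_splitting A (\<mu>, \<delta>, \<eta>, \<epsilon>))"

lemma R_0 [simp]: "R 0 = \<eta>" and S_0 [simp]: "S 0 = \<epsilon>"
  by (simp_all add: R_def S_def to_splitting_def)

lemma R_1: "R (Suc 0) = ident C (A (Suc 0))" and S_1: "S (Suc 0) = ident C (A (Suc 0))"
  by (simp_all add: R_def S_def to_splitting_def)

lemma iterated_comult_arr:
  "iterated_comult A \<delta> (\<lambda>_. 1) n \<in> homset C (A (Suc n)) (pow (Suc n))"
proof (induction n rule: induct_nat_012)
  case (ge2 n)
  then show ?case by (simp add: tensor_pow.simps(2)[of C _ "Suc (Suc n)"])
qed (auto simp: tensor_pow.simps)

text \<open>A recursion uniform from \<open>n = 0\<close> on: there it is the unit law, and for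
  \<open>n = 1\<close> it is the clause for two indices preceded by an identity.\<close>

lemma R_Suc: "R (Suc n) = (R n \<otimes>\<^sub>m ident C (A (Suc 0))) \<Zsemi> \<mu> n (Suc 0)"
proof -
  consider "n = 0" | "n = 1" | k where "n = Suc (Suc k)"
    by (metis One_nat_def not0_implies_Suc)
  then show ?thesis
  proof cases
    case 1
    then show ?thesis by (simp add: R_1 unit_left)
  next
    case 2
    then show ?thesis by (simp add: R_1) (simp add: R_def to_splitting_def)
  next
    case 3
    then show ?thesis by (simp add: R_def to_splitting_def)
  qed
qed

lemma S_Suc: "S (Suc n) = (1 / of_nat (Suc n)) \<odot>\<^sub>m (\<delta> n (Suc 0) \<Zsemi> (S n \<otimes>\<^sub>m ident C (A (Suc 0))))"
proof -
  consider "n = 0" | "n = 1" | k where "n = Suc (Suc k)"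
    by (metis One_nat_def not0_implies_Suc)
  then show ?thesis
  proof cases
    case 1
    then show ?thesis by (simp add: S_1 counit_left)
  next
    case 2
    then show ?thesis by (simp add: S_1) (simp add: S_def to_splitting_def)
  next
    case 3
    have "1 / of_nat (Suc n) * (1 / fact n) = (1 / fact (Suc n) :: rat)"
      by (simp add: divide_simps)
    then show ?thesis
      using 3 iterated_comult_arr[of "Suc k"]
      by (simp add: S_def to_splitting_def del: fact_Suc of_nat_Suc)
  qed
qed

lemma R_arr [simp]: "R n \<in> Arr C" "src C (R n) = pow n" "tgt C (R n) = A n"
proof -
  have "R n \<in> homset C (pow n) (A n)"
    by (induction n) (auto simp: R_Suc tensor_pow.simps)
  then show "R n \<in> Arr C" "src C (R n) = pow n" "tgt C (R n) = A n" by auto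
qed

lemma S_arr [simp]: "S n \<in> Arr C" "src C (S n) = A n" "tgt C (S n) = pow n"
proof -
  have "S n \<in> homset C (A n) (pow n)"
    by (induction n) (auto simp: S_Suc tensor_pow.simps)
  then show "S n \<in> Arr C" "src C (S n) = A n" "tgt C (S n) = pow n" by auto
qed

text \<open>The innermost pair cancels by induction. What is left is \<open>special\<close> for
  \<open>n\<close> and 1, whose binomial coefficient \<open>n + 1\<close> is cancelled by the scalar
  in \<open>S_Suc\<close>.\<close>

lemma S_cmp_R [simp]: "S n \<Zsemi> R n = ident C (A n)"
proof (induction n)
  case 0
  then show ?case by simp
next
  case (Suc n)
  have "(\<delta> n (Suc 0) \<Zsemi> (S n \<otimes>\<^sub>m ident C (A (Suc 0)))) \<Zsemi> ((R n \<otimes>\<^sub>m ident C (A (Suc 0))) \<Zsemi> \<mu> n (Suc 0)) =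
      \<delta> n (Suc 0) \<Zsemi> \<mu> n (Suc 0)"
    using Suc by (simp add: cmp_assoc' interchange_cmp)
  also have "\<dots> = of_nat (Suc n) \<odot>\<^sub>m ident C (A (Suc n))"
    using special[of n "Suc 0"] by simp
  finally show ?case
    by (simp add: R_Suc S_Suc del: of_nat_Suc)
qed

lemma mult_one: "\<mu> n (Suc 0) = (S n \<otimes>\<^sub>m ident C (A (Suc 0))) \<Zsemi> R (Suc n)"
  by (simp add: R_Suc interchange_cmp)

lemma comult_one: "\<delta> n (Suc 0) = of_nat (Suc n) \<odot>\<^sub>m (S (Suc n) \<Zsemi> (R n \<otimes>\<^sub>m ident C (A (Suc 0))))"
  by (simp add: S_Suc interchange' cmp_assoc' del: of_nat_Suc)

lemma R_cmp_S: "R n \<Zsemi> S n = sym n"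
\<comment> \<open>The step uses both \<open>m\<close> and \<open>Suc m\<close>: removing the last
  factor leaves \<open>Suc m\<close>, and exchanging the last two leaves the first \<open>m\<close>
  in place.\<close>
proof (induction n rule: induct_nat_012)
  case 0
  then show ?case by simp
next
  case 1
  then show ?case by (simp add: R_1 S_1 sym_1 tensor_pow_1)
next
  case (ge2 m)
  let ?n = "Suc m" and ?A1 = "A (Suc 0)"
  let ?i = "ident C ?A1"
  let ?g = "ident C (A m) \<otimes>\<^sub>m \<gamma> ?A1 ?A1"
  let ?P = "sym ?n \<otimes>\<^sub>m ?i"
  let ?h = "id_pow m \<otimes>\<^sub>m \<gamma> ?A1 ?A1"
  note [simp] = tensor_pow.simps(2)[symmetric]
  have [simp]: "pow m \<otimes>\<^sub>o (?A1 \<otimes>\<^sub>o ?A1) = pow (Suc (Suc m))"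
    by (simp add: tensor_obj_assoc[symmetric] del: tensor_obj_assoc)
  have RS: "R m \<Zsemi> S m = sym m" "R ?n \<Zsemi> S ?n = sym ?n"
    using ge2 by auto
  \<comment> \<open>\<open>comult_one\<close> and \<open>mult_one\<close> trade the structure maps
    for \<open>R\<close> and \<open>S\<close>, which meet in symmetrizers known from the induction
    hypothesis.\<close>
  have Rd: "R ?n \<Zsemi> \<delta> m (Suc 0) = of_nat ?n \<odot>\<^sub>m (sym ?n \<Zsemi> (R m \<otimes>\<^sub>m ?i))"
    unfolding comult_one[of m] RS(2)[symmetric] by (simp add: cmp_assoc' del: of_nat_Suc)
  have mS: "\<mu> m (Suc 0) \<Zsemi> S ?n = (S m \<otimes>\<^sub>m ?i) \<Zsemi> sym ?n"
    unfolding mult_one[of m] RS(2)[symmetric] by (simp add: cmp_assoc')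
  have "(R ?n \<otimes>\<^sub>m ?i) \<Zsemi> ((\<delta> m (Suc 0) \<otimes>\<^sub>m ?i) \<Zsemi> ?g \<Zsemi> (\<mu> m (Suc 0) \<otimes>\<^sub>m ?i)) \<Zsemi> (S ?n \<otimes>\<^sub>m ?i) =
      ((R ?n \<Zsemi> \<delta> m (Suc 0)) \<otimes>\<^sub>m ?i) \<Zsemi> (?g \<Zsemi> ((\<mu> m (Suc 0) \<Zsemi> S ?n) \<otimes>\<^sub>m ?i))"
    by (simp add: cmp_assoc' interchange' interchange_cmp)
  also have "\<dots> = of_nat ?n \<odot>\<^sub>m (((sym ?n \<Zsemi> (R m \<otimes>\<^sub>m ?i)) \<otimes>\<^sub>m ?i) \<Zsemi>
      (?g \<Zsemi> (((S m \<otimes>\<^sub>m ?i) \<Zsemi> sym ?n) \<otimes>\<^sub>m ?i)))"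
    unfolding Rd mS by (simp del: of_nat_Suc)
  also have "((sym ?n \<Zsemi> (R m \<otimes>\<^sub>m ?i)) \<otimes>\<^sub>m ?i) \<Zsemi> (?g \<Zsemi> (((S m \<otimes>\<^sub>m ?i) \<Zsemi> sym ?n) \<otimes>\<^sub>m ?i)) =
      ?P \<Zsemi> (((R m \<otimes>\<^sub>m (?i \<otimes>\<^sub>m ?i)) \<Zsemi> (?g \<Zsemi> (S m \<otimes>\<^sub>m (?i \<otimes>\<^sub>m ?i)))) \<Zsemi> ?P)"
  proof -
    have "(sym ?n \<Zsemi> (R m \<otimes>\<^sub>m ?i)) \<otimes>\<^sub>m ?i = ?P \<Zsemi> (R m \<otimes>\<^sub>m (?i \<otimes>\<^sub>m ?i))"
      using interchange'[of "sym ?n" "R m \<otimes>\<^sub>m ?i" ?i ?i] by (simp add: tensor_arr_assoc)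
    moreover have "((S m \<otimes>\<^sub>m ?i) \<Zsemi> sym ?n) \<otimes>\<^sub>m ?i = (S m \<otimes>\<^sub>m (?i \<otimes>\<^sub>m ?i)) \<Zsemi> ?P"
      using interchange'[of "S m \<otimes>\<^sub>m ?i" "sym ?n" ?i ?i] by (simp add: tensor_arr_assoc)
    ultimately show ?thesis
      by (simp add: cmp_assoc')
  qed
  also have "(R m \<otimes>\<^sub>m (?i \<otimes>\<^sub>m ?i)) \<Zsemi> (?g \<Zsemi> (S m \<otimes>\<^sub>m (?i \<otimes>\<^sub>m ?i))) = (sym m \<otimes>\<^sub>m (?i \<otimes>\<^sub>m ?i)) \<Zsemi> ?h"
    by (simp add: interchange' RS(1))
  also have "?P \<Zsemi> (((sym m \<otimes>\<^sub>m (?i \<otimes>\<^sub>m ?i)) \<Zsemi> ?h) \<Zsemi> ?P) = ?P \<Zsemi> (?h \<Zsemi> ?P)"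
  proof -
    have "?P \<Zsemi> (sym m \<otimes>\<^sub>m (?i \<otimes>\<^sub>m ?i)) = (sym ?n \<Zsemi> (sym m \<otimes>\<^sub>m id_pow 1)) \<otimes>\<^sub>m ?i"
      using interchange'[of "sym ?n" "sym m \<otimes>\<^sub>m ?i" ?i ?i] by (simp add: tensor_arr_assoc tensor_pow_1)
    also have "\<dots> = ?P"
      using sym_cmp_sym_tensor_id[of m 1] by simp
    finally have "?P \<Zsemi> (sym m \<otimes>\<^sub>m (?i \<otimes>\<^sub>m ?i)) = ?P" .
    then have "(?P \<Zsemi> (sym m \<otimes>\<^sub>m (?i \<otimes>\<^sub>m ?i))) \<Zsemi> (?h \<Zsemi> ?P) = ?P \<Zsemi> (?h \<Zsemi> ?P)"
      by simp
    then show ?thesis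
      by (simp add: cmp_assoc')
  qed
  finally have second: "(R ?n \<otimes>\<^sub>m ?i) \<Zsemi> ((\<delta> m (Suc 0) \<otimes>\<^sub>m ?i) \<Zsemi> ?g \<Zsemi> (\<mu> m (Suc 0) \<otimes>\<^sub>m ?i)) \<Zsemi> (S ?n \<otimes>\<^sub>m ?i) =
      of_nat ?n \<odot>\<^sub>m (?P \<Zsemi> (?h \<Zsemi> ?P))" .
  have "R (Suc ?n) \<Zsemi> S (Suc ?n) = (1 / of_nat (Suc ?n)) \<odot>\<^sub>m
      ((R ?n \<otimes>\<^sub>m ?i) \<Zsemi> (\<mu> ?n (Suc 0) \<Zsemi> \<delta> ?n (Suc 0)) \<Zsemi> (S ?n \<otimes>\<^sub>m ?i))"
    by (simp add: R_Suc[of ?n] S_Suc[of ?n] cmp_assoc' del: of_nat_Suc)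
  also have "(R ?n \<otimes>\<^sub>m ?i) \<Zsemi> (\<mu> ?n (Suc 0) \<Zsemi> \<delta> ?n (Suc 0)) \<Zsemi> (S ?n \<otimes>\<^sub>m ?i) =
      ?P \<oplus>\<^sub>m of_nat ?n \<odot>\<^sub>m (?P \<Zsemi> (?h \<Zsemi> ?P))"
    unfolding second[symmetric] mult_one_comult_one
    by (simp add: add_cmp' cmp_add' interchange' RS(2))
  \<comment> \<open>\<open>sym_Suc_split\<close> with \<open>q = ?n\<close> and
    \<open>r = 1\<close>: its coefficients are \<open>?n + 1\<close>, 1 and \<open>?n\<close>, and
    the insertion at \<open>q - 1 = m\<close> exchanges the last two factors.\<close>
  also have "\<dots> = of_nat (Suc ?n) \<odot>\<^sub>m sym (Suc ?n)"
  proof -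
    have "insert_last ?n m = ?h"
      by (simp add: insert_last_def tensor_pow_1)
    moreover have "(sym ?n \<otimes>\<^sub>m ?i) \<Zsemi> (sym ?n \<otimes>\<^sub>m ?i) = ?P"
      by (simp add: interchange' sym_idem)
    ultimately show ?thesis
      using sym_Suc_split[of ?n 1 ?n] by (simp add: sym_1 tensor_pow_1 of_nat_1[unfolded One_nat_def] del: of_nat_Suc)
  qed
  finally show ?case
    by (simp del: of_nat_Suc)
qed

theorem permutation_splitting_R_S: "permutation_splitting A R S"
  unfolding permutation_splitting_def
  by (simp add: R_cmp_S R_1 S_1 sym_def)

text \<open>Associativity extends the defining recursion, which is the case \<open>p = 1\<close>, to
  all \<open>p\<close>. Composing with \<open>S n \<otimes>\<^sub>m S p\<close> then recovers the
  multiplication from \<open>R\<close> and \<open>S\<close>.\<close>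

lemma R_mult: "(R n \<otimes>\<^sub>m R p) \<Zsemi> \<mu> n p = R (n + p)"
proof (induction p)
  case 0
  show ?case
    by (simp add: mult_zero_right interchange')
next
  case (Suc p)
  let ?i = "ident C (A (Suc 0))"
  note [simp] = tensor_pow.simps(2)[symmetric]
  have "R (n + Suc p) = (((R n \<otimes>\<^sub>m R p) \<Zsemi> \<mu> n p) \<otimes>\<^sub>m ?i) \<Zsemi> \<mu> (n + p) (Suc 0)"
    unfolding Suc by (simp add: R_Suc)
  also have "\<dots> = ((R n \<otimes>\<^sub>m R p) \<otimes>\<^sub>m ?i) \<Zsemi> ((\<mu> n p \<otimes>\<^sub>m ?i) \<Zsemi> \<mu> (n + p) (Suc 0))"
    by (simp add: interchange_cmp)
  also have "\<dots> = (R n \<otimes>\<^sub>m (R p \<otimes>\<^sub>m ?i)) \<Zsemi> ((ident C (A n) \<otimes>\<^sub>m \<mu> p (Suc 0)) \<Zsemi> \<mu> n (p + Suc 0))"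
    unfolding assoc by (simp add: tensor_arr_assoc)
  also have "\<dots> = (R n \<otimes>\<^sub>m R (Suc p)) \<Zsemi> \<mu> n (Suc p)"
    by (simp add: interchange_cmp R_Suc)
  finally show ?case ..
qed

text \<open>Dual to \<open>R_mult\<close>, by coassociativity. The scalars
  \<open>1 / of_nat (Suc p)\<close> and \<open>of_nat (Suc (n + p))\<close> coming from
  \<open>S_Suc\<close> raise \<open>(n + p) choose n\<close> to
  \<open>Suc (n + p) choose n\<close>.\<close>

lemma comult_S: "\<delta> n p \<Zsemi> (S n \<otimes>\<^sub>m S p) = of_nat ((n + p) choose n) \<odot>\<^sub>m S (n + p)"
proof (induction p)
  case 0
  show ?case
    by (simp add: comult_zero_right interchange')
next
  case (Suc p)
  let ?i = "ident C (A (Suc 0))"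
  note [simp] = tensor_pow.simps(2)[symmetric]
  have "\<delta> n (Suc p) \<Zsemi> (S n \<otimes>\<^sub>m S (Suc p)) = (1 / of_nat (Suc p)) \<odot>\<^sub>m
      (\<delta> n (p + Suc 0) \<Zsemi> (S n \<otimes>\<^sub>m (\<delta> p (Suc 0) \<Zsemi> (S p \<otimes>\<^sub>m ?i))))"
    by (simp add: S_Suc del: of_nat_Suc)
  also have "S n \<otimes>\<^sub>m (\<delta> p (Suc 0) \<Zsemi> (S p \<otimes>\<^sub>m ?i)) =
      (ident C (A n) \<otimes>\<^sub>m \<delta> p (Suc 0)) \<Zsemi> ((S n \<otimes>\<^sub>m S p) \<otimes>\<^sub>m ?i)"
    by (simp add: interchange' tensor_arr_assoc)
  also have "\<delta> n (p + Suc 0) \<Zsemi> \<dots> =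
      (\<delta> n (p + Suc 0) \<Zsemi> (ident C (A n) \<otimes>\<^sub>m \<delta> p (Suc 0))) \<Zsemi> ((S n \<otimes>\<^sub>m S p) \<otimes>\<^sub>m ?i)"
    by (simp add: cmp_assoc')
  also have "\<dots> = \<delta> (n + p) (Suc 0) \<Zsemi> ((\<delta> n p \<Zsemi> (S n \<otimes>\<^sub>m S p)) \<otimes>\<^sub>m ?i)"
    unfolding coassoc[symmetric] by (simp add: cmp_assoc' interchange')
  also have "\<dots> = of_nat ((n + p) choose n) \<odot>\<^sub>m (\<delta> (n + p) (Suc 0) \<Zsemi> (S (n + p) \<otimes>\<^sub>m ?i))"
    unfolding Suc by simp
  also have "\<delta> (n + p) (Suc 0) \<Zsemi> (S (n + p) \<otimes>\<^sub>m ?i) = of_nat (Suc (n + p)) \<odot>\<^sub>m S (Suc (n + p))"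
    by (simp add: S_Suc del: of_nat_Suc)
  finally have eq: "\<delta> n (Suc p) \<Zsemi> (S n \<otimes>\<^sub>m S (Suc p)) =
      (1 / of_nat (Suc p) * (of_nat ((n + p) choose n) * of_nat (Suc (n + p)))) \<odot>\<^sub>m S (Suc (n + p))"
    by (simp del: of_nat_Suc)
  have "Suc p * (Suc (n + p) choose n) = Suc (n + p) * ((n + p) choose n)"
    using binomial_absorb_comp[of "Suc (n + p)" n] by (simp add: Suc_diff_le)
  then have "of_nat (Suc p) * of_nat (Suc (n + p) choose n) =
      (of_nat (Suc (n + p)) * of_nat ((n + p) choose n) :: rat)"
    by (metis of_nat_mult)
  then have "1 / of_nat (Suc p) * (of_nat ((n + p) choose n) * of_nat (Suc (n + p))) =
      (of_nat ((n + Suc p) choose n) :: rat)"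
    by (simp add: field_simps del: of_nat_Suc)
  then show ?case
    unfolding eq by simp
qed

text \<open>\<open>R_mult\<close> and \<open>comult_S\<close> become formulas for
  \<open>\<mu>\<close> and \<open>\<delta>\<close> once tensor products of \<open>S\<close> and
  \<open>R\<close> are cancelled by \<open>S_cmp_R\<close>.\<close>

theorem to_bimonoid_to_splitting: "to_bimonoid (R, S) = (\<mu>, \<delta>, \<eta>, \<epsilon>)"
proof -
  have "(S n \<otimes>\<^sub>m S p) \<Zsemi> R (n + p) = \<mu> n p" for n p
    unfolding R_mult[symmetric] by (simp add: interchange_cmp)
  moreover have "of_nat ((n + p) choose n) \<odot>\<^sub>m (S (n + p) \<Zsemi> (R n \<otimes>\<^sub>m R p)) = \<delta> n p" for n p
  proof -
    have "of_nat ((n + p) choose n) \<odot>\<^sub>m (S (n + p) \<Zsemi> (R n \<otimes>\<^sub>m R p)) =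
        (\<delta> n p \<Zsemi> (S n \<otimes>\<^sub>m S p)) \<Zsemi> (R n \<otimes>\<^sub>m R p)"
      unfolding comult_S by simp
    then show ?thesis
      by (simp add: cmp_assoc' interchange')
  qed
  ultimately show ?thesis
    by (simp add: to_bimonoid_def fun_eq_iff)
qed

lemma to_splitting_eq: "to_splitting A (\<mu>, \<delta>, \<eta>, \<epsilon>) = (R, S)"
  by (simp add: R_def S_def)

end

section \<open>The bijection\<close>

theorem theorem24:
  fixes C :: "('o, 'm, 'x) linear_monoidal_category_scheme"
    and A :: "nat \<Rightarrow> 'o"
  assumes "nnrat_linear_symmetric_monoidal_category C"
    and "\<forall>n. A n \<in> Obj C"
  shows
    "bij_betw (nnrat_linear_symmetric_monoidal_category.to_bimonoid C)
       (nnrat_linear_symmetric_monoidal_category.permutation_splittings C A)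
       (nnrat_linear_symmetric_monoidal_category.binomial_bimonoids C A) \<and>
     bij_betw (nnrat_linear_symmetric_monoidal_category.to_splitting C A)
       (nnrat_linear_symmetric_monoidal_category.binomial_bimonoids C A)
       (nnrat_linear_symmetric_monoidal_category.permutation_splittings C A) \<and>
     (\<forall>x \<in> nnrat_linear_symmetric_monoidal_category.permutation_splittings C A.
        nnrat_linear_symmetric_monoidal_category.to_splitting C A
          (nnrat_linear_symmetric_monoidal_category.to_bimonoid C x) = x) \<and>
     (\<forall>y \<in> nnrat_linear_symmetric_monoidal_category.binomial_bimonoids C A.
        nnrat_linear_symmetric_monoidal_category.to_bimonoid C
          (nnrat_linear_symmetric_monoidal_category.to_splitting C A y) = y)"
proof -
  interpret nnrat_linear_symmetric_monoidal_category C
    by (rule assms(1))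
  have to_bimonoid: "to_bimonoid x \<in> binomial_bimonoids A \<and> to_splitting A (to_bimonoid x) = x"
    if x: "x \<in> permutation_splittings A" for x
  proof -
    obtain r s where rs: "x = (r, s)"
      by (cases x)
    interpret splitting C A r s
      using x assms(2) by unfold_locales (auto simp: permutation_splittings_def rs)
    show ?thesis
      using binomial_bimonoid_mult_comult to_splitting_to_bimonoid
      by (simp add: rs binomial_bimonoids_def to_bimonoid_eq)
  qed
  have to_splitting: "to_splitting A y \<in> permutation_splittings A \<and> to_bimonoid (to_splitting A y) = y"
    if y: "y \<in> binomial_bimonoids A" for y
  proof -
    obtain \<mu> \<delta> \<eta> \<epsilon> where y_eq: "y = (\<mu>, \<delta>, \<eta>, \<epsilon>)"
      by (cases y)
    interpret bimonoid C A \<mu> \<delta> \<eta> \<epsilon>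
      using y assms(2) by unfold_locales (auto simp: binomial_bimonoids_def y_eq)
    show ?thesis
      using permutation_splitting_R_S to_bimonoid_to_splitting
      by (simp add: y_eq permutation_splittings_def to_splitting_eq)
  qed
  have "bij_betw to_bimonoid (permutation_splittings A) (binomial_bimonoids A)"
    by (rule bij_betw_byWitness[where f' = "to_splitting A"])
      (use to_bimonoid to_splitting in auto)
  moreover have "bij_betw (to_splitting A) (binomial_bimonoids A) (permutation_splittings A)"
    by (rule bij_betw_byWitness[where f' = to_bimonoid])
      (use to_bimonoid to_splitting in auto)
  ultimately show ?thesis
    using to_bimonoid to_splitting by blast
qed

end
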